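(* Consider the linear regression model for a mixture with varying concentrations described in the context, and fix a component number $m\in\{1,\dots,M\}$. Assume that 1. $\mathsf E[(X^i(O))^4\,|\,\kappa(O)=k]<\infty$ and $\mathsf E[(\varepsilon(O))^4\,|\,\kappa(O)=k]<\infty$ for all $k=1,\dots,M$ and $i=1,\dots,d$. 2. The matrix $\mathbf D=\mathbf D^{(m)}$ is nonsingular. 3. There exists $C>0$ such that $\det\boldsymbol\Gamma_N>C$ for all $N$ large enough. 4. For all $s,p=1,\dots,M$ the limit $\langle(\mathbf a^m)^2\mathbf p^s\mathbf p^p\rangle=\lim_{N\to\infty}\frac1N\sum_{j=1}^N(a_{j;N}^m)^2p_{j;N}^sp_{j;N}^p$ exists (and is finite). Then $\sqrt N\,(\hat{\mathbf b}^{(m)}_{;N}-\mathbf b^{(m)})$ converges weakly, as $N\to\infty$, to the normal distribution $N(0,\mathbf V)$ on $\mathbb R^d$, where $$\mathbf V=\mathbf D^{-1}\boldsymbol\Sigma\mathbf D^{-1},\qquad \boldsymbol\Sigma=(\Sigma^{ik})_{i,k=1}^d,$$ $$\Sigma^{ik}=\sum_{s=1}^M\big\langle(\mathbf a^m)^2\mathbf p^s\big\rangle\Big(D^{ik(s)}(\sigma^{(s)})^2+(\mathbf b^{(s)}-\mathbf b^{(m)})^T\mathbf L^{ik(s)}(\mathbf b^{(s)}-\mathbf b^{(m)})\Big)$$ $$\qquad-\sum_{s=1}^M\sum_{p=1}^M\big\langle(\mathbf a^m)^2\mathbf p^s\mathbf p^p\big\rangle(\mathbf b^{(s)}-\mathbf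 b^{(m)})^T\mathbf M^{ik(s,p)}(\mathbf b^{(p)}-\mathbf b^{(m)}).$$
   Context: **Model.** Fix integers $M\ge1$ (number of mixture components) and $d\ge1$ (number of regressors). For each sample size $N=1,2,\dots$ one has subjects $O_1,\dots,O_N$. Subject $O_j$ has an unobserved component number $\kappa_j=\kappa(O_j)\in\{1,\dots,M\}$ with known probabilities $p_{j;N}^k=\mathsf P\{\kappa_j=k\}$, $k=1,\dots,M$ (so $p_{j;N}^k\ge0$ and $\sum_{k=1}^M p_{j;N}^k=1$), and an observed vector $\xi_j=(Y_j,X_j^1,\dots,X_j^d)^T$. The variables satisfy $$Y_j=\sum_{i=1}^d b_i^{(\kappa_j)}X_j^i+\varepsilon_j,$$ where $\mathbf b^{(k)}=(b_1^{(k)},\dots,b_d^{(k)})^T\in\mathbb R^d$, $k=1,\dots,M$, are nonrandom coefficient vectors. Given $\kappa_j=k$, the joint distribution of the regressor vector $\mathbf X(O_j)=(X_j^1,\dots,X_j^d)^T$ and the error $\varepsilon_j$ depends only on $k$ (not on $j$ or $N$); $\varepsilon_j$ is conditionally independent of $\mathbf X(O_j)$ given $\kappa_j$, and has conditional mean zero. For each $N$, the pairs $(\kappa_j,\xi_j)$, $j=1,\dots,N$, are independent. The data form a triangular array (the index $N$ is suppressed in $\kappa_j,\xi_j$): no relation between the data for different $N$ is assumed. Write $O$ for a generic subject, with regressors $X^i(O)$ and error $\varepsilon(O)$, so that $\mathsf E[\,\cdot\,|\,\kappa(O)=k]$ denotes expectation under the distribution of the $k$th component (the common conditional distribution given $\kappa_j=k$).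 **Moments.** $\mathbf D^{(k)}=\mathsf E[\mathbf X(O)\mathbf X(O)^T\,|\,\kappa(O)=k]$ is the $d\times d$ matrix of second moments of the regressors, with entries $D^{il(k)}=\mathsf E[X^i(O)X^l(O)\,|\,\kappa(O)=k]$; $(\sigma^{(k)})^2=\mathsf E[\varepsilon(O)^2\,|\,\kappa(O)=k]$. For $i,k\in\{1,\dots,d\}$ and $s,p\in\{1,\dots,M\}$ define the $d\times d$ matrices $$\mathbf L^{ik(s)}=\big(\mathsf E[X^i(O)X^k(O)X^q(O)X^l(O)\,|\,\kappa(O)=s]\big)_{l,q=1}^d,\qquad \mathbf M^{ik(s,p)}=\big(D^{il(s)}D^{kq(p)}\big)_{l,q=1}^d$$ (row index $l$, column index $q$). **Weights.** $\boldsymbol\Gamma_N$ is the $M\times M$ matrix with entries $\frac1N\sum_{j=1}^N p_{j;N}^l p_{j;N}^k$, $l,k=1,\dots,M$. Let $\gamma_{lk;N}$ be its $(l,k)$th minor (the determinant of the matrix obtained by deleting row $l$ and column $k$). When $\boldsymbol\Gamma_N$ is nonsingular, put $$a_{j;N}^m=\frac1{\det\boldsymbol\Gamma_N}\sum_{k=1}^M(-1)^{k+m}\gamma_{mk;N}\,p_{j;N}^k,$$ that is, $a_{j;N}^m=\sum_{k=1}^M(\boldsymbol\Gamma_N^{-1})_{mk}\,p_{j;N}^k$. These weights may be negative. **Averages.** Angle brackets denote limits of averages over $j$ of elementwise products: $\langle(\mathbf a^m)^2\mathbf p^s\rangle=\lim_{N\to\infty}\frac1N\sum_{j=1}^N(a_{j;N}^m)^2p_{j;N}^s$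 and $\langle(\mathbf a^m)^2\mathbf p^s\mathbf p^p\rangle=\lim_{N\to\infty}\frac1N\sum_{j=1}^N(a_{j;N}^m)^2p_{j;N}^sp_{j;N}^p$. (Since $\sum_{p}p_{j;N}^p=1$, existence of the latter limits for all $s,p$ gives existence of the former.) **Estimator (modified least squares, MVC-LS).** Let $\mathbf X=(X_j^i)_{j=1,\dots,N;\,i=1,\dots,d}$ be the $N\times d$ matrix of observed regressors, $\mathbf Y=(Y_1,\dots,Y_N)^T$, and $\mathbf A=\operatorname{diag}(a_{1;N}^m,\dots,a_{N;N}^m)$. Then $$\hat{\mathbf b}^{(m)}_{;N}=(\mathbf X^T\mathbf A\mathbf X)^{-1}\mathbf X^T\mathbf A\mathbf Y.$$ On the event where $\mathbf X^T\mathbf A\mathbf X$ is singular, and for those (finitely many, under assumption 3) $N$ with $\boldsymbol\Gamma_N$ singular, the estimator is assigned an arbitrary value, e.g. $0$. The normal distribution $N(0,\mathbf V)$ may be degenerate. *)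

theory Defs
  imports "HOL-Probability.Probability"
begin

text \<open>
  The component numbers are the elements of a finite type \<open>'k\<close> (so M is \<open>CARD('k)\<close>) and the
  regressors are indexed by a finite type \<open>'d\<close>.  Each sample size \<open>N\<close> has its own probability
  space \<open>P N\<close>, and the subjects are \<open>j = 1, \<dots>, N\<close>; nothing relates different values of \<open>N\<close>.
  \<open>F k\<close> is the law of (regressor vector, error) in component \<open>k\<close>.
\<close>

locale mixture_regression =
  fixes P :: "nat \<Rightarrow> 'w measure"
    and \<kappa> :: "nat \<Rightarrow> nat \<Rightarrow> 'w \<Rightarrow> 'k::finite"
    and X :: "nat \<Rightarrow> nat \<Rightarrow> 'w \<Rightarrow> real ^ 'd"
    and \<epsilon> :: "nat \<Rightarrow> nat \<Rightarrow> 'w \<Rightarrow> real"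
    and Y :: "nat \<Rightarrow> nat \<Rightarrow> 'w \<Rightarrow> real"
    and p :: "nat \<Rightarrow> nat \<Rightarrow> 'k \<Rightarrow> real"
    and b :: "'k \<Rightarrow> real ^ 'd"
    and F :: "'k \<Rightarrow> ((real ^ 'd) \<times> real) measure"
  assumes prob_space_P: "N \<ge> 1 \<Longrightarrow> prob_space (P N)"
    and independent_subjects: "N \<ge> 1 \<Longrightarrow>
          prob_space.indep_vars (P N) (\<lambda>_. count_space UNIV \<Otimes>\<^sub>M borel)
            (\<lambda>j \<omega>. (\<kappa> N j \<omega>, (Y N j \<omega>, X N j \<omega>))) {1..N}"
    and regression: "j \<in> {1..N} \<Longrightarrow> \<omega> \<in> space (P N) \<Longrightarrow>
          Y N j \<omega> = (\<Sum>i\<in>UNIV. b (\<kappa> N j \<omega>) $ i * X N j \<omega> $ i) + \<epsilon> N j \<omega>"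
    and concentration: "j \<in> {1..N} \<Longrightarrow>
          measure (P N) {\<omega> \<in> space (P N). \<kappa> N j \<omega> = k} = p N j k"
    \<comment> \<open>\<^const>\<open>uniform_measure\<close> is the conditional probability given the event \<open>\<kappa> = k\<close>,
        which is meaningful only for events of positive probability.\<close>
    and conditional_law: "j \<in> {1..N} \<Longrightarrow> p N j k > 0 \<Longrightarrow>
          distr (uniform_measure (P N) {\<omega> \<in> space (P N). \<kappa> N j \<omega> = k}) borel
            (\<lambda>\<omega>. (X N j \<omega>, \<epsilon> N j \<omega>)) = F k"
    and prob_space_F: "prob_space (F k)"
    and sets_F: "sets (F k) = sets borel"
    and regressors_indep_error: "F k = distr (F k) borel fst \<Otimes>\<^sub>M distr (F k) borel snd"
    and error_integrable: "integrable (F k) snd"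
    and error_mean_zero: "(\<integral>z. snd z \<partial>F k) = 0"

definition second_moments :: "((real ^ 'd) \<times> real) measure \<Rightarrow> real ^ 'd ^ 'd" where
  "second_moments Q = (\<chi> i l. \<integral>z. fst z $ i * fst z $ l \<partial>Q)"

definition error_variance :: "((real ^ 'd) \<times> real) measure \<Rightarrow> real" where
  "error_variance Q = (\<integral>z. (snd z)\<^sup>2 \<partial>Q)"

definition L_matrix :: "((real ^ 'd) \<times> real) measure \<Rightarrow> 'd \<Rightarrow> 'd \<Rightarrow> real ^ 'd ^ 'd" where
  "L_matrix Q i k = (\<chi> l q. \<integral>z. fst z $ i * fst z $ k * fst z $ q * fst z $ l \<partial>Q)"

definition M_matrix ::
    "((real ^ 'd) \<times> real) measure \<Rightarrow> ((real ^ 'd) \<times> real) measure \<Rightarrow> 'd \<Rightarrow> 'd \<Rightarrow> real ^ 'd ^ 'd" where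
  "M_matrix Q R i k = (\<chi> l q. second_moments Q $ i $ l * second_moments R $ k $ q)"

definition Gamma_matrix :: "(nat \<Rightarrow> nat \<Rightarrow> 'k \<Rightarrow> real) \<Rightarrow> nat \<Rightarrow> real ^ 'k ^ 'k::finite" where
  "Gamma_matrix p N = (\<chi> l k. (\<Sum>j=1..N. p N j l * p N j k) / real N)"

text \<open>
  The cofactor expression \<open>\<Sum>\<^sub>k (-1)^(k+m) \<gamma>\<^sub>m\<^sub>k p\<^sub>j\<^sup>k / det \<Gamma>\<close> for the weights is written with the
  inverse matrix (the matrix is symmetric).  The value is unspecified when it is singular.
\<close>

definition weight :: "(nat \<Rightarrow> nat \<Rightarrow> 'k::finite \<Rightarrow> real) \<Rightarrow> 'k \<Rightarrow> nat \<Rightarrow> nat \<Rightarrow> real" where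
  "weight p m N j = (\<Sum>k\<in>UNIV. matrix_inv (Gamma_matrix p N) $ m $ k * p N j k)"

definition average :: "(nat \<Rightarrow> nat \<Rightarrow> real) \<Rightarrow> nat \<Rightarrow> real" where
  "average c N = (\<Sum>j=1..N. c N j) / real N"

definition limit_average :: "(nat \<Rightarrow> nat \<Rightarrow> real) \<Rightarrow> real" where
  "limit_average c = lim (average c)"

text \<open>
  \<open>X\<^sup>T A X\<close> and \<open>X\<^sup>T A Y\<close> for the design matrix with rows \<open>x 1, \<dots>, x N\<close>, the response vector
  \<open>(y 1, \<dots>, y N)\<close> and the diagonal matrix \<open>A = diag (a 1, \<dots>, a N)\<close>.
\<close>

definition weighted_gram :: "nat \<Rightarrow> (nat \<Rightarrow> real) \<Rightarrow> (nat \<Rightarrow> real ^ 'd) \<Rightarrow> real ^ 'd ^ 'd" where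
  "weighted_gram N a x = (\<chi> i l. \<Sum>j=1..N. x j $ i * a j * x j $ l)"

definition weighted_cross ::
    "nat \<Rightarrow> (nat \<Rightarrow> real) \<Rightarrow> (nat \<Rightarrow> real ^ 'd) \<Rightarrow> (nat \<Rightarrow> real) \<Rightarrow> real ^ 'd" where
  "weighted_cross N a x y = (\<chi> i. \<Sum>j=1..N. x j $ i * a j * y j)"

text \<open>
  The value of the estimator is left completely arbitrary (up to measurability) wherever one of
  the two matrices to be inverted is singular.
\<close>

definition mvc_ls_estimator ::
    "(nat \<Rightarrow> 'w measure) \<Rightarrow> (nat \<Rightarrow> nat \<Rightarrow> 'w \<Rightarrow> real ^ 'd) \<Rightarrow> (nat \<Rightarrow> nat \<Rightarrow> 'w \<Rightarrow> real) \<Rightarrow>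
     (nat \<Rightarrow> nat \<Rightarrow> 'k::finite \<Rightarrow> real) \<Rightarrow> 'k \<Rightarrow> (nat \<Rightarrow> 'w \<Rightarrow> real ^ 'd) \<Rightarrow> bool" where
  "mvc_ls_estimator P X Y p m bhat \<longleftrightarrow>
     (\<forall>N\<ge>1. bhat N \<in> borel_measurable (P N) \<and>
       (invertible (Gamma_matrix p N) \<longrightarrow>
         (\<forall>\<omega>\<in>space (P N).
           let G = weighted_gram N (weight p m N) (\<lambda>j. X N j \<omega>);
               h = weighted_cross N (weight p m N) (\<lambda>j. X N j \<omega>) (\<lambda>j. Y N j \<omega>)
           in invertible G \<longrightarrow> bhat N \<omega> = matrix_inv G *v h)))"

definition Sigma_matrix ::
    "(nat \<Rightarrow> nat \<Rightarrow> 'k::finite \<Rightarrow> real) \<Rightarrow> ('k \<Rightarrow> real ^ 'd) \<Rightarrow>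
     ('k \<Rightarrow> ((real ^ 'd) \<times> real) measure) \<Rightarrow> 'k \<Rightarrow> real ^ 'd ^ 'd" where
  "Sigma_matrix p b F m = (\<chi> i k.
     (\<Sum>s\<in>UNIV. limit_average (\<lambda>N j. (weight p m N j)\<^sup>2 * p N j s) *
        (second_moments (F s) $ i $ k * error_variance (F s)
          + (b s - b m) \<bullet> (L_matrix (F s) i k *v (b s - b m))))
     - (\<Sum>s\<in>UNIV. \<Sum>r\<in>UNIV. limit_average (\<lambda>N j. (weight p m N j)\<^sup>2 * p N j s * p N j r) *
          ((b s - b m) \<bullet> (M_matrix (F s) (F r) i k *v (b r - b m)))))"

definition asymptotic_covariance ::
    "(nat \<Rightarrow> nat \<Rightarrow> 'k::finite \<Rightarrow> real) \<Rightarrow> ('k \<Rightarrow> real ^ 'd) \<Rightarrow>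
     ('k \<Rightarrow> ((real ^ 'd) \<times> real) measure) \<Rightarrow> 'k \<Rightarrow> real ^ 'd ^ 'd" where
  "asymptotic_covariance p b F m =
     matrix_inv (second_moments (F m)) ** Sigma_matrix p b F m
       ** matrix_inv (second_moments (F m))"

definition standard_normal_vector :: "(real ^ 'd) measure" where
  "standard_normal_vector =
     distr (\<Pi>\<^sub>M i\<in>(UNIV :: 'd::finite set). density lborel (\<lambda>x. ennreal (std_normal_density x)))
       borel (\<lambda>f. \<chi> i. f i)"

text \<open>
  \<open>is_normal_distribution \<nu> \<mu> V\<close> says that \<open>\<nu>\<close> is the normal distribution with mean \<open>\<mu>\<close> and
  covariance matrix \<open>V\<close>, i.e. the law of \<open>\<mu> + A Z\<close> with \<open>Z\<close> standard normal and \<open>A A\<^sup>T = V\<close>.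
  The law does not depend on the choice of \<open>A\<close>, exists iff \<open>V\<close> is symmetric and positive
  semidefinite, and is degenerate for singular \<open>V\<close>.
\<close>

definition is_normal_distribution :: "(real ^ 'd) measure \<Rightarrow> real ^ 'd \<Rightarrow> real ^ 'd ^ 'd \<Rightarrow> bool" where
  "is_normal_distribution \<nu> \<mu> V \<longleftrightarrow>
     (\<exists>A :: real ^ 'd ^ 'd. A ** transpose A = V \<and>
        \<nu> = distr standard_normal_vector borel (\<lambda>z. \<mu> + A *v z))"

text \<open>
  \<^const>\<open>weak_conv_m\<close> only covers measures on the real line, hence the definition by bounded
  continuous test functions.
\<close>

definition converges_weakly ::
    "(nat \<Rightarrow> 'a::metric_space measure) \<Rightarrow> 'a measure \<Rightarrow> bool" where
  "converges_weakly \<mu> \<nu> \<longleftrightarrow>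
     (\<forall>f :: 'a \<Rightarrow> real. continuous_on UNIV f \<longrightarrow> bounded (range f) \<longrightarrow>
        (\<lambda>n. \<integral>x. f x \<partial>\<mu> n) \<longlonglongrightarrow> (\<integral>x. f x \<partial>\<nu>))"

end

theory Submission
  imports Defs
begin

text \<open>
  Write \<open>S\<^sub>N = N\<^sup>-\<^sup>1\<^sup>/\<^sup>2 \<Sum>\<^sub>j a\<^sub>j (Y\<^sub>j - b\<^sup>m \<bullet> X\<^sub>j) X\<^sub>j\<close> for the normalised weighted score at the
  true coefficients and \<open>G\<^sub>N = X\<^sup>T A X\<close>.  The normal equations give
  \<open>(G\<^sub>N / N) \<surd>N (b\<^sub>N - b\<^sup>m) = S\<^sub>N\<close> for the estimator \<open>b\<^sub>N\<close> where \<open>G\<^sub>N\<close> is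
  invertible, so everything rests on the law of \<open>S\<^sub>N\<close> and on \<open>G\<^sub>N / N\<close>.

  The weights are the row \<open>m\<close> of the inverse of \<open>\<Gamma>\<^sub>N\<close> applied to the concentrations, whence
  \<open>(1/N) \<Sum>\<^sub>j a\<^sub>j p\<^sub>j\<^sup>k = \<delta>\<^sub>m\<^sub>k\<close> (\<open>sum_weight_concentration\<close>): weighted averages estimate moments of
  component \<open>m\<close> without bias.  As \<open>det \<Gamma>\<^sub>N\<close> stays away from zero and the entries of \<open>\<Gamma>\<^sub>N\<close> are at
  most 1, Cramer's rule bounds the weights uniformly (\<open>weights_bounded\<close>).  Two consequences follow.
  The entries of \<open>G\<^sub>N / N\<close> have mean \<open>D\<close> and variance of order \<open>1/N\<close>, so \<open>G\<^sub>N / N\<close> tends to \<open>D\<close> in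
  probability.  And \<open>S\<^sub>N\<close> has mean zero, because the score of component \<open>m\<close> is centred; the
  covariance of one score is the second moment averaged over the components minus the product of the
  averaged means, and its weighted average over \<open>j\<close> tends to \<open>\<Sigma>\<close>
  (\<open>Sigma_quadratic_form\<close>, \<open>score_variance_tendsto\<close>).  The Lindeberg condition holds because the
  summands are dominated by finitely many square integrable laws, one for each component, times a
  constant of order \<open>N\<^sup>-\<^sup>1\<^sup>/\<^sup>2\<close>.  Hence \<open>c \<bullet> S\<^sub>N\<close> is asymptotically normal in each direction \<open>c\<close>.

  Replacing \<open>G\<^sub>N / N\<close> by \<open>D\<close> changes the solution of the linear system only by a small multiple of
  its size (\<open>perturbed_linear_system\<close>), so \<open>\<surd>N (b\<^sub>N - b\<^sup>m) - D\<^sup>-\<^sup>1 S\<^sub>N\<close> tends to zero in probability.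
  The statement thus reduces to a Slutsky argument on the level of characteristic functions
  (\<open>converges_weakly_perturbed\<close>) and to the continuity theorem of Levy in \<open>\<real>\<^sup>d\<close>
  (\<open>levy_continuity_multivariate\<close>).  That the limit law exists, i.e. that \<open>D\<^sup>-\<^sup>1 \<Sigma> D\<^sup>-\<^sup>1\<close> is of the
  form \<open>A A\<^sup>T\<close>, follows because \<open>\<Sigma>\<close> is symmetric and \<open>c \<bullet> \<Sigma> c\<close> is a limit of second moments and
  therefore nonnegative.
\<close>

section \<open>Weak convergence from characteristic functions\<close>

text \<open>
  Phases make sines and cosines one case,
  and arbitrary real frequencies make the class closed under products.
\<close>

inductive trig_poly :: "('a::euclidean_space \<Rightarrow> real) \<Rightarrow> bool" where
  wave: "trig_poly (\<lambda>x. c * cos (t \<bullet> x + \<alpha>))"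
| add: "trig_poly f \<Longrightarrow> trig_poly g \<Longrightarrow> trig_poly (\<lambda>x. f x + g x)"

lemma trig_poly_const: "trig_poly (\<lambda>x. c)"
  using trig_poly.wave[of c 0 0] by simp

lemma trig_poly_sum:
  assumes "\<And>i. i \<in> I \<Longrightarrow> trig_poly (f i)"
  shows "trig_poly (\<lambda>x. \<Sum>i\<in>I. f i x)"
  using assms
  by (induction I rule: infinite_finite_induct) (auto intro: trig_poly_const trig_poly.add)

lemma trig_poly_mult:
  fixes f g :: "'a::euclidean_space \<Rightarrow> real"
  assumes "trig_poly f" "trig_poly g"
  shows "trig_poly (\<lambda>x. f x * g x)"
  using assms(1)
proof (induction rule: trig_poly.induct)
  case (wave c t \<alpha>)
  show ?case
    using assms(2)
  proof (induction rule: trig_poly.induct)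
    case (wave d s \<beta>)
    have "(\<lambda>x. c * cos (t \<bullet> x + \<alpha>) * (d * cos (s \<bullet> x + \<beta>))) =
      (\<lambda>x. (c * d / 2) * cos ((t - s) \<bullet> x + (\<alpha> - \<beta>)) + (c * d / 2) * cos ((t + s) \<bullet> x + (\<alpha> + \<beta>)))"
    proof
      fix x
      have "cos ((t - s) \<bullet> x + (\<alpha> - \<beta>)) + cos ((t + s) \<bullet> x + (\<alpha> + \<beta>))
          = 2 * (cos (t \<bullet> x + \<alpha>) * cos (s \<bullet> x + \<beta>))"
        using cos_times_cos[of "t \<bullet> x + \<alpha>" "s \<bullet> x + \<beta>"] by (simp add: algebra_simps inner_diff_left inner_add_left)
      then show "c * cos (t \<bullet> x + \<alpha>) * (d * cos (s \<bullet> x + \<beta>)) =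
        (c * d / 2) * cos ((t - s) \<bullet> x + (\<alpha> - \<beta>)) + (c * d / 2) * cos ((t + s) \<bullet> x + (\<alpha> + \<beta>))"
        by algebra
    qed
    then show ?case
      by (simp only: trig_poly.add trig_poly.wave)
  next
    case (add f g)
    then show ?case by (simp add: distrib_left trig_poly.add)
  qed
next
  case (add f h)
  then show ?case by (simp add: distrib_right trig_poly.add)
qed

text \<open>
  The box with side \<open>2 \<pi> r\<close> wrapped around a torus; the torus sits in a Euclidean space as the set of
  pairs (vector of cosines, vector of sines), where polynomial approximation is available.
\<close>

definition torus_map :: "real \<Rightarrow> 'a::euclidean_space \<Rightarrow> 'a \<times> 'a" where
  "torus_map r x = (\<Sum>i\<in>Basis. cos ((x \<bullet> i) / r) *\<^sub>R i, \<Sum>i\<in>Basis. sin ((x \<bullet> i) / r) *\<^sub>R i)"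

text \<open>
  A coordinate on the torus is a wave, and waves are closed under sums and products.
\<close>

lemma trig_poly_torus_map:
  assumes "real_polynomial_function g"
  shows "trig_poly (\<lambda>x. g (torus_map r x))"
  using assms
proof (induction rule: real_polynomial_function.induct)
  case (linear f)
  then interpret bounded_linear f .
  have "f (torus_map r x) = (\<Sum>i\<in>Basis. f (i, 0) * cos ((i /\<^sub>R r) \<bullet> x + 0) + f (0, i) * cos ((i /\<^sub>R r) \<bullet> x + (- (pi / 2))))" for x
  proof -
    have "torus_map r x = (\<Sum>i\<in>Basis. cos ((x \<bullet> i) / r) *\<^sub>R (i, 0) + sin ((x \<bullet> i) / r) *\<^sub>R (0, i))"
      by (simp add: torus_map_def prod_eq_iff fst_sum snd_sum)
    then have "f (torus_map r x) = (\<Sum>i\<in>Basis. f (cos ((x \<bullet> i) / r) *\<^sub>R (i, 0) + sin ((x \<bullet> i) / r) *\<^sub>R (0, i)))"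
      by (simp only: sum)
    also have "\<dots> = (\<Sum>i\<in>Basis. f (i, 0) * cos ((i /\<^sub>R r) \<bullet> x + 0) + f (0, i) * cos ((i /\<^sub>R r) \<bullet> x + (- (pi / 2))))"
    proof (rule sum.cong[OF refl])
      fix i :: 'a
      have "cos (y + - (pi / 2)) = sin y" for y :: real
        by (simp add: cos_diff)
      moreover have "(i /\<^sub>R r) \<bullet> x = (x \<bullet> i) / r"
        by (simp add: inner_commute divide_inverse)
      ultimately show "f (cos ((x \<bullet> i) / r) *\<^sub>R (i, 0) + sin ((x \<bullet> i) / r) *\<^sub>R (0, i)) =
          f (i, 0) * cos ((i /\<^sub>R r) \<bullet> x + 0) + f (0, i) * cos ((i /\<^sub>R r) \<bullet> x + (- (pi / 2)))"
        unfolding add scaleR by simp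
    qed
    finally show ?thesis .
  qed
  then show ?case
    by (simp only:) (intro trig_poly_sum trig_poly.add trig_poly.wave)
qed (auto intro: trig_poly_const trig_poly.add trig_poly_mult)

text \<open>
  The function \<open>f\<close> is transported to the torus.  In a point with sines \<open>v\<close> and cosines \<open>u\<close> it takes
  the value of \<open>f\<close> at \<open>r arcsin v\<close>, which is continuous on the whole torus, and it is damped by a factor
  that is 1 where all cosines are at least 1/2 and 0 where one of them is negative.  The first region
  contains the image of the cube in question, on which the arcsine inverts the sine.  A polynomial
  that approximates this function uniformly on the torus is a trigonometric polynomial that is close
  to \<open>f\<close> on the cube and, in contrast to an approximation on the cube alone, bounded by about the same
  constant as \<open>f\<close> everywhere.
\<close>

lemma cube_cutoff_trig_approx:
  fixes f :: "'a::euclidean_space \<Rightarrow> real"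
  assumes f: "continuous_on UNIV f" and bd: "\<And>x. \<bar>f x\<bar> \<le> B" and r: "r > 0" and e: "e > 0"
  obtains g where "trig_poly g" "\<And>x. \<bar>g x\<bar> \<le> B + e"
    "\<And>x. (\<And>i. i \<in> Basis \<Longrightarrow> \<bar>x \<bullet> i\<bar> \<le> r * pi / 3) \<Longrightarrow> \<bar>f x - g x\<bar> < e"
proof -
  define S :: "('a \<times> 'a) set" where "S = cbox (- One) One \<times> cbox (- One) One"
  define cut where "cut c = max 0 (min 1 (2 * c))" for c :: real
  define h :: "'a \<times> 'a \<Rightarrow> real" where "h = (\<lambda>(u, v). f (\<Sum>i\<in>Basis. (r * arcsin (v \<bullet> i)) *\<^sub>R i) * (\<Prod>i\<in>Basis. cut (u \<bullet> i)))"
  have S: "compact S" by (simp add: S_def compact_Times)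
  have torus_in: "torus_map r x \<in> S" for x
    by (auto simp: S_def torus_map_def mem_box)
  have h_cont: "continuous_on S h"
  proof -
    have arc: "continuous_on S (\<lambda>z. \<Sum>i\<in>Basis. (r * arcsin (snd z \<bullet> i)) *\<^sub>R i)"
      by (intro continuous_intros) (auto simp: S_def mem_box)
    have "continuous_on S (\<lambda>z. f (\<Sum>i\<in>Basis. (r * arcsin (snd z \<bullet> i)) *\<^sub>R i))"
      by (rule continuous_on_compose2[OF f arc]) auto
    moreover have "continuous_on S (\<lambda>z. \<Prod>i\<in>Basis. cut (fst z \<bullet> i))"
      unfolding cut_def by (intro continuous_intros)
    ultimately show ?thesis
      unfolding h_def case_prod_beta by (rule continuous_on_mult)
  qed
  have h_bound: "\<bar>h z\<bar> \<le> B" for z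
  proof -
    have "(\<Prod>i\<in>Basis. cut (fst z \<bullet> i)) \<le> 1"
      by (intro prod_le_1 conjI) (simp_all add: cut_def)
    moreover have "0 \<le> (\<Prod>i\<in>Basis. cut (fst z \<bullet> i))"
      by (intro prod_nonneg) (simp add: cut_def)
    ultimately have "\<bar>f x\<bar> * \<bar>\<Prod>i\<in>Basis. cut (fst z \<bullet> i)\<bar> \<le> B * 1" for x
      using bd[of x] by (intro mult_mono) auto
    then show ?thesis
      by (simp add: h_def case_prod_beta abs_mult)
  qed
  have h_eq: "h (torus_map r x) = f x" if x: "\<And>i. i \<in> Basis \<Longrightarrow> \<bar>x \<bullet> i\<bar> \<le> r * pi / 3" for x
  proof -
    have quarter: "- (pi / 2) \<le> y" "y \<le> pi / 2" if "\<bar>y\<bar> \<le> pi / 3" for y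
      using that pi_gt_zero by arith+
    have small: "\<bar>(x \<bullet> i) / r\<bar> \<le> pi / 3" if "i \<in> Basis" for i
      using x[OF that] r by (simp add: field_simps)
    have "r * arcsin (sin ((x \<bullet> i) / r)) = x \<bullet> i" if "i \<in> Basis" for i
    proof -
      have "arcsin (sin ((x \<bullet> i) / r)) = (x \<bullet> i) / r"
        using quarter[OF small[OF that]] by (intro arcsin_sin) auto
      then show ?thesis using r by simp
    qed
    then have "(\<Sum>i\<in>Basis. (r * arcsin (sin ((x \<bullet> i) / r))) *\<^sub>R i) = x"
      by (simp add: euclidean_representation)
    moreover have "cut (cos ((x \<bullet> i) / r)) = 1" if "i \<in> Basis" for i
    proof -
      have "cos (pi / 3) \<le> cos \<bar>(x \<bullet> i) / r\<bar>"
        by (rule cos_monotone_0_pi_le) (use small[OF that] in auto)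
      then show ?thesis unfolding cos_abs_real cos_60 by (simp add: cut_def)
    qed
    ultimately show ?thesis
      by (simp add: h_def torus_map_def prod.neutral)
  qed
  obtain q where q: "real_polynomial_function q" "\<And>z. z \<in> S \<Longrightarrow> \<bar>h z - q z\<bar> < e"
    using Stone_Weierstrass_real_polynomial_function[OF S h_cont e] by blast
  show ?thesis
  proof (rule that[of "\<lambda>x. q (torus_map r x)"])
    show "trig_poly (\<lambda>x. q (torus_map r x))"
      by (rule trig_poly_torus_map) fact
    show "\<bar>q (torus_map r x)\<bar> \<le> B + e" for x
      using q(2)[OF torus_in, of x] h_bound[of "torus_map r x"] by linarith
    show "\<bar>f x - q (torus_map r x)\<bar> < e" if "\<And>i. i \<in> Basis \<Longrightarrow> \<bar>x \<bullet> i\<bar> \<le> r * pi / 3" for x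
      using q(2)[OF torus_in, of x] h_eq[OF that] by simp
  qed
qed

lemma trig_poly_continuous: "trig_poly f \<Longrightarrow> continuous_on UNIV f"
  by (induction rule: trig_poly.induct) (auto intro!: continuous_intros)

lemma trig_poly_bounded: "trig_poly f \<Longrightarrow> \<exists>B. \<forall>x. \<bar>f x\<bar> \<le> B"
proof (induction rule: trig_poly.induct)
  case (wave c t \<alpha>)
  then show ?case
    by (intro exI[of _ "\<bar>c\<bar>"]) (auto simp: abs_mult mult_left_le)
next
  case (add f g)
  then obtain A B where "\<forall>x. \<bar>f x\<bar> \<le> A" "\<forall>x. \<bar>g x\<bar> \<le> B" by blast
  then show ?case
    by (intro exI[of _ "A + B"] allI order_trans[OF abs_triangle_ineq] add_mono) auto
qed

lemma bounded_continuous_integrable: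
  fixes f :: "'a::euclidean_space \<Rightarrow> real"
  assumes "prob_space \<mu>" "sets \<mu> = sets borel" "continuous_on UNIV f" "\<And>x. \<bar>f x\<bar> \<le> B"
  shows "integrable \<mu> f"
proof -
  interpret prob_space \<mu> by fact
  have "f \<in> borel_measurable \<mu>"
    using borel_measurable_continuous_onI[OF assms(3)] by (simp cong: measurable_cong_sets add: assms(2))
  then show ?thesis
    by (intro integrable_const_bound[of _ B]) (auto simp: assms(4))
qed

lemma trig_poly_integral_tendsto:
  fixes \<mu> :: "nat \<Rightarrow> 'a::euclidean_space measure"
  assumes "trig_poly f"
    and prob: "\<forall>\<^sub>F n in sequentially. prob_space (\<mu> n) \<and> sets (\<mu> n) = sets borel"
    and \<nu>: "prob_space \<nu>" "sets \<nu> = sets borel"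
    and char: "\<And>t. (\<lambda>n. \<integral>x. iexp (t \<bullet> x) \<partial>\<mu> n) \<longlonglongrightarrow> (\<integral>x. iexp (t \<bullet> x) \<partial>\<nu>)"
  shows "(\<lambda>n. \<integral>x. f x \<partial>\<mu> n) \<longlonglongrightarrow> (\<integral>x. f x \<partial>\<nu>)"
  using assms(1)
proof (induction rule: trig_poly.induct)
  case (wave c t \<alpha>)
  have eq: "(\<integral>x. c * cos (t \<bullet> x + \<alpha>) \<partial>M) = Re (c * iexp \<alpha> * (\<integral>x. iexp (t \<bullet> x) \<partial>M))"
    if "prob_space M" "sets M = sets borel" for M :: "'a measure"
  proof -
    interpret prob_space M by fact
    have [measurable]: "(\<lambda>x. t \<bullet> x) \<in> borel_measurable M"
      by (simp cong: measurable_cong_sets add: that(2))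
    have "integrable M (\<lambda>x. iexp (t \<bullet> x))"
      by (intro integrable_const_bound[of _ 1]) auto
    then have "Re (c * iexp \<alpha> * (\<integral>x. iexp (t \<bullet> x) \<partial>M)) = (\<integral>x. Re (c * iexp \<alpha> * iexp (t \<bullet> x)) \<partial>M)"
      by (subst integral_mult_right_zero[symmetric]) (auto intro!: integral_Re[symmetric] simp del: Re_complex_of_real)
    also have "\<dots> = (\<integral>x. c * cos (t \<bullet> x + \<alpha>) \<partial>M)"
      by (intro Bochner_Integration.integral_cong refl)
        (simp add: Re_exp Im_exp cos_add algebra_simps)
    finally show ?thesis ..
  qed
  have "(\<lambda>n. Re (c * iexp \<alpha> * (\<integral>x. iexp (t \<bullet> x) \<partial>\<mu> n))) \<longlonglongrightarrow> Re (c * iexp \<alpha> * (\<integral>x. iexp (t \<bullet> x) \<partial>\<nu>))"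
    by (intro tendsto_intros char)
  then show ?case
    unfolding eq[OF \<nu>]
    by (rule Lim_transform_eventually) (use prob in eventually_elim, subst eq, simp_all)
next
  case (add f g)
  have int: "integrable M h" if "prob_space M" "sets M = sets borel" "trig_poly h" for M :: "'a measure" and h
    using trig_poly_bounded[OF that(3)] bounded_continuous_integrable[OF that(1,2) trig_poly_continuous[OF that(3)]]
    by blast
  have "(\<lambda>n. (\<integral>x. f x \<partial>\<mu> n) + (\<integral>x. g x \<partial>\<mu> n)) \<longlonglongrightarrow> (\<integral>x. f x \<partial>\<nu>) + (\<integral>x. g x \<partial>\<nu>)"
    by (intro tendsto_intros add.IH)
  also have "(\<integral>x. f x \<partial>\<nu>) + (\<integral>x. g x \<partial>\<nu>) = (\<integral>x. f x + g x \<partial>\<nu>)"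
    using int[OF \<nu>] add.hyps by simp
  finally show ?case
    by (rule Lim_transform_eventually) (use prob in eventually_elim, use int add.hyps in simp)
qed

text \<open>
  Up to the mass outside a large cube, which tightness makes uniformly small, a bounded continuous
  function may be replaced by a trigonometric polynomial with nearly the same bound.  Its integrals
  are linear combinations of values of the characteristic function.
\<close>

theorem levy_continuity_multivariate:
  fixes \<mu> :: "nat \<Rightarrow> 'a::euclidean_space measure"
  assumes prob: "\<forall>\<^sub>F n in sequentially. prob_space (\<mu> n) \<and> sets (\<mu> n) = sets borel"
    and \<nu>: "prob_space \<nu>" "sets \<nu> = sets borel"
    and char: "\<And>t. (\<lambda>n. \<integral>x. iexp (t \<bullet> x) \<partial>\<mu> n) \<longlonglongrightarrow> (\<integral>x. iexp (t \<bullet> x) \<partial>\<nu>)"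
    and tight: "\<And>e. e > 0 \<Longrightarrow> \<exists>R. \<forall>\<^sub>F n in sequentially. measure (\<mu> n) {x. norm x > R} \<le> e"
  shows "converges_weakly \<mu> \<nu>"
  unfolding converges_weakly_def
proof (intro allI impI)
  fix f :: "'a \<Rightarrow> real"
  assume f: "continuous_on UNIV f" and bdd: "bounded (range f)"
  obtain B where B: "\<And>x. \<bar>f x\<bar> \<le> B" and "B > 0"
    using bdd unfolding bounded_pos by auto
  show "(\<lambda>n. \<integral>x. f x \<partial>\<mu> n) \<longlonglongrightarrow> (\<integral>x. f x \<partial>\<nu>)"
  proof (rule tendstoI)
    fix e' :: real assume "e' > 0"
    \<comment> \<open>Two approximations will cost \<open>e (2 B + 2)\<close> each, and the integrals of the trigonometric
      polynomial another \<open>e\<close>.\<close>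
    define e where "e = min 1 (e' / (4 * B + 6))"
    have e: "e > 0" "e \<le> 1" "e * (4 * B + 6) \<le> e'"
      using \<open>e' > 0\<close> \<open>B > 0\<close> by (simp_all add: e_def flip: pos_le_divide_eq)
    obtain R1 where R1: "\<forall>\<^sub>F n in sequentially. measure (\<mu> n) {x. norm x > R1} \<le> e"
      using tight[OF e(1)] by blast
    interpret \<nu>: prob_space \<nu> by fact
    have "(\<lambda>k. measure \<nu> {x. norm x > real k}) \<longlonglongrightarrow> measure \<nu> (\<Inter>k. {x. norm x > real k})"
      by (rule \<nu>.finite_Lim_measure_decseq) (auto simp: \<nu>(2) decseq_def)
    also have "(\<Inter>k. {x::'a. norm x > real k}) = {}"
    proof (rule equals0I)
      fix x :: 'a assume x: "x \<in> (\<Inter>k. {x. norm x > real k})"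
      obtain k where "norm x \<le> real k" using real_arch_simple by blast
      with x show False by (simp add: not_less[symmetric])
    qed
    finally have "\<forall>\<^sub>F k in sequentially. measure \<nu> {x. norm x > real k} < e"
      using e(1) by (intro order_tendstoD(2)) auto
    then obtain k where k: "measure \<nu> {x. norm x > real k} < e"
      by (auto simp: eventually_sequentially)
    define R where "R = max 1 (max R1 (real k))"
    \<comment> \<open>With this radius the approximation is good on the cube of half-width \<open>R\<close>.\<close>
    define r where "r = 3 * R / pi"
    have r: "r > 0" "r * pi / 3 = R" by (auto simp: r_def R_def)
    obtain g where g: "trig_poly g" "\<And>x. \<bar>g x\<bar> \<le> B + e"
      "\<And>x. (\<And>i. i \<in> Basis \<Longrightarrow> \<bar>x \<bullet> i\<bar> \<le> r * pi / 3) \<Longrightarrow> \<bar>f x - g x\<bar> < e"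
      using cube_cutoff_trig_approx[OF f B r(1) e(1)] by blast
    have close: "\<bar>f x - g x\<bar> \<le> e + (2 * B + e) * indicator {x. norm x > R} x" for x
    proof (cases "norm x > R")
      case True
      then show ?thesis using B[of x] g(2)[of x] e by (simp add: abs_le_iff)
    next
      case False
      then have "\<bar>f x - g x\<bar> < e"
        using Basis_le_norm[of _ x] by (intro g(3)) (force simp: r(2))
      then show ?thesis using False by simp
    qed
    have approx: "\<bar>(\<integral>x. f x \<partial>M) - (\<integral>x. g x \<partial>M)\<bar> \<le> e * (2 * B + 2)"
      if M: "prob_space M" "sets M = sets borel" and small: "measure M {x. norm x > R} \<le> e" for M :: "'a measure"
    proof -
      interpret M: prob_space M by fact
      have [measurable]: "{x. norm x > R} \<in> sets M" by (simp add: M(2))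
      have int: "integrable M f" "integrable M g"
        using bounded_continuous_integrable[OF M f B]
          bounded_continuous_integrable[OF M trig_poly_continuous[OF g(1)] g(2)] by auto
      have "\<bar>(\<integral>x. f x \<partial>M) - (\<integral>x. g x \<partial>M)\<bar> = \<bar>\<integral>x. f x - g x \<partial>M\<bar>"
        using int by simp
      also have "\<dots> \<le> (\<integral>x. \<bar>f x - g x\<bar> \<partial>M)"
        by (rule integral_abs_bound)
      also have "\<dots> \<le> (\<integral>x. e + (2 * B + e) * indicator {x. norm x > R} x \<partial>M)"
        using int by (intro integral_mono close) (auto simp: less_top[symmetric])
      also have "\<dots> = e + (2 * B + e) * measure M {x. norm x > R}"
        using M.prob_space by (simp add: less_top[symmetric])
      also have "\<dots> \<le> e + (2 * B + 1) * e"
        using small e \<open>B > 0\<close> by (intro add_left_mono mult_mono) auto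
      finally show ?thesis by (simp add: algebra_simps)
    qed
    have "measure \<nu> {x. norm x > R} \<le> e"
      using k \<nu>.finite_measure_mono[of "{x. norm x > R}" "{x. norm x > real k}"]
      by (auto simp: R_def \<nu>(2) intro: order_trans[OF _ less_imp_le])
    note app_\<nu> = approx[OF \<nu> this]
    have lim: "\<forall>\<^sub>F n in sequentially. dist (\<integral>x. g x \<partial>\<mu> n) (\<integral>x. g x \<partial>\<nu>) < e"
      using trig_poly_integral_tendsto[OF g(1) prob \<nu> char] e(1) by (rule tendstoD)
    show "\<forall>\<^sub>F n in sequentially. dist (\<integral>x. f x \<partial>\<mu> n) (\<integral>x. f x \<partial>\<nu>) < e'"
      using prob R1 lim
    proof eventually_elim
      case (elim n)
      interpret M: prob_space "\<mu> n" using elim by simp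
      have "measure (\<mu> n) {x. norm x > R} \<le> measure (\<mu> n) {x. norm x > R1}"
        using elim by (intro M.finite_measure_mono) (auto simp: R_def)
      then have "\<bar>(\<integral>x. f x \<partial>\<mu> n) - (\<integral>x. g x \<partial>\<mu> n)\<bar> \<le> e * (2 * B + 2)"
        using elim by (intro approx) auto
      moreover have "e * (4 * B + 6) = e * (2 * B + 2) + e * (2 * B + 2) + e + e"
        by (simp add: algebra_simps)
      ultimately show ?case
        using app_\<nu> elim(3) e(1,3) by (simp add: dist_real_def)
    qed
  qed
qed

lemma cmod_iexp_diff_le: "cmod (iexp x - iexp y) \<le> \<bar>x - y\<bar>"
proof -
  have "iexp x - iexp y = iexp y * (iexp (x - y) - 1)"
    by (simp add: algebra_simps flip: exp_add)
  then have "cmod (iexp x - iexp y) = cmod (iexp (x - y) - 1)"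
    by (simp add: norm_mult)
  also have "\<dots> \<le> \<bar>x - y\<bar>"
    using iexp_approx1[of "x - y" 0] by simp
  finally show ?thesis .
qed

lemma (in prob_space) char_perturbation_le:
  fixes T U :: "'a \<Rightarrow> 'b::euclidean_space"
  assumes [measurable]: "T \<in> borel_measurable M" "U \<in> borel_measurable M" and "\<delta> \<ge> 0"
  shows "cmod ((\<integral>\<omega>. iexp (t \<bullet> T \<omega>) \<partial>M) - (\<integral>\<omega>. iexp (t \<bullet> U \<omega>) \<partial>M))
    \<le> norm t * \<delta> + 2 * prob {\<omega> \<in> space M. norm (T \<omega> - U \<omega>) > \<delta>}"
proof -
  define A where "A = {\<omega> \<in> space M. norm (T \<omega> - U \<omega>) > \<delta>}"
  have A[measurable]: "A \<in> events" by (simp add: A_def)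
  have int: "integrable M (\<lambda>\<omega>. iexp (t \<bullet> T \<omega>))" "integrable M (\<lambda>\<omega>. iexp (t \<bullet> U \<omega>))"
    by (auto intro!: integrable_const_bound[of _ 1])
  have "cmod ((\<integral>\<omega>. iexp (t \<bullet> T \<omega>) \<partial>M) - (\<integral>\<omega>. iexp (t \<bullet> U \<omega>) \<partial>M))
      = cmod (\<integral>\<omega>. iexp (t \<bullet> T \<omega>) - iexp (t \<bullet> U \<omega>) \<partial>M)"
    using int by simp
  also have "\<dots> \<le> (\<integral>\<omega>. cmod (iexp (t \<bullet> T \<omega>) - iexp (t \<bullet> U \<omega>)) \<partial>M)"
    by (rule integral_norm_bound)
  also have "\<dots> \<le> (\<integral>\<omega>. norm t * \<delta> + 2 * indicator A \<omega> \<partial>M)"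
  proof (rule integral_mono)
    fix \<omega> assume \<omega>: "\<omega> \<in> space M"
    show "cmod (iexp (t \<bullet> T \<omega>) - iexp (t \<bullet> U \<omega>)) \<le> norm t * \<delta> + 2 * indicator A \<omega>"
    proof (cases "\<omega> \<in> A")
      case True
      have "cmod (iexp (t \<bullet> T \<omega>) - iexp (t \<bullet> U \<omega>)) \<le> 1 + 1"
        by (rule order_trans[OF norm_triangle_ineq4]) simp
      then show ?thesis using True \<open>\<delta> \<ge> 0\<close> by (simp add: add_increasing)
    next
      case False
      have "cmod (iexp (t \<bullet> T \<omega>) - iexp (t \<bullet> U \<omega>)) \<le> \<bar>t \<bullet> (T \<omega> - U \<omega>)\<bar>"
        using cmod_iexp_diff_le by (simp add: inner_diff_right)
      also have "\<dots> \<le> norm t * norm (T \<omega> - U \<omega>)"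
        by (rule Cauchy_Schwarz_ineq2)
      also have "\<dots> \<le> norm t * \<delta>"
        using False \<omega> by (intro mult_left_mono) (auto simp: A_def)
      finally show ?thesis using False by simp
    qed
  qed (use int in \<open>auto simp: less_top[symmetric]\<close>)
  also have "\<dots> = norm t * \<delta> + 2 * prob A"
    using prob_space by (simp add: less_top[symmetric])
  finally show ?thesis by (simp add: A_def)
qed

text \<open>
  Slutsky's lemma for sums: a perturbation that tends to zero in probability changes neither the limit
  of the characteristic functions nor the tightness.
\<close>

theorem converges_weakly_perturbed:
  fixes T U :: "nat \<Rightarrow> 'w \<Rightarrow> 'a::euclidean_space" and P :: "nat \<Rightarrow> 'w measure"
  assumes array: "\<forall>\<^sub>F n in sequentially. prob_space (P n) \<and> T n \<in> borel_measurable (P n) \<and> U n \<in> borel_measurable (P n)"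
    and \<nu>: "prob_space \<nu>" "sets \<nu> = sets borel"
    and char: "\<And>t. (\<lambda>n. \<integral>\<omega>. iexp (t \<bullet> U n \<omega>) \<partial>P n) \<longlonglongrightarrow> (\<integral>x. iexp (t \<bullet> x) \<partial>\<nu>)"
    and tight: "\<And>e. e > 0 \<Longrightarrow> \<exists>R. \<forall>\<^sub>F n in sequentially. measure (P n) {\<omega> \<in> space (P n). norm (U n \<omega>) > R} \<le> e"
    and close: "\<And>\<delta> e. \<delta> > 0 \<Longrightarrow> e > 0 \<Longrightarrow>
      \<forall>\<^sub>F n in sequentially. measure (P n) {\<omega> \<in> space (P n). norm (T n \<omega> - U n \<omega>) > \<delta>} \<le> e"
  shows "converges_weakly (\<lambda>n. distr (P n) borel (T n)) \<nu>"
proof (rule levy_continuity_multivariate[OF _ \<nu>])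
  show "\<forall>\<^sub>F n in sequentially. prob_space (distr (P n) borel (T n)) \<and> sets (distr (P n) borel (T n)) = sets borel"
    using array by eventually_elim (auto intro: prob_space.prob_space_distr)
next
  fix t :: 'a
  have "(\<lambda>n. (\<integral>\<omega>. iexp (t \<bullet> T n \<omega>) \<partial>P n) - (\<integral>\<omega>. iexp (t \<bullet> U n \<omega>) \<partial>P n)) \<longlonglongrightarrow> 0"
  proof (rule tendstoI)
    fix r :: real assume r: "r > 0"
    define \<delta> where "\<delta> = r / (4 * (norm t + 1))"
    have \<delta>: "\<delta> > 0" "norm t * \<delta> \<le> r / 4"
    proof -
      have "norm t + 1 > 0" using norm_ge_zero[of t] by linarith
      then show "\<delta> > 0" "norm t * \<delta> \<le> r / 4" using r by (simp_all add: \<delta>_def field_simps)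
    qed
    have "\<forall>\<^sub>F n in sequentially. measure (P n) {\<omega> \<in> space (P n). norm (T n \<omega> - U n \<omega>) > \<delta>} \<le> r / 4"
      using close[OF \<delta>(1), of "r / 4"] r by simp
    with array show "\<forall>\<^sub>F n in sequentially. dist ((\<integral>\<omega>. iexp (t \<bullet> T n \<omega>) \<partial>P n) - (\<integral>\<omega>. iexp (t \<bullet> U n \<omega>) \<partial>P n)) 0 < r"
    proof eventually_elim
      case (elim n)
      interpret prob_space "P n" using elim by simp
      show ?case
        using char_perturbation_le[of "T n" "U n" \<delta> t] elim \<delta> r by (simp add: dist_norm)
    qed
  qed
  from tendsto_add[OF this char[of t]]
  have "(\<lambda>n. \<integral>\<omega>. iexp (t \<bullet> T n \<omega>) \<partial>P n) \<longlonglongrightarrow> (\<integral>x. iexp (t \<bullet> x) \<partial>\<nu>)" by simp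
  then show "(\<lambda>n. \<integral>x. iexp (t \<bullet> x) \<partial>distr (P n) borel (T n)) \<longlonglongrightarrow> (\<integral>x. iexp (t \<bullet> x) \<partial>\<nu>)"
    by (rule Lim_transform_eventually)
      (use array in eventually_elim, subst integral_distr, simp_all)
next
  fix e :: real assume e: "e > 0"
  obtain R where R: "\<forall>\<^sub>F n in sequentially. measure (P n) {\<omega> \<in> space (P n). norm (U n \<omega>) > R} \<le> e / 2"
    using tight[of "e / 2"] e by auto
  have "\<forall>\<^sub>F n in sequentially. measure (P n) {\<omega> \<in> space (P n). norm (T n \<omega> - U n \<omega>) > 1} \<le> e / 2"
    using close[of 1 "e / 2"] e by simp
  with array R have "\<forall>\<^sub>F n in sequentially. measure (distr (P n) borel (T n)) {x. norm x > R + 1} \<le> e"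
  proof eventually_elim
    case (elim n)
    interpret prob_space "P n" using elim by simp
    have [measurable]: "T n \<in> borel_measurable (P n)" "U n \<in> borel_measurable (P n)" using elim by auto
    have "measure (distr (P n) borel (T n)) {x. norm x > R + 1} = prob {\<omega> \<in> space (P n). norm (T n \<omega>) > R + 1}"
      by (subst measure_distr) (auto intro!: arg_cong[where f = prob])
    also have "\<dots> \<le> prob ({\<omega> \<in> space (P n). norm (U n \<omega>) > R} \<union> {\<omega> \<in> space (P n). norm (T n \<omega> - U n \<omega>) > 1})"
    proof (rule finite_measure_mono)
      show "{\<omega> \<in> space (P n). norm (T n \<omega>) > R + 1}
          \<subseteq> {\<omega> \<in> space (P n). norm (U n \<omega>) > R} \<union> {\<omega> \<in> space (P n). norm (T n \<omega> - U n \<omega>) > 1}"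
      proof
        fix \<omega> assume \<omega>: "\<omega> \<in> {\<omega> \<in> space (P n). norm (T n \<omega>) > R + 1}"
        have "norm (T n \<omega>) \<le> norm (U n \<omega>) + norm (T n \<omega> - U n \<omega>)"
          using norm_triangle_ineq[of "U n \<omega>" "T n \<omega> - U n \<omega>"] by simp
        with \<omega> show "\<omega> \<in> {\<omega> \<in> space (P n). norm (U n \<omega>) > R} \<union> {\<omega> \<in> space (P n). norm (T n \<omega> - U n \<omega>) > 1}"
          by auto
      qed
    qed measurable
    also have "\<dots> \<le> prob {\<omega> \<in> space (P n). norm (U n \<omega>) > R} + prob {\<omega> \<in> space (P n). norm (T n \<omega> - U n \<omega>) > 1}"
      by (rule measure_Un_le) measurable
    also have "\<dots> \<le> e" using elim by simp
    finally show ?case .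
  qed
  then show "\<exists>R. \<forall>\<^sub>F n in sequentially. measure (distr (P n) borel (T n)) {x. norm x > R} \<le> e"
    by blast
qed

section \<open>Normal distributions with semidefinite covariance\<close>

text \<open>
  Otherwise the quadratic form on the span of two coordinate vectors would be a polynomial
  \<open>V j j s\<^sup>2 + 2 V e j s\<close> with nonzero linear term, which takes negative values near \<open>s = 0\<close>.
\<close>

lemma psd_diagonal_zero:
  fixes V :: "'i \<Rightarrow> 'i \<Rightarrow> real"
  assumes fin: "finite I" and sym: "\<And>i j. i \<in> I \<Longrightarrow> j \<in> I \<Longrightarrow> V i j = V j i"
    and psd: "\<And>x. 0 \<le> (\<Sum>i\<in>I. \<Sum>j\<in>I. x i * V i j * x j)"
    and "e \<in> I" "j \<in> I" "V e e = 0"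
  shows "V e j = 0"
proof (cases "j = e")
  case False
  have quad: "0 \<le> V j j * s\<^sup>2 + 2 * V e j * s" for s
  proof -
    have two: "(\<Sum>i\<in>I. (if i = e then 1 else if i = j then s else 0) * h i) = h e + s * h j" for h :: "'i \<Rightarrow> real"
    proof -
      have "(\<Sum>i\<in>I. (if i = e then 1 else if i = j then s else 0) * h i)
          = (\<Sum>i\<in>I. (if i = e then h e else 0) + (if i = j then s * h j else 0))"
        using False by (intro sum.cong) auto
      also have "\<dots> = h e + s * h j"
        using fin assms(4,5) by (simp add: sum.distrib)
      finally show ?thesis .
    qed
    define x where "x i = (if i = e then 1 else if i = j then s else 0)" for i
    have "(\<Sum>i\<in>I. \<Sum>k\<in>I. x i * V i k * x k) = (\<Sum>i\<in>I. x i * (\<Sum>k\<in>I. x k * V i k))"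
      by (simp add: sum_distrib_left mult_ac)
    also have "\<dots> = (V e e + s * V e j) + s * (V j e + s * V j j)"
      unfolding x_def two ..
    also have "\<dots> = V j j * s\<^sup>2 + 2 * V e j * s"
      using sym[OF assms(4,5)] assms(6) by (simp add: algebra_simps power2_eq_square)
    finally show ?thesis using psd[of x] by simp
  qed
  show ?thesis
  proof (rule ccontr)
    assume nz: "V e j \<noteq> 0"
    define c where "c = \<bar>V j j\<bar> + 1"
    \<comment> \<open>The minimiser of the majorant \<open>c s\<^sup>2 + 2 V e j s\<close>, whose leading coefficient is positive.\<close>
    define s where "s = - V e j / c"
    have c: "c > 0" "V j j \<le> c" by (auto simp: c_def)
    have "V j j * s\<^sup>2 + 2 * V e j * s \<le> c * s\<^sup>2 + 2 * V e j * s"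
      using c by (intro add_right_mono mult_right_mono) auto
    also have "\<dots> = - ((V e j)\<^sup>2 / c)"
      using c by (simp add: s_def power2_eq_square field_simps)
    also have "\<dots> < 0" using nz c by simp
    finally show False using quad[of s] by simp
  qed
qed (use assms in simp)

text \<open>
  Cholesky decomposition.  The Schur complement of a diagonal entry is again positive semidefinite,
  since the minimum of the form over the eliminated coordinate is nonnegative.  If the diagonal entry
  is zero, so are its row and column; division by zero then yields zero and the same formulas apply.
\<close>

lemma psd_gram_on:
  fixes V :: "'i \<Rightarrow> 'i \<Rightarrow> real"
  assumes "finite I"
    and "\<And>i j. i \<in> I \<Longrightarrow> j \<in> I \<Longrightarrow> V i j = V j i"
    and "\<And>x. 0 \<le> (\<Sum>i\<in>I. \<Sum>j\<in>I. x i * V i j * x j)"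
  shows "\<exists>A. \<forall>i\<in>I. \<forall>j\<in>I. (\<Sum>k\<in>I. A i k * A j k) = V i j"
  using assms
proof (induction I arbitrary: V rule: finite_induct)
  case (insert e I)
  note sym = insert.prems(1) and psd = insert.prems(2)
  define v where "v = V e e"
  define W where "W i j = V i j - V i e * V e j / v" for i j
  have Vee: "v \<ge> 0"
  proof -
    define x where "x i = (if i = e then 1 else 0 :: real)" for i
    have "x e = 1" "\<And>i. i \<in> I \<Longrightarrow> x i = 0"
      using insert.hyps by (auto simp: x_def)
    then have "(\<Sum>i\<in>insert e I. \<Sum>j\<in>insert e I. x i * V i j * x j) = v"
      using insert.hyps by (simp add: v_def)
    then show ?thesis using psd[of x] by simp
  qed
  have zero: "V e i = 0" if "v = 0" "i \<in> insert e I" for i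
    using psd_diagonal_zero[OF _ sym psd, of e i] insert.hyps that by (auto simp: v_def)
  have "\<exists>A. \<forall>i\<in>I. \<forall>j\<in>I. (\<Sum>k\<in>I. A i k * A j k) = W i j"
  proof (rule insert.IH)
    show "W i j = W j i" if "i \<in> I" "j \<in> I" for i j
      using sym[of i j] sym[of i e] sym[of j e] that by (simp add: W_def)
    show "0 \<le> (\<Sum>i\<in>I. \<Sum>j\<in>I. x i * W i j * x j)" for x
    proof -
      define u where "u = (\<Sum>j\<in>I. V e j * x j)"
      define q where "q = (\<Sum>i\<in>I. \<Sum>j\<in>I. x i * V i j * x j)"
      \<comment> \<open>The minimiser of the form over the coordinate \<open>e\<close>.\<close>
      define y where "y i = (if i = e then - u / v else x i)" for i
      have y: "y e = - u / v" "\<And>i. i \<in> I \<Longrightarrow> y i = x i"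
        using insert.hyps by (auto simp: y_def)
      have u': "(\<Sum>i\<in>I. x i * V i e) = u"
        unfolding u_def using sym by (intro sum.cong) (auto simp: mult_ac)
      have "0 \<le> (\<Sum>i\<in>insert e I. \<Sum>j\<in>insert e I. y i * V i j * y j)"
        by (rule psd)
      also have "\<dots> = y e * v * y e + (\<Sum>j\<in>I. y e * (V e j * x j)) + ((\<Sum>i\<in>I. x i * V i e * y e) + q)"
        using insert.hyps y(2) by (simp add: sum.distrib v_def q_def mult_ac)
      also have "\<dots> = y e * v * y e + y e * u + u * y e + q"
        by (simp add: u_def[symmetric] u' flip: sum_distrib_left sum_distrib_right)
      also have "\<dots> = q - u * u / v"
        using zero by (cases "v = 0") (simp_all add: y u_def field_simps)
      also have "u * u / v = (\<Sum>i\<in>I. \<Sum>j\<in>I. x i * (V i e * V e j / v) * x j)"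
      proof -
        have "u * u = (\<Sum>i\<in>I. x i * V i e) * (\<Sum>j\<in>I. V e j * x j)"
          by (simp only: u' u_def[symmetric])
        then show ?thesis
          unfolding sum_product by (simp only: sum_divide_distrib) (simp add: mult_ac)
      qed
      also have "q - \<dots> = (\<Sum>i\<in>I. \<Sum>j\<in>I. x i * W i j * x j)"
        by (simp add: q_def W_def algebra_simps sum_subtractf)
      finally show ?thesis .
    qed
  qed
  then obtain A where A: "\<And>i j. i \<in> I \<Longrightarrow> j \<in> I \<Longrightarrow> (\<Sum>k\<in>I. A i k * A j k) = W i j"
    by blast
  define B where "B i k = (if k = e then V i e / sqrt v else if i = e then 0 else A i k)" for i k
  have "(\<Sum>k\<in>insert e I. B i k * B j k) = V i j" if ij: "i \<in> insert e I" "j \<in> insert e I" for i j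
  proof -
    have first: "B i e * B j e = V i e * V e j / v"
      using sym[of j e] ij Vee by (auto simp: B_def)
    have rest: "(\<Sum>k\<in>I. B i k * B j k) = (if i = e \<or> j = e then 0 else W i j)"
    proof (cases "i = e \<or> j = e")
      case False
      have "(\<Sum>k\<in>I. B i k * B j k) = (\<Sum>k\<in>I. A i k * A j k)"
        using insert.hyps False by (intro sum.cong) (auto simp: B_def)
      then show ?thesis using A False ij by auto
    next
      case True
      then show ?thesis
        using insert.hyps by (auto simp: B_def intro!: sum.neutral)
    qed
    have "(\<Sum>k\<in>insert e I. B i k * B j k) = V i e * V e j / v + (if i = e \<or> j = e then 0 else W i j)"
      using insert.hyps first rest by simp
    also have "\<dots> = V i j"
      using zero sym[of i e] sym[of i j] ij by (cases "v = 0") (auto simp: W_def v_def)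
    finally show ?thesis .
  qed
  then show ?case by blast
qed simp

lemma psd_matrix_gram:
  fixes V :: "real ^ 'n ^ 'n"
  assumes sym: "\<And>i j. V $ i $ j = V $ j $ i" and psd: "\<And>x. 0 \<le> x \<bullet> (V *v x)"
  obtains A :: "real ^ 'n ^ 'n" where "A ** transpose A = V"
proof -
  have quad: "0 \<le> (\<Sum>i\<in>UNIV. \<Sum>j\<in>UNIV. x i * V $ i $ j * x j)" for x
    using psd[of "\<chi> i. x i"]
    by (simp add: inner_vec_def matrix_vector_mult_def sum_distrib_left mult_ac)
  have "\<exists>A :: 'n \<Rightarrow> 'n \<Rightarrow> real. \<forall>i\<in>UNIV. \<forall>j\<in>UNIV. (\<Sum>k\<in>UNIV. A i k * A j k) = V $ i $ j"
    by (rule psd_gram_on[OF finite sym quad])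
  then obtain A :: "'n \<Rightarrow> 'n \<Rightarrow> real" where "\<And>i j. (\<Sum>k\<in>UNIV. A i k * A j k) = V $ i $ j"
    by auto
  then show ?thesis
    by (intro that[of "\<chi> i k. A i k"]) (simp add: matrix_matrix_mult_def transpose_def vec_eq_iff)
qed

lemma inner_matrix_vector_mult:
  fixes A :: "real ^ 'n ^ 'm"
  shows "t \<bullet> (A *v z) = (transpose A *v t) \<bullet> z"
  using dot_lmul_matrix[of t A z] by simp

lemma measurable_vec_lambda[measurable]:
  "(\<lambda>f. \<chi> i. f i) \<in> measurable (\<Pi>\<^sub>M i\<in>(UNIV :: 'n::finite set). (borel :: real measure)) borel"
proof (subst borel_measurable_euclidean_space, intro ballI)
  fix b :: "real ^ 'n" assume "b \<in> Basis"
  then obtain i where "b = axis i 1" by (auto simp: Basis_vec_def)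
  then show "(\<lambda>f. (\<chi> i. f i) \<bullet> b) \<in> borel_measurable (\<Pi>\<^sub>M i\<in>(UNIV :: 'n set). (borel :: real measure))"
    by (simp add: inner_axis)
qed

lemma
  shows prob_space_standard_normal_vector:
      "prob_space (standard_normal_vector :: (real ^ 'd::finite) measure)"
    and sets_standard_normal_vector:
      "sets (standard_normal_vector :: (real ^ 'd::finite) measure) = sets borel"
    and char_standard_normal_vector:
      "(\<integral>z. iexp (u \<bullet> z) \<partial>(standard_normal_vector :: (real ^ 'd::finite) measure)) = exp (- (u \<bullet> u) / 2)"
proof -
  let ?G = "density lborel (\<lambda>x. ennreal (std_normal_density x))"
  let ?P = "\<Pi>\<^sub>M i\<in>(UNIV :: 'd set). ?G"
  interpret G: prob_space ?G by (rule prob_space_normal_density) simp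
  interpret PP: product_prob_space "\<lambda>_. ?G" "UNIV :: 'd set"
    by unfold_locales
  have [measurable]: "(\<lambda>f. \<chi> i. f i) \<in> measurable ?P (borel :: (real ^ 'd) measure)"
    using measurable_vec_lambda by (simp cong: measurable_cong_sets sets_PiM_cong)
  show "prob_space (standard_normal_vector :: (real ^ 'd) measure)"
    unfolding standard_normal_vector_def by (rule PP.prob_space_distr) simp
  show "sets (standard_normal_vector :: (real ^ 'd) measure) = sets borel"
    by (simp add: standard_normal_vector_def)
  have one: "integrable ?G (\<lambda>x. iexp (c * x))" "(\<integral>x. iexp (c * x) \<partial>?G) = exp (- (c\<^sup>2) / 2)" for c
    using fun_cong[OF char_std_normal_distribution, of c]
    by (auto simp: char_def intro!: G.integrable_const_bound[of _ 1])
  have "(\<integral>z. iexp (u \<bullet> z) \<partial>(standard_normal_vector :: (real ^ 'd) measure))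
      = (\<integral>f. iexp (u \<bullet> (\<chi> i. f i)) \<partial>?P)"
    unfolding standard_normal_vector_def by (rule integral_distr) simp_all
  also have "\<dots> = (\<integral>f. (\<Prod>i\<in>UNIV. iexp (u $ i * f i)) \<partial>?P)"
    by (simp add: inner_vec_def sum_distrib_left exp_sum)
  also have "\<dots> = (\<Prod>i\<in>UNIV. (\<integral>x. iexp (u $ i * x) \<partial>?G))"
    by (rule PP.product_integral_prod[OF finite one(1)])
  also have "\<dots> = exp (- (u \<bullet> u) / 2)"
    unfolding one(2) by (simp add: inner_vec_def sum_divide_distrib sum_negf power2_eq_square flip: exp_sum exp_of_real of_real_prod)
  finally show "(\<integral>z. iexp (u \<bullet> z) \<partial>(standard_normal_vector :: (real ^ 'd) measure)) = exp (- (u \<bullet> u) / 2)" .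
qed

lemma centred_normal_distribution:
  fixes V :: "real ^ 'd::finite ^ 'd"
  assumes sym: "\<And>i j. V $ i $ j = V $ j $ i" and psd: "\<And>x. 0 \<le> x \<bullet> (V *v x)"
  obtains \<nu> where "is_normal_distribution \<nu> 0 V" "prob_space \<nu>" "sets \<nu> = sets borel"
    "\<And>t. (\<integral>x. iexp (t \<bullet> x) \<partial>\<nu>) = exp (- (t \<bullet> (V *v t)) / 2)"
proof -
  obtain A :: "real ^ 'd ^ 'd" where A: "A ** transpose A = V"
    using psd_matrix_gram[OF sym psd] .
  let ?Z = "standard_normal_vector :: (real ^ 'd) measure"
  interpret Z: prob_space ?Z by (rule prob_space_standard_normal_vector)
  have "(\<lambda>z. A *v z) \<in> measurable ?Z borel"
    unfolding measurable_cong_sets[OF sets_standard_normal_vector refl]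
    by (intro borel_measurable_continuous_onI matrix_vector_mult_linear_continuous_on)
  then have meas: "(\<lambda>z. 0 + A *v z) \<in> measurable ?Z borel"
    by simp
  show ?thesis
  proof (rule that[of "distr ?Z borel (\<lambda>z. 0 + A *v z)"])
    show "is_normal_distribution (distr ?Z borel (\<lambda>z. 0 + A *v z)) 0 V"
      unfolding is_normal_distribution_def using A by blast
    show "prob_space (distr ?Z borel (\<lambda>z. 0 + A *v z))"
      by (rule Z.prob_space_distr[OF meas])
    fix t :: "real ^ 'd"
    have "(\<integral>x. iexp (t \<bullet> x) \<partial>distr ?Z borel (\<lambda>z. 0 + A *v z)) = (\<integral>z. iexp (t \<bullet> (0 + A *v z)) \<partial>?Z)"
      by (rule integral_distr[OF meas]) simp_all
    also have "\<dots> = exp (- ((transpose A *v t) \<bullet> (transpose A *v t)) / 2)"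
      by (simp only: add_0 inner_matrix_vector_mult char_standard_normal_vector)
    also have "(transpose A *v t) \<bullet> (transpose A *v t) = t \<bullet> (V *v t)"
      unfolding A[symmetric] inner_matrix_vector_mult[symmetric] by (simp add: matrix_vector_mul_assoc del: transpose_matrix_vector)
    finally show "(\<integral>x. iexp (t \<bullet> x) \<partial>distr ?Z borel (\<lambda>z. 0 + A *v z)) = exp (- (t \<bullet> (V *v t)) / 2)" .
  qed simp
qed

section \<open>Lindeberg central limit theorem\<close>

lemma (in prob_space)
  fixes Z :: "'i \<Rightarrow> 'a \<Rightarrow> real"
  assumes fin: "finite J" and indep: "indep_vars (\<lambda>_. borel) Z J"
    and int2: "\<And>j. j \<in> J \<Longrightarrow> integrable M (\<lambda>\<omega>. (Z j \<omega>)\<^sup>2)"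
    and mean: "\<And>j. j \<in> J \<Longrightarrow> expectation (Z j) = 0"
  shows integrable_square_sum_indep: "integrable M (\<lambda>\<omega>. (\<Sum>j\<in>J. Z j \<omega>)\<^sup>2)" (is ?int)
    and expectation_square_sum_indep:
      "expectation (\<lambda>\<omega>. (\<Sum>j\<in>J. Z j \<omega>)\<^sup>2) = (\<Sum>j\<in>J. expectation (\<lambda>\<omega>. (Z j \<omega>)\<^sup>2))" (is ?eq)
proof -
  have "?int \<and> ?eq"
    using fin indep int2 mean
  proof (induction J rule: finite_induct)
    case (insert i J)
    have rv[measurable]: "random_variable borel (Z j)" if "j \<in> insert i J" for j
      using insert.prems(1) that by (auto simp: indep_vars_def)
    have int1: "integrable M (Z j)" if "j \<in> insert i J" for j
      by (rule square_integrable_imp_integrable[OF rv[OF that]]) (use insert.prems(2) that in auto)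
    have indJ: "indep_vars (\<lambda>_. borel) Z J"
      by (rule indep_vars_subset[OF insert.prems(1)]) auto
    have IH: "integrable M (\<lambda>\<omega>. (\<Sum>j\<in>J. Z j \<omega>)\<^sup>2)"
        "expectation (\<lambda>\<omega>. (\<Sum>j\<in>J. Z j \<omega>)\<^sup>2) = (\<Sum>j\<in>J. expectation (\<lambda>\<omega>. (Z j \<omega>)\<^sup>2))"
      using insert.IH[OF indJ] insert.prems by auto
    have two: "indep_var borel (Z i) borel (\<lambda>\<omega>. \<Sum>j\<in>J. Z j \<omega>)"
      using insert.hyps insert.prems(1) by (rule indep_vars_sum)
    have intJ: "integrable M (\<lambda>\<omega>. \<Sum>j\<in>J. Z j \<omega>)"
      by (intro Bochner_Integration.integrable_sum int1) auto
    have cross: "integrable M (\<lambda>\<omega>. Z i \<omega> * (\<Sum>j\<in>J. Z j \<omega>))"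
        "expectation (\<lambda>\<omega>. Z i \<omega> * (\<Sum>j\<in>J. Z j \<omega>)) = 0"
      using indep_var_integrable[OF two int1 intJ] indep_var_lebesgue_integral[OF two int1 intJ]
        insert.prems(3) by auto
    have expand: "(\<Sum>j\<in>insert i J. Z j \<omega>)\<^sup>2
        = (Z i \<omega>)\<^sup>2 + 2 * (Z i \<omega> * (\<Sum>j\<in>J. Z j \<omega>)) + (\<Sum>j\<in>J. Z j \<omega>)\<^sup>2" for \<omega>
      using insert.hyps by (simp add: power2_sum)
    show ?case
      unfolding expand using cross IH insert.prems(2)[of i] insert.hyps
      by (simp del: sum.insert) simp
  qed (simp add: prob_space)
  then show ?int ?eq by blast+
qed

lemma exp_minus_second_order:
  fixes x :: real
  assumes "0 \<le> x"
  shows "\<bar>(1 - x) - exp (- x)\<bar> \<le> x\<^sup>2 / 2"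
proof -
  have lower: "1 - x \<le> exp (- x)"
    using exp_ge_add_one_self[of "- x"] by simp
  have "exp (- x) \<le> 1 - x + x\<^sup>2 / 2"
  proof -
    have "\<exists>t. \<bar>t\<bar> \<le> \<bar>- x\<bar> \<and> exp (- x) = (\<Sum>m<3. (- x) ^ m / fact m) + exp t / fact 3 * (- x) ^ 3"
      by (rule Maclaurin_exp_le)
    then obtain t where "exp (- x) = (\<Sum>m<3. (- x) ^ m / fact m) + exp t / fact 3 * (- x) ^ 3"
      by blast
    moreover have "exp t / fact 3 * (- x) ^ 3 \<le> 0"
      using assms by (simp add: power3_eq_cube)
    ultimately show ?thesis
      by (simp add: numeral_3_eq_3 power2_eq_square)
  qed
  with lower show ?thesis by simp
qed

text \<open>
  The Taylor remainder of the characteristic function is controlled by the minimum of a quadratic and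
  a cubic term; the cubic one is used where \<open>Z\<close> is at most \<open>e\<close>, the quadratic one elsewhere.  The same
  cut gives \<open>s \<le> e\<^sup>2 + l\<close>, so the second order error of the exponential is small as well.
\<close>

lemma (in prob_space) char_gaussian_approx:
  fixes Z :: "'a \<Rightarrow> real"
  assumes [measurable]: "random_variable borel Z" and int2: "integrable M (\<lambda>\<omega>. (Z \<omega>)\<^sup>2)"
    and mean: "expectation Z = 0" and e: "0 \<le> e"
  defines "s \<equiv> expectation (\<lambda>\<omega>. (Z \<omega>)\<^sup>2)"
    and "l \<equiv> expectation (\<lambda>\<omega>. (Z \<omega>)\<^sup>2 * indicator {x. \<bar>x\<bar> > e} (Z \<omega>))"
  shows "cmod (char (distr M borel Z) 1 - exp (- s / 2)) \<le> l + e * s / 6 + s * (e\<^sup>2 + l) / 8"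
proof -
  have int1: "integrable M Z"
    by (rule square_integrable_imp_integrable[OF _ int2]) simp
  have intl: "integrable M (\<lambda>\<omega>. (Z \<omega>)\<^sup>2 * indicator {x. \<bar>x\<bar> > e} (Z \<omega>))"
    by (rule Bochner_Integration.integrable_bound[OF int2]) (auto simp: indicator_def)
  have s0: "0 \<le> s" by (simp add: s_def)
  have l0: "0 \<le> l" by (simp add: l_def)
  have "s \<le> expectation (\<lambda>\<omega>. e\<^sup>2 + (Z \<omega>)\<^sup>2 * indicator {x. \<bar>x\<bar> > e} (Z \<omega>))"
    unfolding s_def using int2 intl
    by (intro integral_mono) (auto simp: indicator_def abs_le_square_iff[symmetric] not_less e)
  also have "\<dots> = e\<^sup>2 + l"
    using intl by (simp add: l_def prob_space)
  finally have s_le: "s \<le> e\<^sup>2 + l" .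
  have cut: "min (6 * z\<^sup>2) (\<bar>z\<bar> ^ 3) \<le> 6 * (z\<^sup>2 * indicator {x. \<bar>x\<bar> > e} z) + e * z\<^sup>2" for z :: real
  proof (cases "\<bar>z\<bar> > e")
    case True
    then show ?thesis using e by (simp add: min.coboundedI1)
  next
    case False
    have "\<bar>z\<bar> ^ 3 = \<bar>z\<bar> * z\<^sup>2" by (simp add: power3_eq_cube power2_eq_square)
    also have "\<dots> \<le> e * z\<^sup>2" using False by (intro mult_right_mono) auto
    finally show ?thesis using False by (simp add: min.coboundedI2)
  qed
  have intmin: "integrable M (\<lambda>\<omega>. min (6 * (Z \<omega>)\<^sup>2) (\<bar>Z \<omega>\<bar> ^ 3))"
    by (rule Bochner_Integration.integrable_bound[OF integrable_mult_right[OF int2, of 6]])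
      (auto simp: min_def)
  have "expectation (\<lambda>\<omega>. min (6 * (Z \<omega>)\<^sup>2) (\<bar>Z \<omega>\<bar> ^ 3))
      \<le> expectation (\<lambda>\<omega>. 6 * ((Z \<omega>)\<^sup>2 * indicator {x. \<bar>x\<bar> > e} (Z \<omega>)) + e * (Z \<omega>)\<^sup>2)"
    using intmin intl int2 cut by (intro integral_mono) auto
  also have "\<dots> = 6 * l + e * s"
    using intl int2 by (simp add: l_def s_def)
  finally have third: "expectation (\<lambda>\<omega>. min (6 * (Z \<omega>)\<^sup>2) (\<bar>Z \<omega>\<bar> ^ 3)) \<le> 6 * l + e * s" .
  have "cmod (char (distr M borel Z) 1 - (1 - 1\<^sup>2 * s / 2))
      \<le> 1\<^sup>2 / 6 * expectation (\<lambda>\<omega>. min (6 * (Z \<omega>)\<^sup>2) (\<bar>1\<bar> * \<bar>Z \<omega>\<bar> ^ 3))"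
    using char_approx3'[of Z s "distr M borel Z" 1] int1 int2 mean by (simp add: s_def)
  then have 1: "cmod (char (distr M borel Z) 1 - of_real (1 - s / 2)) \<le> l + e * s / 6"
    using third by simp
  have "cmod (of_real (1 - s / 2) - exp (- s / 2)) = \<bar>(1 - s / 2) - exp (- (s / 2))\<bar>"
    by (simp flip: norm_of_real[where 'a = complex] exp_of_real)
  also have "\<dots> \<le> (s / 2)\<^sup>2 / 2"
    using s0 by (intro exp_minus_second_order) simp
  also have "\<dots> = s * s / 8" by (simp add: power2_eq_square)
  also have "\<dots> \<le> s * (e\<^sup>2 + l) / 8"
    using s_le s0 by (intro divide_right_mono mult_left_mono) auto
  finally have 2: "cmod (of_real (1 - s / 2) - exp (- s / 2)) \<le> s * (e\<^sup>2 + l) / 8" .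
  show ?thesis
    using norm_triangle_mono[OF 1 2] by simp
qed

text \<open>
  The characteristic function of the sum and the Gaussian one are both products over the summands with
  factors of modulus at most 1, so their distance is at most the sum of the distances of the factors.
  Frequency 1 suffices, as other frequencies amount to rescaling the array.  The limit variance may
  vanish.
\<close>

theorem lindeberg_char_tendsto:
  fixes M :: "nat \<Rightarrow> 'a measure" and Z :: "nat \<Rightarrow> 'i \<Rightarrow> 'a \<Rightarrow> real" and J :: "nat \<Rightarrow> 'i set"
  assumes array: "\<forall>\<^sub>F n in sequentially. prob_space (M n) \<and> finite (J n) \<and>
      prob_space.indep_vars (M n) (\<lambda>_. borel) (Z n) (J n) \<and>
      (\<forall>j\<in>J n. integrable (M n) (\<lambda>\<omega>. (Z n j \<omega>)\<^sup>2) \<and> (\<integral>\<omega>. Z n j \<omega> \<partial>M n) = 0)"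
    and variance: "(\<lambda>n. \<Sum>j\<in>J n. \<integral>\<omega>. (Z n j \<omega>)\<^sup>2 \<partial>M n) \<longlonglongrightarrow> v"
    and lindeberg: "\<And>e. e > 0 \<Longrightarrow>
      (\<lambda>n. \<Sum>j\<in>J n. \<integral>\<omega>. (Z n j \<omega>)\<^sup>2 * indicator {x. \<bar>x\<bar> > e} (Z n j \<omega>) \<partial>M n) \<longlonglongrightarrow> 0"
  shows "(\<lambda>n. \<integral>\<omega>. iexp (\<Sum>j\<in>J n. Z n j \<omega>) \<partial>M n) \<longlonglongrightarrow> exp (- v / 2)"
proof -
  define s where "s n j = (\<integral>\<omega>. (Z n j \<omega>)\<^sup>2 \<partial>M n)" for n j
  define V where "V n = (\<Sum>j\<in>J n. s n j)" for n
  define l where "l e n j = (\<integral>\<omega>. (Z n j \<omega>)\<^sup>2 * indicator {x. \<bar>x\<bar> > e} (Z n j \<omega>) \<partial>M n)" for e n j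
  define L where "L e n = (\<Sum>j\<in>J n. l e n j)" for e n
  define \<phi> where "\<phi> n = (\<integral>\<omega>. iexp (\<Sum>j\<in>J n. Z n j \<omega>) \<partial>M n)" for n
  have s0: "0 \<le> s n j" and l0: "0 \<le> l e n j" for e n j
    by (simp_all add: s_def l_def)
  have V: "V \<longlonglongrightarrow> v" and L: "L e \<longlonglongrightarrow> 0" if "e > 0" for e
    using variance lindeberg[OF that] by (simp_all add: V_def[abs_def] s_def L_def[abs_def] l_def)
  have v0: "0 \<le> v"
    by (rule tendsto_lowerbound[OF V[OF zero_less_one]]) (auto simp: V_def intro!: sum_nonneg s0 always_eventually)
  have bound: "\<forall>\<^sub>F n in sequentially. cmod (\<phi> n - exp (- V n / 2)) \<le> L e n + e * V n / 6 + V n * (e\<^sup>2 + L e n) / 8"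
    if "e > 0" for e
    using array
  proof eventually_elim
    case (elim n)
    then interpret prob_space "M n" by simp
    have indep: "indep_vars (\<lambda>_. borel) (Z n) (J n)" and fin: "finite (J n)" using elim by auto
    have rv: "random_variable borel (Z n j)" if "j \<in> J n" for j
      using indep that by (auto simp: indep_vars_def)
    have "\<phi> n = char (distr (M n) borel (\<lambda>\<omega>. \<Sum>j\<in>J n. Z n j \<omega>)) 1"
      unfolding \<phi>_def char_def using rv by (subst integral_distr) auto
    also have "\<dots> = (\<Prod>j\<in>J n. char (distr (M n) borel (Z n j)) 1)"
      by (rule char_distr_sum[OF indep])
    finally have "\<phi> n = (\<Prod>j\<in>J n. char (distr (M n) borel (Z n j)) 1)" .
    moreover have "exp (- V n / 2) = (\<Prod>j\<in>J n. exp (- s n j / 2))"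
      using fin by (simp add: V_def sum_negf sum_divide_distrib flip: exp_sum)
    ultimately have "cmod (\<phi> n - exp (- V n / 2))
        = cmod ((\<Prod>j\<in>J n. char (distr (M n) borel (Z n j)) 1) - (\<Prod>j\<in>J n. complex_of_real (exp (- s n j / 2))))"
      by simp
    also have "\<dots> \<le> (\<Sum>j\<in>J n. cmod (char (distr (M n) borel (Z n j)) 1 - complex_of_real (exp (- s n j / 2))))"
    proof (rule norm_prod_diff)
      fix j assume "j \<in> J n"
      then interpret Zj: real_distribution "distr (M n) borel (Z n j)"
        by (intro real_distribution_distr rv)
      show "cmod (char (distr (M n) borel (Z n j)) 1) \<le> 1" by (rule Zj.cmod_char_le_1)
      show "cmod (complex_of_real (exp (- s n j / 2))) \<le> 1"
        unfolding norm_of_real using s0[of n j] by simp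
    qed
    also have "\<dots> \<le> (\<Sum>j\<in>J n. l e n j + e * s n j / 6 + s n j * (e\<^sup>2 + L e n) / 8)"
    proof (rule sum_mono)
      fix j assume j: "j \<in> J n"
      have "cmod (char (distr (M n) borel (Z n j)) 1 - exp (- s n j / 2))
          \<le> l e n j + e * s n j / 6 + s n j * (e\<^sup>2 + l e n j) / 8"
        unfolding s_def l_def using elim j \<open>e > 0\<close>
        by (intro char_gaussian_approx[OF rv[OF j]]) auto
      also have "\<dots> \<le> l e n j + e * s n j / 6 + s n j * (e\<^sup>2 + L e n) / 8"
        using member_le_sum[OF j, of "l e n"] fin l0 s0
        by (intro add_left_mono divide_right_mono mult_left_mono) (auto simp: L_def)
      finally show "cmod (char (distr (M n) borel (Z n j)) 1 - complex_of_real (exp (- s n j / 2)))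
          \<le> l e n j + e * s n j / 6 + s n j * (e\<^sup>2 + L e n) / 8"
        by (simp flip: exp_of_real)
    qed
    also have "\<dots> = L e n + e * V n / 6 + V n * (e\<^sup>2 + L e n) / 8"
      by (simp add: sum.distrib V_def L_def sum_distrib_left sum_distrib_right sum_divide_distrib)
    finally show ?case .
  qed
  have "(\<lambda>n. \<phi> n - exp (- V n / 2)) \<longlonglongrightarrow> 0"
  proof (rule tendstoI)
    fix r :: real assume r: "r > 0"
    \<comment> \<open>The bound tends to \<open>e v / 6 + v e\<^sup>2 / 8\<close>, which is at most \<open>e v < r\<close> for \<open>0 < e \<le> 1\<close>.\<close>
    define e where "e = min 1 (r / (v + 1))"
    have e: "e > 0" "e \<le> 1" "e * (v + 1) \<le> r"
      using r v0 by (simp_all add: e_def flip: pos_le_divide_eq)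
    have "(\<lambda>n. L e n + e * V n / 6 + V n * (e\<^sup>2 + L e n) / 8) \<longlonglongrightarrow> 0 + e * v / 6 + v * (e\<^sup>2 + 0) / 8"
      by (intro tendsto_intros V[OF e(1)] L[OF e(1)]) auto
    moreover have "0 + e * v / 6 + v * (e\<^sup>2 + 0) / 8 < r"
    proof -
      have "v * e\<^sup>2 \<le> v * e"
        using e v0 by (intro mult_left_mono) (auto simp: power2_eq_square mult_left_le)
      moreover have "0 \<le> v * e" using e v0 by simp
      moreover have "v * e + e \<le> r" using e(3) by (simp add: algebra_simps)
      ultimately show ?thesis using e(1) by (simp add: mult.commute[of e v])
    qed
    ultimately have "\<forall>\<^sub>F n in sequentially. L e n + e * V n / 6 + V n * (e\<^sup>2 + L e n) / 8 < r"
      by (rule order_tendstoD(2))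
    with bound[OF e(1)] show "\<forall>\<^sub>F n in sequentially. dist (\<phi> n - exp (- V n / 2)) 0 < r"
      by eventually_elim simp
  qed
  moreover have "(\<lambda>n. complex_of_real (exp (- V n / 2))) \<longlonglongrightarrow> complex_of_real (exp (- v / 2))"
    by (intro tendsto_intros V[OF zero_less_one]) simp
  ultimately have "(\<lambda>n. (\<phi> n - exp (- V n / 2)) + exp (- V n / 2)) \<longlonglongrightarrow> 0 + complex_of_real (exp (- v / 2))"
    by (rule tendsto_add)
  then show ?thesis by (simp add: \<phi>_def)
qed

section \<open>Inverses, determinants and perturbed linear systems\<close>

lemma matrix_inv_mult:
  fixes A :: "real ^ 'n ^ 'n"
  assumes "invertible A"
  shows "A ** matrix_inv A = mat 1" "matrix_inv A ** A = mat 1"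
  using someI_ex[OF assms[unfolded invertible_def]] by (simp_all add: matrix_inv_def)

lemma abs_det_le_fact:
  fixes A :: "real ^ 'n ^ 'n"
  assumes "\<And>i j. \<bar>A $ i $ j\<bar> \<le> 1"
  shows "\<bar>det A\<bar> \<le> fact CARD('n)"
proof -
  have "\<bar>det A\<bar> \<le> (\<Sum>q\<in>{q. q permutes (UNIV :: 'n set)}. \<bar>of_int (sign q) * (\<Prod>i\<in>UNIV. A $ i $ q i)\<bar>)"
    unfolding det_def by (rule sum_abs)
  also have "\<dots> \<le> (\<Sum>q\<in>{q. q permutes (UNIV :: 'n set)}. 1)"
  proof (rule sum_mono)
    fix q :: "'n \<Rightarrow> 'n"
    have "(\<Prod>i\<in>UNIV. \<bar>A $ i $ q i\<bar>) \<le> 1"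
      by (rule prod_le_1) (simp add: assms)
    then show "\<bar>of_int (sign q) * (\<Prod>i\<in>UNIV. A $ i $ q i)\<bar> \<le> (1::real)"
      by (simp add: abs_mult abs_prod sign_def)
  qed
  also have "\<dots> = fact CARD('n)"
    by (simp add: card_permutations[OF refl])
  finally show ?thesis .
qed

lemma abs_matrix_inv_le:
  fixes A :: "real ^ 'n ^ 'n"
  assumes A: "\<And>i j. \<bar>A $ i $ j\<bar> \<le> 1" and C: "0 < C" "C < det A"
  shows "\<bar>matrix_inv A $ i $ k\<bar> \<le> fact CARD('n) / C"
proof -
  have det: "det A \<noteq> 0" "det A > 0" using C by auto
  then have inv: "invertible A" by (simp add: invertible_det_nz)
  define x where "x = matrix_inv A *v axis k 1"
  have "A *v x = axis k 1"
    by (simp add: x_def matrix_vector_mul_assoc matrix_inv_mult(1)[OF inv])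
  then have "x = (\<chi> l. det (\<chi> i j. if j = l then axis k 1 $ i else A $ i $ j) / det A)"
    using cramer[OF det(1)] by blast
  then have "x $ i = det (\<chi> r j. if j = i then axis k 1 $ r else A $ r $ j) / det A"
    by (metis (no_types, lifting) vec_lambda_beta)
  moreover have "x $ i = matrix_inv A $ i $ k"
    by (simp add: x_def matrix_vector_mult_basis column_def)
  moreover have "\<bar>det (\<chi> r j. if j = i then axis k 1 $ r else A $ r $ j)\<bar> \<le> fact CARD('n)"
    by (rule abs_det_le_fact) (auto simp: A axis_def)
  ultimately show ?thesis
    using C det(2) by (auto intro!: frac_le)
qed

lemma transpose_matrix_inv_symmetric:
  fixes D :: "real ^ 'n ^ 'n"
  assumes "invertible D" "transpose D = D"
  shows "transpose (matrix_inv D) = matrix_inv D"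
proof -
  have "transpose (matrix_inv D) ** D = transpose (D ** matrix_inv D)"
    by (simp add: matrix_transpose_mul assms(2))
  also have "\<dots> = mat 1"
    by (simp add: matrix_inv_mult[OF assms(1)] transpose_mat)
  finally have "transpose (matrix_inv D) ** D ** matrix_inv D = matrix_inv D"
    by simp
  then show ?thesis
    by (simp add: matrix_inv_mult[OF assms(1)] flip: matrix_mul_assoc)
qed

text \<open>
  From \<open>v - D\<^sup>-\<^sup>1 H v = - D\<^sup>-\<^sup>1 (H - D) v\<close> the operator \<open>D\<^sup>-\<^sup>1 H\<close> differs from the identity by at most
  \<open>c \<delta> \<le> 1/2\<close> in norm.  It is thus injective, and a solution of \<open>H t = s\<close> is at most twice as long as the
  solution of the system with \<open>D\<close>; inserting this into the same identity gives the bound.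
\<close>

lemma perturbed_linear_system:
  fixes D H :: "real ^ 'n ^ 'n"
  defines "c \<equiv> onorm ((*v) (matrix_inv D)) * (real CARD('n) * real CARD('n))"
  assumes D: "invertible D" and entries: "\<And>i j. \<bar>H $ i $ j - D $ i $ j\<bar> \<le> \<delta>" and small: "c * \<delta> \<le> 1 / 2"
  shows "invertible H"
    and "H *v t = s \<Longrightarrow> norm (t - matrix_inv D *v s) \<le> 2 * (c * \<delta>) * norm (matrix_inv D *v s)"
proof -
  have key: "norm (v - matrix_inv D *v (H *v v)) \<le> c * \<delta> * norm v" for v
  proof -
    have bl: "bounded_linear ((*v) M)" for M :: "real ^ 'n ^ 'n"
      by (rule matrix_vector_mul_bounded_linear)
    have "v - matrix_inv D *v (H *v v) = - (matrix_inv D *v ((H - D) *v v))"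
      by (simp add: matrix_vector_mult_diff_rdistrib matrix_vector_mult_diff_distrib
          matrix_vector_mul_assoc matrix_inv_mult(2)[OF D])
    then have "norm (v - matrix_inv D *v (H *v v)) = norm (matrix_inv D *v ((H - D) *v v))"
      by simp
    also have "\<dots> \<le> onorm ((*v) (matrix_inv D)) * norm ((H - D) *v v)"
      by (rule onorm[OF bl])
    also have "\<dots> \<le> onorm ((*v) (matrix_inv D)) * (real CARD('n) * real CARD('n) * \<delta> * norm v)"
    proof (rule mult_left_mono[OF _ onorm_pos_le[OF bl]])
      have "norm ((H - D) *v v) \<le> onorm ((*v) (H - D)) * norm v"
        by (rule onorm[OF bl])
      also have "\<dots> \<le> real CARD('n) * real CARD('n) * \<delta> * norm v"
        using entries by (intro mult_right_mono onorm_le_matrix_component) auto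
      finally show "norm ((H - D) *v v) \<le> real CARD('n) * real CARD('n) * \<delta> * norm v" .
    qed
    finally show ?thesis by (simp add: c_def mult_ac)
  qed
  have "v = 0" if "H *v v = 0" for v
  proof -
    have "norm v \<le> c * \<delta> * norm v" using key[of v] that by simp
    also have "\<dots> \<le> 1 / 2 * norm v" using small by (intro mult_right_mono) auto
    finally show ?thesis by simp
  qed
  then show "invertible H"
    by (meson invertible_left_inverse matrix_left_invertible_ker)
  assume s: "H *v t = s"
  let ?u = "matrix_inv D *v s"
  have tu: "norm (t - ?u) \<le> c * \<delta> * norm t" using key[of t] s by simp
  also have "\<dots> \<le> 1 / 2 * norm t" using small by (intro mult_right_mono) auto
  finally have "norm (t - ?u) \<le> 1 / 2 * norm t" .
  then have t: "norm t \<le> 2 * norm ?u"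
    using norm_triangle_ineq2[of t ?u] by simp
  have "0 \<le> c * \<delta>"
  proof -
    have "0 \<le> \<delta>" using entries[of undefined undefined] by linarith
    then show ?thesis unfolding c_def by (intro mult_nonneg_nonneg onorm_pos_le matrix_vector_mul_bounded_linear) auto
  qed
  with tu t show "norm (t - ?u) \<le> 2 * (c * \<delta>) * norm ?u"
    using mult_left_mono[OF t, of "c * \<delta>"] by simp
qed

section \<open>Functions with fourth moments\<close>

lemma abs_prod4_le:
  fixes a b c d :: real
  shows "\<bar>a * b * c * d\<bar> \<le> a ^ 4 + b ^ 4 + c ^ 4 + d ^ 4"
proof -
  have sq: "\<bar>x * y\<bar> \<le> (x\<^sup>2 + y\<^sup>2) / 2" for x y :: real
    using sum_squares_bound[of "\<bar>x\<bar>" "\<bar>y\<bar>"] by (simp add: abs_mult)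
  have "\<bar>a * b * c * d\<bar> \<le> ((a * b)\<^sup>2 + (c * d)\<^sup>2) / 2"
    using sq[of "a * b" "c * d"] by (simp add: mult.assoc)
  moreover have "(a * b)\<^sup>2 \<le> (a ^ 4 + b ^ 4) / 2" "(c * d)\<^sup>2 \<le> (c ^ 4 + d ^ 4) / 2"
    using sq[of "a\<^sup>2" "b\<^sup>2"] sq[of "c\<^sup>2" "d\<^sup>2"] by (simp_all add: power_mult_distrib)
  moreover have "0 \<le> a ^ 4" "0 \<le> b ^ 4" "0 \<le> c ^ 4" "0 \<le> d ^ 4" by simp_all
  ultimately show ?thesis by (simp add: field_simps)
qed

text \<open>
  Square integrability of the scores involves products of four regressors or errors.  A single fourth
  moment condition on each factor handles all of them, and it is stable under linear combinations.
\<close>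

definition fourth_moment :: "'a measure \<Rightarrow> ('a \<Rightarrow> real) \<Rightarrow> bool" where
  "fourth_moment M f \<longleftrightarrow> f \<in> borel_measurable M \<and> integrable M (\<lambda>x. f x ^ 4)"

lemma integrable_prod4:
  assumes "fourth_moment M f" "fourth_moment M g" "fourth_moment M h" "fourth_moment M l"
  shows "integrable M (\<lambda>x. f x * g x * h x * l x)"
proof (rule Bochner_Integration.integrable_bound)
  show "integrable M (\<lambda>x. f x ^ 4 + g x ^ 4 + h x ^ 4 + l x ^ 4)"
    using assms by (simp add: fourth_moment_def)
  show "(\<lambda>x. f x * g x * h x * l x) \<in> borel_measurable M"
    using assms by (intro borel_measurable_times) (auto simp: fourth_moment_def)
  show "AE x in M. norm (f x * g x * h x * l x) \<le> norm (f x ^ 4 + g x ^ 4 + h x ^ 4 + l x ^ 4)"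
    unfolding real_norm_def by (intro AE_I2 order_trans[OF abs_prod4_le abs_ge_self])
qed

lemma fourth_moment_add:
  assumes "fourth_moment M f" "fourth_moment M g"
  shows "fourth_moment M (\<lambda>x. f x + g x)"
proof -
  have "(f x + g x) ^ 4 = f x * f x * f x * f x + 4 * (f x * f x * f x * g x)
      + 6 * (f x * f x * g x * g x) + 4 * (f x * g x * g x * g x) + g x * g x * g x * g x" for x
    by (simp add: power4_eq_xxxx algebra_simps)
  then show ?thesis
    using assms by (auto simp: fourth_moment_def[of M "\<lambda>x. f x + g x"] intro!: Bochner_Integration.integrable_add
        integrable_mult_right integrable_prod4) (auto simp: fourth_moment_def)
qed

lemma fourth_moment_cmult:
  assumes "fourth_moment M f"
  shows "fourth_moment M (\<lambda>x. c * f x)"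
  using assms by (auto simp: fourth_moment_def power_mult_distrib)

lemma (in prob_space) fourth_moment_const: "fourth_moment M (\<lambda>x. c)"
  by (simp add: fourth_moment_def)

lemma (in prob_space) fourth_moment_sum:
  assumes "\<And>i. i \<in> I \<Longrightarrow> fourth_moment M (f i)"
  shows "fourth_moment M (\<lambda>x. \<Sum>i\<in>I. f i x)"
  using assms
  by (induction I rule: infinite_finite_induct) (auto intro: fourth_moment_const fourth_moment_add)

section \<open>Mixture components\<close>

context mixture_regression
begin

lemma measurable_observation:
  assumes "j \<in> {1..N}"
  shows "(\<lambda>\<omega>. (\<kappa> N j \<omega>, (Y N j \<omega>, X N j \<omega>))) \<in> measurable (P N) (count_space UNIV \<Otimes>\<^sub>M borel)"
proof -
  have "N \<ge> 1" using assms by simp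
  then interpret prob_space "P N" by (rule prob_space_P)
  show ?thesis
    using independent_subjects[OF \<open>N \<ge> 1\<close>] assms by (auto simp: indep_vars_def)
qed

lemma measurable_component:
  assumes "j \<in> {1..N}"
  shows "\<kappa> N j \<in> measurable (P N) (count_space UNIV)"
  using measurable_compose[OF measurable_observation[OF assms] measurable_fst] by simp

lemma measurable_response:
  assumes "j \<in> {1..N}"
  shows "Y N j \<in> borel_measurable (P N)" and "X N j \<in> borel_measurable (P N)"
proof -
  have "(\<lambda>\<omega>. (Y N j \<omega>, X N j \<omega>)) \<in> measurable (P N) (borel \<Otimes>\<^sub>M borel)"
    unfolding borel_prod
    using measurable_compose[OF measurable_observation[OF assms] measurable_snd] by simp
  from measurable_compose[OF this measurable_fst] measurable_compose[OF this measurable_snd]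
  show "Y N j \<in> borel_measurable (P N)" and "X N j \<in> borel_measurable (P N)" by simp_all
qed

lemma response_eq:
  assumes "j \<in> {1..N}" "\<omega> \<in> space (P N)"
  shows "Y N j \<omega> = b (\<kappa> N j \<omega>) \<bullet> X N j \<omega> + \<epsilon> N j \<omega>"
  using regression[OF assms] by (simp add: inner_vec_def)

lemma measurable_error:
  assumes j: "j \<in> {1..N}"
  shows "\<epsilon> N j \<in> borel_measurable (P N)"
proof -
  note [measurable] = measurable_component[OF j] measurable_response[OF j]
  have "(\<lambda>\<omega>. b (\<kappa> N j \<omega>)) \<in> borel_measurable (P N)"
    by (rule measurable_compose[OF measurable_component[OF j]]) simp
  then have "(\<lambda>\<omega>. Y N j \<omega> - b (\<kappa> N j \<omega>) \<bullet> X N j \<omega>) \<in> borel_measurable (P N)"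
    by measurable
  then show ?thesis
    by (rule measurable_cong[THEN iffD1, rotated]) (simp add: response_eq[OF j])
qed

lemma concentration_bounds:
  assumes j: "j \<in> {1..N}"
  shows "0 \<le> p N j k" "p N j k \<le> 1" "(\<Sum>k\<in>UNIV. p N j k) = 1"
proof -
  interpret prob_space "P N" using prob_space_P j by simp
  show "0 \<le> p N j k" "p N j k \<le> 1"
    using concentration[OF j, of k, symmetric] by simp_all
  note [measurable] = measurable_component[OF j]
  have "prob (\<Union>k\<in>UNIV. {\<omega> \<in> space (P N). \<kappa> N j \<omega> = k}) = (\<Sum>k\<in>UNIV. prob {\<omega> \<in> space (P N). \<kappa> N j \<omega> = k})"
    by (rule finite_measure_finite_Union) (auto simp: disjoint_family_on_def)
  also have "(\<Union>k\<in>UNIV. {\<omega> \<in> space (P N). \<kappa> N j \<omega> = k}) = space (P N)" by auto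
  finally show "(\<Sum>k\<in>UNIV. p N j k) = 1"
    by (simp add: concentration[OF j] prob_space)
qed

text \<open>
  The conditional law describes the subject on the event \<open>\<kappa> = k\<close> only if this event has positive
  probability; otherwise both sides vanish.
\<close>

lemma component_contribution:
  assumes j: "j \<in> {1..N}" and g: "integrable (F k) g"
  shows "has_bochner_integral (P N)
    (\<lambda>\<omega>. indicator {\<omega> \<in> space (P N). \<kappa> N j \<omega> = k} \<omega> * g (X N j \<omega>, \<epsilon> N j \<omega>)) (p N j k * (\<integral>z. g z \<partial>F k))"
proof -
  interpret prob_space "P N" using prob_space_P j by simp
  note [measurable] = measurable_component[OF j] measurable_response[OF j] measurable_error[OF j]
  define A where "A = {\<omega> \<in> space (P N). \<kappa> N j \<omega> = k}"
  have A[measurable]: "A \<in> events" by (simp add: A_def)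
  have pA: "prob A = p N j k" using concentration[OF j] by (simp add: A_def)
  have g_meas[measurable]: "g \<in> borel_measurable borel"
    using borel_measurable_integrable[OF g] by (simp cong: measurable_cong_sets add: sets_F)
  have pair[measurable]: "(\<lambda>\<omega>. (X N j \<omega>, \<epsilon> N j \<omega>)) \<in> borel_measurable (P N)"
    by (simp flip: borel_prod)
  show ?thesis
  proof (cases "p N j k = 0")
    case True
    then have "emeasure (P N) A = 0" using pA by (simp add: emeasure_eq_measure)
    then have null: "AE \<omega> in P N. \<omega> \<notin> A" by (intro AE_not_in null_setsI A)
    have "has_bochner_integral (P N) (\<lambda>\<omega>. 0) (0::real)" by (rule has_bochner_integral_zero)
    then have "has_bochner_integral (P N) (\<lambda>\<omega>. indicator A \<omega> * g (X N j \<omega>, \<epsilon> N j \<omega>)) (0::real)"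
      by (rule has_bochner_integralI_AE) (use null in auto)
    then show ?thesis using True by (simp add: A_def)
  next
    case False
    then have pos: "p N j k > 0" using concentration_bounds(1)[OF j, of k] by simp
    define U where "U = uniform_measure (P N) A"
    have U: "U = density (P N) (\<lambda>\<omega>. ennreal (indicator A \<omega> / p N j k))"
      unfolding U_def uniform_measure_def emeasure_eq_measure pA
      using pos by (intro arg_cong[where f = "density (P N)"] ext) (auto simp: indicator_def divide_ennreal ennreal_1[symmetric] simp del: ennreal_1)
    have FU: "F k = distr U borel (\<lambda>\<omega>. (X N j \<omega>, \<epsilon> N j \<omega>))"
      using conditional_law[OF j pos] by (simp add: U_def A_def)
    have pairU: "(\<lambda>\<omega>. (X N j \<omega>, \<epsilon> N j \<omega>)) \<in> measurable U borel"
      by (simp add: U)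
    have "integrable U (\<lambda>\<omega>. g (X N j \<omega>, \<epsilon> N j \<omega>))"
      using g unfolding FU by (rule integrable_distr[OF pairU])
    then have int: "integrable (P N) (\<lambda>\<omega>. (indicator A \<omega> / p N j k) * g (X N j \<omega>, \<epsilon> N j \<omega>))"
      unfolding U using pos by (subst (asm) integrable_density) auto
    have "(\<integral>z. g z \<partial>F k) = (\<integral>\<omega>. g (X N j \<omega>, \<epsilon> N j \<omega>) \<partial>U)"
      unfolding FU by (rule integral_distr[OF pairU]) simp
    also have "\<dots> = (\<integral>\<omega>. (indicator A \<omega> / p N j k) * g (X N j \<omega>, \<epsilon> N j \<omega>) \<partial>P N)"
      unfolding U using pos by (subst integral_density) auto
    finally have "has_bochner_integral (P N) (\<lambda>\<omega>. (indicator A \<omega> / p N j k) * g (X N j \<omega>, \<epsilon> N j \<omega>)) (\<integral>z. g z \<partial>F k)"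
      using int by (simp add: has_bochner_integral_iff)
    then have "has_bochner_integral (P N) (\<lambda>\<omega>. p N j k * ((indicator A \<omega> / p N j k) * g (X N j \<omega>, \<epsilon> N j \<omega>))) (p N j k * (\<integral>z. g z \<partial>F k))"
      by (rule has_bochner_integral_mult_right)
    then show ?thesis using False by (simp add: A_def)
  qed
qed

lemma expectation_by_component:
  assumes j: "j \<in> {1..N}" and g: "\<And>k. integrable (F k) (g k)"
  shows "has_bochner_integral (P N) (\<lambda>\<omega>. g (\<kappa> N j \<omega>) (X N j \<omega>, \<epsilon> N j \<omega>))
    (\<Sum>k\<in>UNIV. p N j k * (\<integral>z. g k z \<partial>F k))"
proof -
  have "has_bochner_integral (P N)
      (\<lambda>\<omega>. \<Sum>k\<in>UNIV. indicator {\<omega> \<in> space (P N). \<kappa> N j \<omega> = k} \<omega> * g k (X N j \<omega>, \<epsilon> N j \<omega>))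
      (\<Sum>k\<in>UNIV. p N j k * (\<integral>z. g k z \<partial>F k))"
    by (intro has_bochner_integral_sum component_contribution j g)
  then show ?thesis
  proof (rule has_bochner_integral_cong[THEN iffD1, rotated -1])
    fix \<omega> assume "\<omega> \<in> space (P N)"
    then have "(\<Sum>k\<in>UNIV. indicator {\<omega> \<in> space (P N). \<kappa> N j \<omega> = k} \<omega> * g k (X N j \<omega>, \<epsilon> N j \<omega>))
        = (\<Sum>k\<in>UNIV. if k = \<kappa> N j \<omega> then g k (X N j \<omega>, \<epsilon> N j \<omega>) else 0)"
      by (intro sum.cong) auto
    then show "(\<Sum>k\<in>UNIV. indicator {\<omega> \<in> space (P N). \<kappa> N j \<omega> = k} \<omega> * g k (X N j \<omega>, \<epsilon> N j \<omega>))
        = g (\<kappa> N j \<omega>) (X N j \<omega>, \<epsilon> N j \<omega>)" by simp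
  qed simp_all
qed

end

lemma inner_M_matrix:
  "v \<bullet> (M_matrix Q R i l *v w) = (second_moments Q *v v) $ i * (second_moments R *v w) $ l"
  by (simp add: M_matrix_def inner_vec_def matrix_vector_mult_def sum_product sum_distrib_left mult_ac)
    (rule sum.swap)

context mixture_regression
begin

text \<open>
  By Cramer's rule the entries of the inverse are determinants of matrices with entries in the unit
  interval, divided by a determinant that is bounded below.
\<close>

lemma weights_bounded:
  assumes "\<exists>C>0. \<forall>\<^sub>F N in sequentially. det (Gamma_matrix p N) > C"
  obtains K where "K > 0" "\<forall>\<^sub>F N in sequentially. \<forall>j\<in>{1..N}. \<bar>weight p m N j\<bar> \<le> K"
proof -
  obtain C where C: "C > 0" "\<forall>\<^sub>F N in sequentially. det (Gamma_matrix p N) > C"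
    using assms by blast
  show ?thesis
  proof
    show "real CARD('k) * (fact CARD('k) / C) > 0" using C by simp
    show "\<forall>\<^sub>F N in sequentially. \<forall>j\<in>{1..N}. \<bar>weight p m N j\<bar> \<le> real CARD('k) * (fact CARD('k) / C)"
      using C(2)
    proof eventually_elim
      case (elim N)
      have entries: "\<bar>Gamma_matrix p N $ i $ k\<bar> \<le> 1" for i k
      proof (cases "N = 0")
        case False
        have "\<bar>\<Sum>j=1..N. p N j i * p N j k\<bar> \<le> (\<Sum>j=1..N. \<bar>p N j i * p N j k\<bar>)"
          by (rule sum_abs)
        also have "\<dots> \<le> (\<Sum>j=1..N. 1)"
          using concentration_bounds by (intro sum_mono) (auto simp: abs_mult intro!: mult_le_one)
        finally show ?thesis using False by (simp add: Gamma_matrix_def)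
      qed (simp add: Gamma_matrix_def)
      show ?case
      proof
        fix j assume j: "j \<in> {1..N}"
        have "\<bar>weight p m N j\<bar> \<le> (\<Sum>k\<in>UNIV. \<bar>matrix_inv (Gamma_matrix p N) $ m $ k * p N j k\<bar>)"
          unfolding weight_def by (rule sum_abs)
        also have "\<dots> \<le> (\<Sum>k\<in>(UNIV :: 'k set). fact CARD('k) / C * 1)"
          unfolding abs_mult using concentration_bounds[OF j] C(1)
          by (intro sum_mono mult_mono abs_matrix_inv_le entries elim) auto
        finally show "\<bar>weight p m N j\<bar> \<le> real CARD('k) * (fact CARD('k) / C)" by simp
      qed
    qed
  qed
qed

text \<open>
  This is the identity \<open>\<Gamma>\<^sup>-\<^sup>1 \<Gamma> = 1\<close> in row \<open>m\<close>, and the reason for choosing these weights.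
\<close>

lemma sum_weight_concentration:
  assumes "invertible (Gamma_matrix p N)" "N \<ge> 1"
  shows "(\<Sum>j=1..N. weight p m N j * p N j k) = (if k = m then real N else 0)"
proof -
  let ?G = "Gamma_matrix p N"
  have "(\<Sum>j=1..N. weight p m N j * p N j k)
      = (\<Sum>l\<in>UNIV. matrix_inv ?G $ m $ l * (\<Sum>j=1..N. p N j l * p N j k))"
    unfolding weight_def sum_distrib_right sum_distrib_left by (subst sum.swap) (simp add: mult_ac)
  also have "\<dots> = real N * (matrix_inv ?G ** ?G) $ m $ k"
  proof -
    have "(\<Sum>j=1..N. p N j l * p N j k) = real N * Gamma_matrix p N $ l $ k" for l
      using assms(2) by (simp add: Gamma_matrix_def)
    then show ?thesis
      by (simp add: matrix_matrix_mult_def sum_distrib_left mult_ac)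
  qed
  also have "\<dots> = (if k = m then real N else 0)"
    by (simp add: matrix_inv_mult(2)[OF assms(1)] mat_def)
  finally show ?thesis .
qed

text \<open>
  In component \<open>k\<close> the residual with respect to the coefficients of component \<open>m\<close> is the error plus
  the bias caused by the wrong coefficients.
\<close>

definition component_score :: "'k \<Rightarrow> real ^ 'd \<Rightarrow> 'k \<Rightarrow> (real ^ 'd) \<times> real \<Rightarrow> real" where
  "component_score m c k z = (c \<bullet> fst z) * ((b k - b m) \<bullet> fst z + snd z)"

lemma score_eq_component_score:
  assumes "j \<in> {1..N}" "\<omega> \<in> space (P N)"
  shows "c \<bullet> ((Y N j \<omega> - b m \<bullet> X N j \<omega>) *\<^sub>R X N j \<omega>)
    = component_score m c (\<kappa> N j \<omega>) (X N j \<omega>, \<epsilon> N j \<omega>)"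
  by (simp add: component_score_def response_eq[OF assms] inner_diff_left)

end

text \<open>
  The conditions on the component laws are separated from those on the concentrations, since moment
  computations within one component do not see the latter.
\<close>

locale mixture_regression_moments = mixture_regression P \<kappa> X \<epsilon> Y p b F
  for P :: "nat \<Rightarrow> 'w measure" and \<kappa> :: "nat \<Rightarrow> nat \<Rightarrow> 'w \<Rightarrow> 'k::finite"
    and X :: "nat \<Rightarrow> nat \<Rightarrow> 'w \<Rightarrow> real ^ 'd" and \<epsilon> :: "nat \<Rightarrow> nat \<Rightarrow> 'w \<Rightarrow> real"
    and Y :: "nat \<Rightarrow> nat \<Rightarrow> 'w \<Rightarrow> real" and p :: "nat \<Rightarrow> nat \<Rightarrow> 'k \<Rightarrow> real"
    and b :: "'k \<Rightarrow> real ^ 'd" and F :: "'k \<Rightarrow> ((real ^ 'd) \<times> real) measure" +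
  assumes regressor_moments: "\<And>k i. integrable (F k) (\<lambda>z. (fst z $ i) ^ 4)"
    and error_moments: "\<And>k. integrable (F k) (\<lambda>z. (snd z) ^ 4)"
begin

lemma measurable_F: "f \<in> borel_measurable (F k)" if "f \<in> borel_measurable borel"
  using that by (simp cong: measurable_cong_sets add: sets_F)

lemma measurable_F_fst: "(\<lambda>z. f (fst z)) \<in> borel_measurable (F k)" if "f \<in> borel_measurable borel"
  by (rule measurable_F) (intro measurable_compose[OF _ that] borel_measurable_continuous_onI continuous_intros)

lemma measurable_F_snd: "(\<lambda>z. snd z) \<in> borel_measurable (F k)"
  by (intro measurable_F borel_measurable_continuous_onI continuous_intros)

lemma fourth_moment_snd: "fourth_moment (F k) (\<lambda>z. snd z)"
  unfolding fourth_moment_def using error_moments measurable_F_snd by blast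

lemma fourth_moment_component: "fourth_moment (F k) (\<lambda>z. fst z $ i)"
  unfolding fourth_moment_def using regressor_moments measurable_F_fst[of "\<lambda>x. x $ i"] by simp

lemma fourth_moment_one: "fourth_moment (F k) (\<lambda>z. 1)"
  by (rule prob_space.fourth_moment_const[OF prob_space_F])

lemma fourth_moment_inner: "fourth_moment (F k) (\<lambda>z. u \<bullet> fst z)"
  unfolding inner_vec_def
  by (simp add: prob_space.fourth_moment_sum[OF prob_space_F] fourth_moment_cmult fourth_moment_component)

lemmas fourth_moments = fourth_moment_snd fourth_moment_component fourth_moment_one fourth_moment_inner

text \<open>
  Fubini's theorem for the product law.  Regressors and errors take values in different types, whereas
  \<open>indep_var\<close> relates variables with values in the same type.
\<close>

lemma regressor_error_product:
  fixes f :: "real ^ 'd \<Rightarrow> real" and g :: "real \<Rightarrow> real"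
  assumes meas[measurable]: "f \<in> borel_measurable borel" "g \<in> borel_measurable borel"
    and int: "integrable (F k) (\<lambda>z. f (fst z) * g (snd z))"
  shows "(\<integral>z. f (fst z) * g (snd z) \<partial>F k) = (\<integral>z. f (fst z) \<partial>F k) * (\<integral>z. g (snd z) \<partial>F k)"
proof -
  interpret F: prob_space "F k" by (rule prob_space_F)
  define M1 where "M1 = distr (F k) borel fst"
  define M2 where "M2 = distr (F k) borel snd"
  have rv: "fst \<in> borel_measurable (F k)" "snd \<in> borel_measurable (F k)"
    by (intro measurable_F borel_measurable_continuous_onI continuous_intros)+
  interpret M1: prob_space M1 unfolding M1_def by (rule F.prob_space_distr[OF rv(1)])
  interpret M2: prob_space M2 unfolding M2_def by (rule F.prob_space_distr[OF rv(2)])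
  interpret pair_sigma_finite M1 M2 ..
  have FM: "F k = M1 \<Otimes>\<^sub>M M2"
    using regressors_indep_error[of k] by (simp only: M1_def M2_def)
  have "(\<integral>z. f (fst z) * g (snd z) \<partial>F k) = (\<integral>x. (\<integral>y. f x * g y \<partial>M2) \<partial>M1)"
    using integral_fst'[of "\<lambda>z. f (fst z) * g (snd z)"] int unfolding FM by simp
  also have "\<dots> = (\<integral>x. f x \<partial>M1) * (\<integral>y. g y \<partial>M2)"
    by simp
  also have "(\<integral>x. f x \<partial>M1) = (\<integral>z. f (fst z) \<partial>F k)"
    unfolding M1_def by (rule integral_distr[OF rv(1)]) simp
  also have "(\<integral>y. g y \<partial>M2) = (\<integral>z. g (snd z) \<partial>F k)"
    unfolding M2_def by (rule integral_distr[OF rv(2)]) simp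
  finally show ?thesis .
qed

lemma
  shows integrable_component_score: "integrable (F k) (component_score m c k)"
    and expectation_component_score:
      "(\<integral>z. component_score m c k z \<partial>F k) = c \<bullet> (second_moments (F k) *v (b k - b m))"
proof -
  let ?\<beta> = "b k - b m"
  have int: "integrable (F k) (\<lambda>z. (u \<bullet> fst z) * (v \<bullet> fst z))"
       "integrable (F k) (\<lambda>z. (u \<bullet> fst z) * snd z)"
       "integrable (F k) (\<lambda>z. fst z $ i * fst z $ l)" for u v i l
    using integrable_prod4[OF fourth_moment_inner fourth_moment_inner fourth_moment_one fourth_moment_one, of k u v]
      integrable_prod4[OF fourth_moment_inner fourth_moment_snd fourth_moment_one fourth_moment_one, of k u]
      integrable_prod4[OF fourth_moment_component fourth_moment_component fourth_moment_one fourth_moment_one, of k i l]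
    by simp_all
  have split: "component_score m c k = (\<lambda>z. (c \<bullet> fst z) * (?\<beta> \<bullet> fst z) + (c \<bullet> fst z) * snd z)"
    by (simp add: component_score_def fun_eq_iff distrib_left)
  show "integrable (F k) (component_score m c k)"
    unfolding split using int by simp
  have "(\<integral>z. (c \<bullet> fst z) * snd z \<partial>F k) = (\<integral>z. c \<bullet> fst z \<partial>F k) * (\<integral>z. snd z \<partial>F k)"
    by (rule regressor_error_product[where g = "\<lambda>e. e"]) (measurable, rule int(2))
  then have zero: "(\<integral>z. (c \<bullet> fst z) * snd z \<partial>F k) = 0"
    by (simp only: error_mean_zero mult_zero_right)
  have "(\<integral>z. component_score m c k z \<partial>F k) = (\<integral>z. (c \<bullet> fst z) * (?\<beta> \<bullet> fst z) \<partial>F k)"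
    unfolding split using int zero by simp
  also have "\<dots> = (\<integral>z. (\<Sum>i\<in>UNIV. \<Sum>l\<in>UNIV. c $ i * ?\<beta> $ l * (fst z $ i * fst z $ l)) \<partial>F k)"
    by (intro Bochner_Integration.integral_cong refl) (simp add: inner_vec_def sum_product mult_ac)
  also have "\<dots> = (\<Sum>i\<in>UNIV. \<Sum>l\<in>UNIV. c $ i * ?\<beta> $ l * second_moments (F k) $ i $ l)"
    using int(3) by (simp add: second_moments_def)
  also have "\<dots> = c \<bullet> (second_moments (F k) *v ?\<beta>)"
    by (simp add: inner_vec_def matrix_vector_mult_def sum_distrib_left mult_ac)
  finally show "(\<integral>z. component_score m c k z \<partial>F k) = c \<bullet> (second_moments (F k) *v ?\<beta>)" .
qed

lemma
  shows integrable_component_score_square: "integrable (F k) (\<lambda>z. (component_score m c k z)\<^sup>2)"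
    and expectation_component_score_square:
      "(\<integral>z. (component_score m c k z)\<^sup>2 \<partial>F k) = (\<Sum>i\<in>UNIV. \<Sum>l\<in>UNIV. c $ i * c $ l *
        (second_moments (F k) $ i $ l * error_variance (F k)
          + (b k - b m) \<bullet> (L_matrix (F k) i l *v (b k - b m))))"
proof -
  let ?\<beta> = "b k - b m"
  define g1 g2 g3 where "g1 z = (c \<bullet> fst z) * (c \<bullet> fst z) * (?\<beta> \<bullet> fst z) * (?\<beta> \<bullet> fst z)"
    and "g2 z = (c \<bullet> fst z) * (c \<bullet> fst z) * (?\<beta> \<bullet> fst z) * snd z"
    and "g3 z = (c \<bullet> fst z) * (c \<bullet> fst z) * snd z * snd z" for z :: "(real ^ 'd) \<times> real"
  have int: "integrable (F k) g1" "integrable (F k) g2" "integrable (F k) g3"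
    unfolding g1_def g2_def g3_def by (intro integrable_prod4 fourth_moments)+
  have split: "(component_score m c k z)\<^sup>2 = g1 z + 2 * g2 z + g3 z" for z
    by (simp add: component_score_def g1_def g2_def g3_def power2_eq_square algebra_simps)
  show "integrable (F k) (\<lambda>z. (component_score m c k z)\<^sup>2)"
    unfolding split using int by simp
  have "(\<integral>z. g2 z \<partial>F k) = (\<integral>z. (c \<bullet> fst z) * (c \<bullet> fst z) * (?\<beta> \<bullet> fst z) \<partial>F k) * (\<integral>z. snd z \<partial>F k)"
    unfolding g2_def
  proof (rule regressor_error_product[where g = "\<lambda>e. e"])
    show "integrable (F k) (\<lambda>z. (c \<bullet> fst z) * (c \<bullet> fst z) * (?\<beta> \<bullet> fst z) * snd z)"
      using int(2) unfolding g2_def .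
  qed measurable
  then have g2: "(\<integral>z. g2 z \<partial>F k) = 0"
    by (simp only: error_mean_zero mult_zero_right)
  have pair: "integrable (F k) (\<lambda>z. fst z $ i * fst z $ l)" for i l
    using integrable_prod4[OF fourth_moment_component fourth_moment_component fourth_moment_one fourth_moment_one, of k i l]
    by simp
  have four: "integrable (F k) (\<lambda>z. fst z $ i * fst z $ l * fst z $ q * fst z $ r)" for i l q r
    by (intro integrable_prod4 fourth_moments)
  have "(\<integral>z. g3 z \<partial>F k) = (\<integral>z. (c \<bullet> fst z) * (c \<bullet> fst z) \<partial>F k) * error_variance (F k)"
    unfolding g3_def error_variance_def mult.assoc[of _ "snd _" "snd _"] power2_eq_square[symmetric, of "snd _"]
  proof (rule regressor_error_product[where g = "\<lambda>e. e\<^sup>2"])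
    show "integrable (F k) (\<lambda>z. (c \<bullet> fst z) * (c \<bullet> fst z) * (snd z)\<^sup>2)"
      using int(3) unfolding g3_def mult.assoc[of _ "snd _" "snd _"] power2_eq_square[symmetric, of "snd _"] .
  qed measurable
  also have "(\<integral>z. (c \<bullet> fst z) * (c \<bullet> fst z) \<partial>F k)
      = (\<integral>z. (\<Sum>i\<in>UNIV. \<Sum>l\<in>UNIV. c $ i * c $ l * (fst z $ i * fst z $ l)) \<partial>F k)"
    by (intro Bochner_Integration.integral_cong refl) (simp add: inner_vec_def sum_product mult_ac)
  also have "\<dots> = (\<Sum>i\<in>UNIV. \<Sum>l\<in>UNIV. c $ i * c $ l * second_moments (F k) $ i $ l)"
    using pair by (simp add: second_moments_def)
  finally have g3: "(\<integral>z. g3 z \<partial>F k)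
      = (\<Sum>i\<in>UNIV. \<Sum>l\<in>UNIV. c $ i * c $ l * (second_moments (F k) $ i $ l * error_variance (F k)))"
    by (simp only: sum_distrib_right mult.assoc)
  have "(\<integral>z. g1 z \<partial>F k)
      = (\<integral>z. (\<Sum>i\<in>UNIV. \<Sum>l\<in>UNIV. c $ i * c $ l *
          (\<Sum>r\<in>UNIV. \<Sum>q\<in>UNIV. ?\<beta> $ r * ?\<beta> $ q * (fst z $ i * fst z $ l * fst z $ q * fst z $ r))) \<partial>F k)"
  proof (intro Bochner_Integration.integral_cong refl)
    fix z :: "(real ^ 'd) \<times> real"
    have "g1 z = (\<Sum>i\<in>UNIV. \<Sum>l\<in>UNIV. (c $ i * fst z $ i) * (c $ l * fst z $ l))
        * (\<Sum>r\<in>UNIV. \<Sum>q\<in>UNIV. (?\<beta> $ r * fst z $ r) * (?\<beta> $ q * fst z $ q))"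
      unfolding sum_product[symmetric] by (simp add: g1_def inner_vec_def mult.assoc)
    also have "\<dots> = (\<Sum>i\<in>UNIV. \<Sum>l\<in>UNIV. c $ i * c $ l *
          (\<Sum>r\<in>UNIV. \<Sum>q\<in>UNIV. ?\<beta> $ r * ?\<beta> $ q * (fst z $ i * fst z $ l * fst z $ q * fst z $ r)))"
      unfolding sum_distrib_right unfolding sum_distrib_left
      by (intro sum.cong refl) (simp only: mult_ac)
    finally show "g1 z = \<dots>" .
  qed
  also have "\<dots> = (\<Sum>i\<in>UNIV. \<Sum>l\<in>UNIV. c $ i * c $ l *
          (\<Sum>r\<in>UNIV. \<Sum>q\<in>UNIV. ?\<beta> $ r * ?\<beta> $ q * L_matrix (F k) i l $ r $ q))"
    using four by (simp add: L_matrix_def)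
  also have "\<dots> = (\<Sum>i\<in>UNIV. \<Sum>l\<in>UNIV. c $ i * c $ l * (?\<beta> \<bullet> (L_matrix (F k) i l *v ?\<beta>)))"
    by (simp add: inner_vec_def matrix_vector_mult_def sum_distrib_left mult_ac)
  finally have g1: "(\<integral>z. g1 z \<partial>F k) = (\<Sum>i\<in>UNIV. \<Sum>l\<in>UNIV. c $ i * c $ l * (?\<beta> \<bullet> (L_matrix (F k) i l *v ?\<beta>)))" .
  have "(\<integral>z. (component_score m c k z)\<^sup>2 \<partial>F k) = (\<integral>z. g1 z \<partial>F k) + (\<integral>z. g3 z \<partial>F k)"
    unfolding split using int g2 by simp
  also have "\<dots> = (\<Sum>i\<in>UNIV. \<Sum>l\<in>UNIV. c $ i * c $ l *
        (second_moments (F k) $ i $ l * error_variance (F k) + ?\<beta> \<bullet> (L_matrix (F k) i l *v ?\<beta>)))"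
    unfolding g1 g3 by (simp add: sum.distrib distrib_left)
  finally show "(\<integral>z. (component_score m c k z)\<^sup>2 \<partial>F k) = \<dots>" .
qed

text \<open>
  In direction \<open>c\<close> the matrix of interest only sees the mean and the second moment of the score within
  each component.
\<close>

lemma Sigma_quadratic_form:
  "c \<bullet> (Sigma_matrix p b F m *v c)
    = (\<Sum>s\<in>UNIV. limit_average (\<lambda>N j. (weight p m N j)\<^sup>2 * p N j s) * (\<integral>z. (component_score m c s z)\<^sup>2 \<partial>F s))
      - (\<Sum>s\<in>UNIV. \<Sum>r\<in>UNIV. limit_average (\<lambda>N j. (weight p m N j)\<^sup>2 * p N j s * p N j r)
          * ((\<integral>z. component_score m c s z \<partial>F s) * (\<integral>z. component_score m c r z \<partial>F r)))"
proof -
  define A where "A s = limit_average (\<lambda>N j. (weight p m N j)\<^sup>2 * p N j s)" for s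
  define B where "B s r = limit_average (\<lambda>N j. (weight p m N j)\<^sup>2 * p N j s * p N j r)" for s r
  define q where "q s i l = second_moments (F s) $ i $ l * error_variance (F s)
      + (b s - b m) \<bullet> (L_matrix (F s) i l *v (b s - b m))" for s i l
  define u where "u s = second_moments (F s) *v (b s - b m)" for s
  have M: "(b s - b m) \<bullet> (M_matrix (F s) (F r) i l *v (b r - b m)) = u s $ i * u r $ l" for s r i l
    by (simp add: u_def inner_M_matrix)
  have "c \<bullet> (Sigma_matrix p b F m *v c)
      = (\<Sum>i\<in>UNIV. \<Sum>l\<in>UNIV. c $ i * c $ l * Sigma_matrix p b F m $ i $ l)"
    by (simp add: inner_vec_def matrix_vector_mult_def sum_distrib_left mult_ac)
  also have "\<dots> = (\<Sum>i\<in>UNIV. \<Sum>l\<in>UNIV. \<Sum>s\<in>UNIV. A s * (c $ i * c $ l * q s i l))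
      - (\<Sum>i\<in>UNIV. \<Sum>l\<in>UNIV. \<Sum>s\<in>UNIV. \<Sum>r\<in>UNIV. B s r * ((c $ i * u s $ i) * (c $ l * u r $ l)))"
    by (simp add: Sigma_matrix_def M A_def B_def q_def sum_subtractf right_diff_distrib sum_distrib_left mult_ac)
  also have "(\<Sum>i\<in>UNIV. \<Sum>l\<in>UNIV. \<Sum>s\<in>UNIV. A s * (c $ i * c $ l * q s i l))
      = (\<Sum>i\<in>UNIV. \<Sum>s\<in>UNIV. \<Sum>l\<in>UNIV. A s * (c $ i * c $ l * q s i l))"
    by (intro sum.cong refl sum.swap)
  also have "\<dots> = (\<Sum>s\<in>UNIV. \<Sum>i\<in>UNIV. \<Sum>l\<in>UNIV. A s * (c $ i * c $ l * q s i l))"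
    by (rule sum.swap)
  also have "\<dots> = (\<Sum>s\<in>UNIV. A s * (\<integral>z. (component_score m c s z)\<^sup>2 \<partial>F s))"
    by (simp only: expectation_component_score_square q_def sum_distrib_left)
  also have "(\<Sum>i\<in>UNIV. \<Sum>l\<in>UNIV. \<Sum>s\<in>UNIV. \<Sum>r\<in>UNIV. B s r * ((c $ i * u s $ i) * (c $ l * u r $ l)))
      = (\<Sum>i\<in>UNIV. \<Sum>s\<in>UNIV. \<Sum>l\<in>UNIV. \<Sum>r\<in>UNIV. B s r * ((c $ i * u s $ i) * (c $ l * u r $ l)))"
    by (intro sum.cong refl sum.swap)
  also have "\<dots> = (\<Sum>s\<in>UNIV. \<Sum>i\<in>UNIV. \<Sum>r\<in>UNIV. \<Sum>l\<in>UNIV. B s r * ((c $ i * u s $ i) * (c $ l * u r $ l)))"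
    by (subst sum.swap) (intro sum.cong refl sum.swap)
  also have "\<dots> = (\<Sum>s\<in>UNIV. \<Sum>r\<in>UNIV. \<Sum>i\<in>UNIV. \<Sum>l\<in>UNIV. B s r * ((c $ i * u s $ i) * (c $ l * u r $ l)))"
    by (intro sum.cong refl sum.swap)
  also have "\<dots> = (\<Sum>s\<in>UNIV. \<Sum>r\<in>UNIV. B s r * ((c \<bullet> u s) * (c \<bullet> u r)))"
    unfolding inner_vec_def inner_real_def sum_product by (simp only: sum_distrib_left)
  also have "\<dots> = (\<Sum>s\<in>UNIV. \<Sum>r\<in>UNIV. B s r
      * ((\<integral>z. component_score m c s z \<partial>F s) * (\<integral>z. component_score m c r z \<partial>F r)))"
    by (simp only: expectation_component_score u_def)
  finally show ?thesis
    unfolding A_def B_def .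
qed

end

section \<open>Asymptotic normality of the weighted score\<close>

locale mvc_ls_setting = mixture_regression_moments P \<kappa> X \<epsilon> Y p b F
  for P :: "nat \<Rightarrow> 'w measure" and \<kappa> :: "nat \<Rightarrow> nat \<Rightarrow> 'w \<Rightarrow> 'k::finite"
    and X :: "nat \<Rightarrow> nat \<Rightarrow> 'w \<Rightarrow> real ^ 'd" and \<epsilon> :: "nat \<Rightarrow> nat \<Rightarrow> 'w \<Rightarrow> real"
    and Y :: "nat \<Rightarrow> nat \<Rightarrow> 'w \<Rightarrow> real" and p :: "nat \<Rightarrow> nat \<Rightarrow> 'k \<Rightarrow> real"
    and b :: "'k \<Rightarrow> real ^ 'd" and F :: "'k \<Rightarrow> ((real ^ 'd) \<times> real) measure" +
  fixes m :: 'k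
  assumes nonsingular: "invertible (second_moments (F m))"
    and concentrations: "\<exists>C>0. \<forall>\<^sub>F N in sequentially. det (Gamma_matrix p N) > C"
    and limits: "\<And>s r. convergent (average (\<lambda>N j. (weight p m N j)\<^sup>2 * p N j s * p N j r))"
begin

abbreviation a :: "nat \<Rightarrow> nat \<Rightarrow> real" where "a \<equiv> weight p m"

lemma eventually_regular:
  "\<forall>\<^sub>F N in sequentially. N \<ge> 1 \<and> invertible (Gamma_matrix p N)"
proof -
  obtain C where "C > 0" "\<forall>\<^sub>F N in sequentially. det (Gamma_matrix p N) > C"
    using concentrations by blast
  from this(2) eventually_ge_at_top[of 1] show ?thesis
    by eventually_elim (use \<open>C > 0\<close> in \<open>auto simp: invertible_det_nz\<close>)
qed

lemma average_pair_tendsto: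
  "average (\<lambda>N j. (a N j)\<^sup>2 * p N j s * p N j r) \<longlonglongrightarrow> limit_average (\<lambda>N j. (a N j)\<^sup>2 * p N j s * p N j r)"
  using limits by (simp add: limit_average_def convergent_LIMSEQ_iff)

lemma average_single_tendsto:
  "average (\<lambda>N j. (a N j)\<^sup>2 * p N j s) \<longlonglongrightarrow> limit_average (\<lambda>N j. (a N j)\<^sup>2 * p N j s)"
proof -
  have "average (\<lambda>N j. (a N j)\<^sup>2 * p N j s) N = (\<Sum>r\<in>UNIV. average (\<lambda>N j. (a N j)\<^sup>2 * p N j s * p N j r) N)" for N
  proof -
    have "(\<Sum>j=1..N. (a N j)\<^sup>2 * p N j s) = (\<Sum>j=1..N. \<Sum>r\<in>UNIV. (a N j)\<^sup>2 * p N j s * p N j r)"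
      by (intro sum.cong refl) (simp add: concentration_bounds(3) flip: sum_distrib_left)
    also have "\<dots> = (\<Sum>r\<in>UNIV. \<Sum>j=1..N. (a N j)\<^sup>2 * p N j s * p N j r)"
      by (rule sum.swap)
    finally show ?thesis by (simp add: average_def sum_divide_distrib)
  qed
  then have "average (\<lambda>N j. (a N j)\<^sup>2 * p N j s) = (\<lambda>N. \<Sum>r\<in>UNIV. average (\<lambda>N j. (a N j)\<^sup>2 * p N j s * p N j r) N)"
    by blast
  then have "convergent (average (\<lambda>N j. (a N j)\<^sup>2 * p N j s))"
    using limits by (simp add: convergent_sum)
  then show ?thesis by (simp add: limit_average_def convergent_LIMSEQ_iff)
qed

definition score :: "nat \<Rightarrow> nat \<Rightarrow> 'w \<Rightarrow> real ^ 'd" where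
  "score N j \<omega> = (Y N j \<omega> - b m \<bullet> X N j \<omega>) *\<^sub>R X N j \<omega>"

definition score_sum :: "nat \<Rightarrow> 'w \<Rightarrow> real ^ 'd" where
  "score_sum N \<omega> = (1 / sqrt (real N)) *\<^sub>R (\<Sum>j=1..N. a N j *\<^sub>R score N j \<omega>)"

definition score_mean :: "real ^ 'd \<Rightarrow> 'k \<Rightarrow> real" where
  "score_mean c k = (\<integral>z. component_score m c k z \<partial>F k)"

definition score_second_moment :: "real ^ 'd \<Rightarrow> 'k \<Rightarrow> real" where
  "score_second_moment c k = (\<integral>z. (component_score m c k z)\<^sup>2 \<partial>F k)"

text \<open>
  Each term is centred at its own mean, which differs between subjects.  By the choice of the weights
  these means cancel in the sum.
\<close>

definition score_term :: "real ^ 'd \<Rightarrow> nat \<Rightarrow> nat \<Rightarrow> 'w \<Rightarrow> real" where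
  "score_term c N j \<omega> = a N j / sqrt (real N) * (c \<bullet> score N j \<omega> - (\<Sum>k\<in>UNIV. p N j k * score_mean c k))"

lemma score_mean_self: "score_mean c m = 0"
  by (simp add: score_mean_def expectation_component_score)

lemma inner_score: "j \<in> {1..N} \<Longrightarrow> \<omega> \<in> space (P N) \<Longrightarrow>
    c \<bullet> score N j \<omega> = component_score m c (\<kappa> N j \<omega>) (X N j \<omega>, \<epsilon> N j \<omega>)"
  unfolding score_def by (rule score_eq_component_score)

lemma measurable_score:
  assumes "j \<in> {1..N}"
  shows "score N j \<in> borel_measurable (P N)"
  unfolding score_def using measurable_response[OF assms] by measurable

lemma measurable_score_sum: "score_sum N \<in> borel_measurable (P N)"
  unfolding score_sum_def
  by (intro borel_measurable_scaleR borel_measurable_sum measurable_score borel_measurable_const) auto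

lemma
  assumes j: "j \<in> {1..N}"
  shows expectation_score: "has_bochner_integral (P N) (\<lambda>\<omega>. c \<bullet> score N j \<omega>) (\<Sum>k\<in>UNIV. p N j k * score_mean c k)"
    and expectation_score_square:
      "has_bochner_integral (P N) (\<lambda>\<omega>. (c \<bullet> score N j \<omega>)\<^sup>2) (\<Sum>k\<in>UNIV. p N j k * score_second_moment c k)"
proof -
  show "has_bochner_integral (P N) (\<lambda>\<omega>. c \<bullet> score N j \<omega>) (\<Sum>k\<in>UNIV. p N j k * score_mean c k)"
    using expectation_by_component[OF j, of "component_score m c", OF integrable_component_score]
    unfolding score_mean_def
    by (rule has_bochner_integral_cong[THEN iffD1, rotated -1]) (simp_all add: inner_score[OF j])
  show "has_bochner_integral (P N) (\<lambda>\<omega>. (c \<bullet> score N j \<omega>)\<^sup>2) (\<Sum>k\<in>UNIV. p N j k * score_second_moment c k)"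
    using expectation_by_component[OF j, of "\<lambda>k z. (component_score m c k z)\<^sup>2", OF integrable_component_score_square]
    unfolding score_second_moment_def
    by (rule has_bochner_integral_cong[THEN iffD1, rotated -1]) (simp_all add: inner_score[OF j])
qed

lemma
  assumes j: "j \<in> {1..N}"
  shows measurable_score_term: "score_term c N j \<in> borel_measurable (P N)"
    and integrable_score_term_square: "integrable (P N) (\<lambda>\<omega>. (score_term c N j \<omega>)\<^sup>2)"
    and expectation_score_term: "(\<integral>\<omega>. score_term c N j \<omega> \<partial>P N) = 0"
    and expectation_score_term_square: "(\<integral>\<omega>. (score_term c N j \<omega>)\<^sup>2 \<partial>P N) = (a N j)\<^sup>2 / real N *
      ((\<Sum>k\<in>UNIV. p N j k * score_second_moment c k) - (\<Sum>k\<in>UNIV. p N j k * score_mean c k)\<^sup>2)"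
proof -
  have N: "N \<ge> 1" using j by simp
  interpret prob_space "P N" using prob_space_P N .
  define s where "s = (\<Sum>k\<in>UNIV. p N j k * score_mean c k)"
  note [measurable] = measurable_score[OF j]
  show "score_term c N j \<in> borel_measurable (P N)"
    unfolding score_term_def by measurable
  have 1: "integrable (P N) (\<lambda>\<omega>. c \<bullet> score N j \<omega>)" "expectation (\<lambda>\<omega>. c \<bullet> score N j \<omega>) = s"
    using expectation_score[OF j, of c] by (auto simp: has_bochner_integral_iff s_def)
  have 2: "integrable (P N) (\<lambda>\<omega>. (c \<bullet> score N j \<omega>)\<^sup>2)"
      "expectation (\<lambda>\<omega>. (c \<bullet> score N j \<omega>)\<^sup>2) = (\<Sum>k\<in>UNIV. p N j k * score_second_moment c k)"
    using expectation_score_square[OF j, of c] by (auto simp: has_bochner_integral_iff)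
  show "(\<integral>\<omega>. score_term c N j \<omega> \<partial>P N) = 0"
    unfolding score_term_def s_def[symmetric] using 1 prob_space by simp
  have sq: "(score_term c N j \<omega>)\<^sup>2 = (a N j)\<^sup>2 / real N * ((c \<bullet> score N j \<omega>)\<^sup>2 - 2 * s * (c \<bullet> score N j \<omega>) + s\<^sup>2)" for \<omega>
    unfolding score_term_def s_def[symmetric] by (simp add: power_mult_distrib power_divide power2_diff)
  show "integrable (P N) (\<lambda>\<omega>. (score_term c N j \<omega>)\<^sup>2)"
    unfolding sq using 1 2 by simp
  have "expectation (\<lambda>\<omega>. (c \<bullet> score N j \<omega>)\<^sup>2 - 2 * s * (c \<bullet> score N j \<omega>) + s\<^sup>2)
      = (\<Sum>k\<in>UNIV. p N j k * score_second_moment c k) - 2 * s * s + s\<^sup>2"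
    using 1 2 prob_space by simp
  then show "(\<integral>\<omega>. (score_term c N j \<omega>)\<^sup>2 \<partial>P N) = (a N j)\<^sup>2 / real N *
      ((\<Sum>k\<in>UNIV. p N j k * score_second_moment c k) - (\<Sum>k\<in>UNIV. p N j k * score_mean c k)\<^sup>2)"
    unfolding sq s_def[symmetric] by (simp add: power2_eq_square)
qed

lemma indep_vars_score_term:
  assumes "N \<ge> 1"
  shows "prob_space.indep_vars (P N) (\<lambda>_. borel) (score_term c N) {1..N}"
proof -
  interpret prob_space "P N" using prob_space_P assms .
  have "indep_vars (\<lambda>_. borel)
      (\<lambda>j \<omega>. (\<lambda>q. a N j / sqrt (real N) * (c \<bullet> ((fst (snd q) - b m \<bullet> snd (snd q)) *\<^sub>R snd (snd q))
          - (\<Sum>k\<in>UNIV. p N j k * score_mean c k))) (\<kappa> N j \<omega>, Y N j \<omega>, X N j \<omega>)) {1..N}"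
  proof (rule indep_vars_compose2[OF independent_subjects[OF assms]])
    fix j
    have "(\<lambda>q. fst (snd q)) \<in> measurable (count_space (UNIV :: 'k set) \<Otimes>\<^sub>M (borel :: (real \<times> (real ^ 'd)) measure)) borel"
         "(\<lambda>q. snd (snd q)) \<in> measurable (count_space (UNIV :: 'k set) \<Otimes>\<^sub>M (borel :: (real \<times> (real ^ 'd)) measure)) borel"
      unfolding borel_prod[symmetric] by measurable
    note [measurable] = this
    show "(\<lambda>q. a N j / sqrt (real N) * (c \<bullet> ((fst (snd q) - b m \<bullet> snd (snd q)) *\<^sub>R snd (snd q))
          - (\<Sum>k\<in>UNIV. p N j k * score_mean c k))) \<in> measurable (count_space (UNIV :: 'k set) \<Otimes>\<^sub>M borel) borel"
      by measurable
  qed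
  then show ?thesis by (simp add: score_term_def[abs_def] score_def)
qed

lemma inner_score_sum:
  assumes "N \<ge> 1" "invertible (Gamma_matrix p N)"
  shows "c \<bullet> score_sum N \<omega> = (\<Sum>j=1..N. score_term c N j \<omega>)"
proof -
  have "(\<Sum>j=1..N. a N j * (\<Sum>k\<in>UNIV. p N j k * score_mean c k)) = (\<Sum>k\<in>UNIV. (\<Sum>j=1..N. a N j * p N j k) * score_mean c k)"
    unfolding sum_distrib_left sum_distrib_right by (subst sum.swap) (simp add: mult_ac)
  also have "\<dots> = 0"
    unfolding sum_weight_concentration[OF assms(2,1)] by (intro sum.neutral) (simp add: score_mean_self)
  finally have "(\<Sum>j=1..N. a N j * (c \<bullet> score N j \<omega>))
      = (\<Sum>j=1..N. a N j * (c \<bullet> score N j \<omega> - (\<Sum>k\<in>UNIV. p N j k * score_mean c k)))"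
    by (simp add: right_diff_distrib sum_subtractf)
  then show ?thesis
    by (simp add: score_sum_def score_term_def inner_sum_right sum_divide_distrib)
qed

text \<open>
  Means and second moments within the components are constants, so the sum is a linear combination of
  those averages of weights and concentrations whose limits enter the matrix.
\<close>

lemma score_variance_tendsto:
  "(\<lambda>N. \<Sum>j=1..N. \<integral>\<omega>. (score_term c N j \<omega>)\<^sup>2 \<partial>P N) \<longlonglongrightarrow> c \<bullet> (Sigma_matrix p b F m *v c)"
proof -
  have "(\<Sum>j=1..N. \<integral>\<omega>. (score_term c N j \<omega>)\<^sup>2 \<partial>P N)
      = (\<Sum>s\<in>UNIV. average (\<lambda>N j. (a N j)\<^sup>2 * p N j s) N * score_second_moment c s)
        - (\<Sum>s\<in>UNIV. \<Sum>r\<in>UNIV. average (\<lambda>N j. (a N j)\<^sup>2 * p N j s * p N j r) N * (score_mean c s * score_mean c r))" for N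
  proof -
    have "(\<Sum>j=1..N. \<integral>\<omega>. (score_term c N j \<omega>)\<^sup>2 \<partial>P N) = (\<Sum>j=1..N. (a N j)\<^sup>2 / real N *
      ((\<Sum>k\<in>UNIV. p N j k * score_second_moment c k) - (\<Sum>k\<in>UNIV. p N j k * score_mean c k)\<^sup>2))"
      by (intro sum.cong refl expectation_score_term_square)
    also have "\<dots> = (\<Sum>j=1..N. \<Sum>s\<in>UNIV. (a N j)\<^sup>2 * p N j s / real N * score_second_moment c s)
        - (\<Sum>j=1..N. \<Sum>s\<in>UNIV. \<Sum>r\<in>UNIV. (a N j)\<^sup>2 * p N j s * p N j r / real N * (score_mean c s * score_mean c r))"
      unfolding power2_eq_square[of "sum _ _"] sum_product
      by (simp add: right_diff_distrib sum_subtractf sum_distrib_left mult_ac)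
    also have "(\<Sum>j=1..N. \<Sum>s\<in>UNIV. (a N j)\<^sup>2 * p N j s / real N * score_second_moment c s)
        = (\<Sum>s\<in>UNIV. average (\<lambda>N j. (a N j)\<^sup>2 * p N j s) N * score_second_moment c s)"
      by (subst sum.swap) (simp only: average_def sum_divide_distrib sum_distrib_right)
    also have "(\<Sum>j=1..N. \<Sum>s\<in>UNIV. \<Sum>r\<in>UNIV. (a N j)\<^sup>2 * p N j s * p N j r / real N * (score_mean c s * score_mean c r))
        = (\<Sum>s\<in>UNIV. \<Sum>j=1..N. \<Sum>r\<in>UNIV. (a N j)\<^sup>2 * p N j s * p N j r / real N * (score_mean c s * score_mean c r))"
      by (rule sum.swap)
    also have "\<dots> = (\<Sum>s\<in>UNIV. \<Sum>r\<in>UNIV. \<Sum>j=1..N. (a N j)\<^sup>2 * p N j s * p N j r / real N * (score_mean c s * score_mean c r))"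
      by (intro sum.cong refl sum.swap)
    also have "\<dots> = (\<Sum>s\<in>UNIV. \<Sum>r\<in>UNIV. average (\<lambda>N j. (a N j)\<^sup>2 * p N j s * p N j r) N * (score_mean c s * score_mean c r))"
      by (simp only: average_def sum_divide_distrib sum_distrib_right)
    finally show ?thesis .
  qed
  moreover have "(\<lambda>N. (\<Sum>s\<in>UNIV. average (\<lambda>N j. (a N j)\<^sup>2 * p N j s) N * score_second_moment c s)
        - (\<Sum>s\<in>UNIV. \<Sum>r\<in>UNIV. average (\<lambda>N j. (a N j)\<^sup>2 * p N j s * p N j r) N * (score_mean c s * score_mean c r)))
      \<longlonglongrightarrow> c \<bullet> (Sigma_matrix p b F m *v c)"
    unfolding Sigma_quadratic_form score_mean_def[symmetric] score_second_moment_def[symmetric]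
    by (intro tendsto_intros average_single_tendsto average_pair_tendsto)
  ultimately show ?thesis by simp
qed

text \<open>
  With bounded weights and means, a term of the array is at most \<open>K N\<^sup>-\<^sup>1\<^sup>/\<^sup>2\<close> times a function \<open>w\<close> of
  the subject, whatever its number.  Hence the truncated second moments are controlled by integrals of
  \<open>w\<^sup>2\<close> over \<open>{w > e \<surd>N / K}\<close> under the finitely many component laws, which tend to zero by dominated
  convergence.
\<close>

lemma score_lindeberg_condition:
  assumes "e > 0"
  shows "(\<lambda>N. \<Sum>j=1..N. \<integral>\<omega>. (score_term c N j \<omega>)\<^sup>2 * indicator {x. \<bar>x\<bar> > e} (score_term c N j \<omega>) \<partial>P N) \<longlonglongrightarrow> 0"
proof -
  obtain K where K: "K > 0" "\<forall>\<^sub>F N in sequentially. \<forall>j\<in>{1..N}. \<bar>a N j\<bar> \<le> K"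
    using weights_bounded[OF concentrations] by blast
  define B where "B = (\<Sum>k\<in>UNIV. \<bar>score_mean c k\<bar>)"
  define w where "w k z = \<bar>component_score m c k z\<bar> + B" for k z
  define h where "h N k z = (w k z)\<^sup>2 * indicator {t. e * sqrt (real N) / K < t} (w k z)" for N :: nat and k z
  have B0: "B \<ge> 0" by (simp add: B_def sum_nonneg)
  have w0: "w k z \<ge> 0" for k z using B0 by (simp add: w_def)
  have w_meas[measurable]: "w k \<in> borel_measurable (F k)" for k
    using borel_measurable_integrable[OF integrable_component_score] unfolding w_def by measurable
  have w_int: "integrable (F k) (\<lambda>z. (w k z)\<^sup>2)" for k
  proof -
    interpret prob_space "F k" by (rule prob_space_F)
    have "(w k z)\<^sup>2 = (component_score m c k z)\<^sup>2 + 2 * B * \<bar>component_score m c k z\<bar> + B\<^sup>2" for z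
      by (simp add: w_def power2_sum)
    then show ?thesis
      using integrable_component_score_square[of k m c] integrable_component_score[of k m c] by simp
  qed
  have h_le: "\<bar>h N k z\<bar> \<le> (w k z)\<^sup>2" "0 \<le> h N k z" for N k z
    by (auto simp: h_def indicator_def)
  have h_meas[measurable]: "h N k \<in> borel_measurable (F k)" for N k
    unfolding h_def by measurable
  have h_int: "integrable (F k) (h N k)" for N k
    by (rule Bochner_Integration.integrable_bound[OF w_int[of k]]) (use h_le in auto)
  have h_lim: "(\<lambda>N. \<integral>z. h N k z \<partial>F k) \<longlonglongrightarrow> 0" for k
  proof -
    have "(\<lambda>N. \<integral>z. h N k z \<partial>F k) \<longlonglongrightarrow> (\<integral>z. 0 \<partial>F k)"
    proof (rule integral_dominated_convergence[where w = "\<lambda>z. (w k z)\<^sup>2"])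
      show "AE z in F k. (\<lambda>N. h N k z) \<longlonglongrightarrow> 0"
      proof (rule AE_I2)
        fix z
        have "filterlim (\<lambda>N. e / K * sqrt (real N)) at_top sequentially"
          using assms K(1) by (intro filterlim_tendsto_pos_mult_at_top[OF tendsto_const]
              filterlim_compose[OF sqrt_at_top filterlim_real_sequentially]) auto
        then have "\<forall>\<^sub>F N in sequentially. w k z \<le> e / K * sqrt (real N)"
          by (simp add: filterlim_at_top)
        then have "\<forall>\<^sub>F N in sequentially. h N k z = 0"
          by eventually_elim (simp add: h_def)
        then show "(\<lambda>N. h N k z) \<longlonglongrightarrow> 0" by (rule tendsto_eventually)
      qed
    qed (use w_int h_le(1) in auto)
    then show ?thesis by simp
  qed
  have lim: "(\<lambda>N. K\<^sup>2 * (\<Sum>k\<in>UNIV. \<integral>z. h N k z \<partial>F k)) \<longlonglongrightarrow> 0"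
    by (intro tendsto_mult_right_zero tendsto_null_sum h_lim)
  show ?thesis
  proof (rule tendsto_sandwich[OF _ _ tendsto_const lim])
    show "\<forall>\<^sub>F N in sequentially. 0 \<le> (\<Sum>j=1..N. \<integral>\<omega>. (score_term c N j \<omega>)\<^sup>2 * indicator {x. \<bar>x\<bar> > e} (score_term c N j \<omega>) \<partial>P N)"
      by (auto intro!: always_eventually sum_nonneg)
    show "\<forall>\<^sub>F N in sequentially. (\<Sum>j=1..N. \<integral>\<omega>. (score_term c N j \<omega>)\<^sup>2 * indicator {x. \<bar>x\<bar> > e} (score_term c N j \<omega>) \<partial>P N)
        \<le> K\<^sup>2 * (\<Sum>k\<in>UNIV. \<integral>z. h N k z \<partial>F k)"
      using K(2) eventually_ge_at_top[of 1]
    proof eventually_elim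
      case (elim N)
      define H where "H = (\<Sum>k\<in>UNIV. \<integral>z. h N k z \<partial>F k)"
      have each: "(\<integral>\<omega>. (score_term c N j \<omega>)\<^sup>2 * indicator {x. \<bar>x\<bar> > e} (score_term c N j \<omega>) \<partial>P N) \<le> K\<^sup>2 / real N * H"
        if j: "j \<in> {1..N}" for j
      proof -
        interpret prob_space "P N" using prob_space_P elim(2) .
        define q where "q \<omega> = h N (\<kappa> N j \<omega>) (X N j \<omega>, \<epsilon> N j \<omega>)" for \<omega>
        have q: "integrable (P N) q" "expectation q = (\<Sum>k\<in>UNIV. p N j k * (\<integral>z. h N k z \<partial>F k))"
          using expectation_by_component[OF j, of "h N", OF h_int] unfolding has_bochner_integral_iff q_def by auto
        have "(\<Sum>k\<in>UNIV. p N j k * (\<integral>z. h N k z \<partial>F k)) \<le> (\<Sum>k\<in>UNIV. 1 * (\<integral>z. h N k z \<partial>F k))"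
          using concentration_bounds[OF j] h_le(2) by (intro sum_mono mult_right_mono) auto
        then have qH: "expectation q \<le> H" using q(2) by (simp add: H_def)
        have mean: "\<bar>\<Sum>k\<in>UNIV. p N j k * score_mean c k\<bar> \<le> B"
          unfolding B_def
          by (rule order_trans[OF sum_abs])
            (use concentration_bounds[OF j] in \<open>auto intro!: sum_mono mult_left_le_one_le simp: abs_mult\<close>)
        have pointwise: "(score_term c N j \<omega>)\<^sup>2 * indicator {x. \<bar>x\<bar> > e} (score_term c N j \<omega>) \<le> K\<^sup>2 / real N * q \<omega>"
          if \<omega>: "\<omega> \<in> space (P N)" for \<omega>
        proof -
          let ?w = "w (\<kappa> N j \<omega>) (X N j \<omega>, \<epsilon> N j \<omega>)"
          have "\<bar>score_term c N j \<omega>\<bar> = \<bar>a N j\<bar> / sqrt (real N) * \<bar>c \<bullet> score N j \<omega> - (\<Sum>k\<in>UNIV. p N j k * score_mean c k)\<bar>"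
            by (simp add: score_term_def abs_mult)
          also have "\<dots> \<le> K / sqrt (real N) * ?w"
            using elim(1) j mean K(1) unfolding w_def inner_score[OF j \<omega>]
            by (intro mult_mono divide_right_mono order_trans[OF abs_triangle_ineq4] add_left_mono) auto
          finally have term_le: "\<bar>score_term c N j \<omega>\<bar> \<le> K / sqrt (real N) * ?w" .
          show ?thesis
          proof (cases "\<bar>score_term c N j \<omega>\<bar> > e")
            case True
            then have "e < K / sqrt (real N) * ?w" using term_le by linarith
            then have "e * sqrt (real N) / K < ?w"
              using K(1) elim(2) by (simp add: field_simps)
            then have "q \<omega> = ?w\<^sup>2" by (simp add: q_def h_def)
            moreover have "(score_term c N j \<omega>)\<^sup>2 \<le> (K / sqrt (real N) * ?w)\<^sup>2"
              using term_le K(1) w0 by (simp add: abs_le_square_iff[symmetric])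
            ultimately show ?thesis
              using True by (simp add: power_mult_distrib power_divide)
          next
            case False
            then show ?thesis using h_le(2) by (simp add: q_def)
          qed
        qed
        have "integrable (P N) (\<lambda>\<omega>. (score_term c N j \<omega>)\<^sup>2 * indicator {x. \<bar>x\<bar> > e} (score_term c N j \<omega>))"
          using measurable_score_term[OF j, of c]
          by (intro Bochner_Integration.integrable_bound[OF integrable_score_term_square[OF j, of c]])
            (auto simp: indicator_def)
        then have "(\<integral>\<omega>. (score_term c N j \<omega>)\<^sup>2 * indicator {x. \<bar>x\<bar> > e} (score_term c N j \<omega>) \<partial>P N) \<le> expectation (\<lambda>\<omega>. K\<^sup>2 / real N * q \<omega>)"
          using q(1) by (intro integral_mono pointwise) auto
        also have "\<dots> \<le> K\<^sup>2 / real N * H"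
          using qH by (simp add: mult_left_mono divide_right_mono)
        finally show ?thesis .
      qed
      have "(\<Sum>j=1..N. \<integral>\<omega>. (score_term c N j \<omega>)\<^sup>2 * indicator {x. \<bar>x\<bar> > e} (score_term c N j \<omega>) \<partial>P N) \<le> (\<Sum>j=1..N. K\<^sup>2 / real N * H)"
        by (intro sum_mono each)
      then show ?case using elim(2) by (simp add: H_def)
    qed
  qed
qed

theorem score_sum_char_tendsto:
  "(\<lambda>N. \<integral>\<omega>. iexp (c \<bullet> score_sum N \<omega>) \<partial>P N) \<longlonglongrightarrow> exp (- (c \<bullet> (Sigma_matrix p b F m *v c)) / 2)"
proof -
  have "(\<lambda>N. \<integral>\<omega>. iexp (\<Sum>j\<in>{1..N}. score_term c N j \<omega>) \<partial>P N) \<longlonglongrightarrow> exp (- (c \<bullet> (Sigma_matrix p b F m *v c)) / 2)"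
  proof (rule lindeberg_char_tendsto[OF _ score_variance_tendsto score_lindeberg_condition])
    show "\<forall>\<^sub>F N in sequentially. prob_space (P N) \<and> finite {1..N} \<and>
        prob_space.indep_vars (P N) (\<lambda>_. borel) (score_term c N) {1..N} \<and>
        (\<forall>j\<in>{1..N}. integrable (P N) (\<lambda>\<omega>. (score_term c N j \<omega>)\<^sup>2) \<and> (\<integral>\<omega>. score_term c N j \<omega> \<partial>P N) = 0)"
      using eventually_ge_at_top[of 1]
    proof eventually_elim
      case (elim N)
      then show ?case
        using prob_space_P indep_vars_score_term integrable_score_term_square expectation_score_term by blast
    qed
  qed
  then show ?thesis
    by (rule Lim_transform_eventually)
      (use eventually_regular in eventually_elim, simp add: inner_score_sum)
qed

lemma score_sum_second_moment_tendsto: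
  "(\<lambda>N. \<integral>\<omega>. (c \<bullet> score_sum N \<omega>)\<^sup>2 \<partial>P N) \<longlonglongrightarrow> c \<bullet> (Sigma_matrix p b F m *v c)"
  and score_sum_square_integrable:
    "\<forall>\<^sub>F N in sequentially. integrable (P N) (\<lambda>\<omega>. (c \<bullet> score_sum N \<omega>)\<^sup>2)"
proof -
  have ev: "\<forall>\<^sub>F N in sequentially. integrable (P N) (\<lambda>\<omega>. (c \<bullet> score_sum N \<omega>)\<^sup>2) \<and>
      (\<Sum>j=1..N. \<integral>\<omega>. (score_term c N j \<omega>)\<^sup>2 \<partial>P N) = (\<integral>\<omega>. (c \<bullet> score_sum N \<omega>)\<^sup>2 \<partial>P N)"
    using eventually_regular
  proof eventually_elim
    case (elim N)
    interpret prob_space "P N" using prob_space_P elim by simp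
    note facts = indep_vars_score_term[of N c] integrable_score_term_square expectation_score_term
    show ?case
      using integrable_square_sum_indep[of "{1..N}" "score_term c N"] expectation_square_sum_indep[of "{1..N}" "score_term c N"]
        facts elim by (simp add: inner_score_sum)
  qed
  then show "\<forall>\<^sub>F N in sequentially. integrable (P N) (\<lambda>\<omega>. (c \<bullet> score_sum N \<omega>)\<^sup>2)"
    by eventually_elim simp
  show "(\<lambda>N. \<integral>\<omega>. (c \<bullet> score_sum N \<omega>)\<^sup>2 \<partial>P N) \<longlonglongrightarrow> c \<bullet> (Sigma_matrix p b F m *v c)"
    by (rule Lim_transform_eventually[OF score_variance_tendsto]) (use ev in eventually_elim, simp)
qed

end

section \<open>The weighted Gram matrix and the estimator\<close>

lemma transpose_second_moments: "transpose (second_moments Q) = second_moments Q"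
  by (simp add: second_moments_def transpose_def vec_eq_iff mult.commute)

lemma transpose_Sigma_matrix: "transpose (Sigma_matrix p b F m) = Sigma_matrix p b F m"
proof -
  define A where "A s = limit_average (\<lambda>N j. (weight p m N j)\<^sup>2 * p N j s)" for s
  define B where "B s r = limit_average (\<lambda>N j. (weight p m N j)\<^sup>2 * p N j s * p N j r)" for s r
  define u where "u s = second_moments (F s) *v (b s - b m)" for s
  have M: "(b s - b m) \<bullet> (M_matrix (F s) (F r) i l *v (b r - b m)) = u s $ i * u r $ l" for s r i l
    by (simp add: u_def inner_M_matrix)
  have L: "L_matrix (F s) l i = L_matrix (F s) i l" for s i l
    by (simp add: L_matrix_def mult.commute mult.left_commute)
  have D: "second_moments (F s) $ l $ i = second_moments (F s) $ i $ l" for s i l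
    by (simp add: second_moments_def mult.commute)
  have B: "B s r = B r s" for s r
    by (simp add: B_def mult_ac)
  have "(\<Sum>s\<in>UNIV. \<Sum>r\<in>UNIV. B s r * (u s $ l * u r $ i)) = (\<Sum>s\<in>UNIV. \<Sum>r\<in>UNIV. B s r * (u s $ i * u r $ l))" for i l
  proof -
    have "(\<Sum>s\<in>UNIV. \<Sum>r\<in>UNIV. B s r * (u s $ l * u r $ i)) = (\<Sum>r\<in>UNIV. \<Sum>s\<in>UNIV. B s r * (u s $ l * u r $ i))"
      by (rule sum.swap)
    also have "\<dots> = (\<Sum>s\<in>UNIV. \<Sum>r\<in>UNIV. B s r * (u s $ i * u r $ l))"
      by (intro sum.cong refl) (metis B mult.commute)
    finally show ?thesis .
  qed
  then show ?thesis
    by (simp add: vec_eq_iff transpose_def Sigma_matrix_def M flip: A_def B_def) (simp add: L D)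
qed

context mvc_ls_setting
begin

definition gram :: "nat \<Rightarrow> 'w \<Rightarrow> real ^ 'd ^ 'd" where
  "gram N \<omega> = weighted_gram N (a N) (\<lambda>j. X N j \<omega>)"

text \<open>
  Each entry is unbiased by the choice of the weights, and its variance is a sum of \<open>N\<close> terms of order
  \<open>N\<^sup>-\<^sup>2\<close>.
\<close>

lemma gram_mean_square_tendsto:
  "(\<lambda>N. \<integral>\<omega>. (gram N \<omega> $ i $ l / real N - second_moments (F m) $ i $ l)\<^sup>2 \<partial>P N) \<longlonglongrightarrow> 0"
  and gram_square_integrable: "\<forall>\<^sub>F N in sequentially.
    integrable (P N) (\<lambda>\<omega>. (gram N \<omega> $ i $ l / real N - second_moments (F m) $ i $ l)\<^sup>2)"
proof -
  obtain K where K: "K > 0" "\<forall>\<^sub>F N in sequentially. \<forall>j\<in>{1..N}. \<bar>a N j\<bar> \<le> K"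
    using weights_bounded[OF concentrations] by blast
  define g where "g z = fst z $ i * fst z $ l" for z :: "(real ^ 'd) \<times> real"
  define C where "C = (\<Sum>k\<in>UNIV. \<integral>z. (g z)\<^sup>2 \<partial>F k)"
  have g_int: "integrable (F k) g" "integrable (F k) (\<lambda>z. (g z)\<^sup>2)" for k
    using integrable_prod4[OF fourth_moment_component fourth_moment_component fourth_moment_one fourth_moment_one, of k i l]
      integrable_prod4[OF fourth_moment_component fourth_moment_component fourth_moment_component fourth_moment_component, of k i i l l]
    by (simp_all add: g_def[abs_def] power2_eq_square mult_ac)
  have gD: "(\<integral>z. g z \<partial>F k) = second_moments (F k) $ i $ l" for k
    by (simp add: second_moments_def g_def)
  have main: "\<forall>\<^sub>F N in sequentially.
      integrable (P N) (\<lambda>\<omega>. (gram N \<omega> $ i $ l / real N - second_moments (F m) $ i $ l)\<^sup>2) \<and>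
      (\<integral>\<omega>. (gram N \<omega> $ i $ l / real N - second_moments (F m) $ i $ l)\<^sup>2 \<partial>P N) \<le> K\<^sup>2 * C / real N"
    using eventually_regular K(2)
  proof eventually_elim
    case (elim N)
    interpret prob_space "P N" using prob_space_P elim by simp
    define s where "s j = (\<Sum>k\<in>UNIV. p N j k * (\<integral>z. g z \<partial>F k))" for j
    define G where "G j \<omega> = X N j \<omega> $ i * X N j \<omega> $ l" for j \<omega>
    define W where "W j \<omega> = a N j / real N * (G j \<omega> - s j)" for j \<omega>
    have sum_W: "gram N \<omega> $ i $ l / real N - second_moments (F m) $ i $ l = (\<Sum>j=1..N. W j \<omega>)" for \<omega>
    proof -
      have "(\<Sum>j=1..N. a N j * s j) = (\<Sum>k\<in>UNIV. (\<Sum>j=1..N. a N j * p N j k) * (\<integral>z. g z \<partial>F k))"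
        unfolding s_def sum_distrib_left sum_distrib_right by (subst sum.swap) (simp add: mult_ac)
      also have "\<dots> = (\<Sum>k\<in>UNIV. if k = m then real N * (\<integral>z. g z \<partial>F k) else 0)"
        unfolding sum_weight_concentration[OF conjunct2[OF elim(1)] conjunct1[OF elim(1)]]
        by (intro sum.cong) auto
      also have "\<dots> = real N * second_moments (F m) $ i $ l" by (simp add: gD)
      finally have "(\<Sum>j=1..N. a N j * s j) = real N * second_moments (F m) $ i $ l" .
      moreover have "gram N \<omega> $ i $ l = (\<Sum>j=1..N. a N j * G j \<omega>)"
        by (simp add: gram_def weighted_gram_def G_def mult_ac)
      moreover have "(\<Sum>j=1..N. W j \<omega>) = ((\<Sum>j=1..N. a N j * G j \<omega>) - (\<Sum>j=1..N. a N j * s j)) / real N"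
        by (simp add: W_def right_diff_distrib sum_subtractf sum_divide_distrib diff_divide_distrib)
      ultimately show ?thesis using elim by (simp add: diff_divide_distrib)
    qed
    have indep: "indep_vars (\<lambda>_. borel) W {1..N}"
    proof -
      have "indep_vars (\<lambda>_. borel)
          (\<lambda>j \<omega>. (\<lambda>q. a N j / real N * (snd (snd q) $ i * snd (snd q) $ l - s j)) (\<kappa> N j \<omega>, Y N j \<omega>, X N j \<omega>)) {1..N}"
      proof (rule indep_vars_compose2[OF independent_subjects])
        fix j
        have "(\<lambda>q. snd (snd q)) \<in> measurable (count_space (UNIV :: 'k set) \<Otimes>\<^sub>M (borel :: (real \<times> (real ^ 'd)) measure)) borel"
          unfolding borel_prod[symmetric] by measurable
        then have [measurable]: "(\<lambda>q. snd (snd q) $ r) \<in>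
            measurable (count_space (UNIV :: 'k set) \<Otimes>\<^sub>M (borel :: (real \<times> (real ^ 'd)) measure)) borel" for r
          by (rule measurable_compose) (intro borel_measurable_continuous_onI continuous_intros)
        show "(\<lambda>q. a N j / real N * (snd (snd q) $ i * snd (snd q) $ l - s j))
            \<in> measurable (count_space (UNIV :: 'k set) \<Otimes>\<^sub>M (borel :: (real \<times> (real ^ 'd)) measure)) borel"
          by measurable
      qed (use elim in simp)
      then show ?thesis by (simp add: W_def[abs_def] G_def)
    qed
    have W: "integrable (P N) (\<lambda>\<omega>. (W j \<omega>)\<^sup>2)" "expectation (W j) = 0"
        "expectation (\<lambda>\<omega>. (W j \<omega>)\<^sup>2) \<le> K\<^sup>2 * C / (real N)\<^sup>2" if j: "j \<in> {1..N}" for j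
    proof -
      have 1: "integrable (P N) (G j)" "expectation (G j) = s j"
        using expectation_by_component[OF j, of "\<lambda>_. g", OF g_int(1)]
        by (auto simp: has_bochner_integral_iff g_def G_def[abs_def] s_def)
      have 2: "integrable (P N) (\<lambda>\<omega>. (G j \<omega>)\<^sup>2)" "expectation (\<lambda>\<omega>. (G j \<omega>)\<^sup>2) = (\<Sum>k\<in>UNIV. p N j k * (\<integral>z. (g z)\<^sup>2 \<partial>F k))"
        using expectation_by_component[OF j, of "\<lambda>_ z. (g z)\<^sup>2", OF g_int(2)]
        by (auto simp: has_bochner_integral_iff g_def G_def[abs_def])
      show "expectation (W j) = 0"
        unfolding W_def using 1 prob_space by simp
      have sq: "(W j \<omega>)\<^sup>2 = (a N j)\<^sup>2 / (real N)\<^sup>2 * ((G j \<omega>)\<^sup>2 - 2 * s j * G j \<omega> + (s j)\<^sup>2)" for \<omega>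
        by (simp add: W_def power_mult_distrib power_divide power2_diff)
      show "integrable (P N) (\<lambda>\<omega>. (W j \<omega>)\<^sup>2)"
        unfolding sq using 1 2 by simp
      have "expectation (\<lambda>\<omega>. (G j \<omega>)\<^sup>2 - 2 * s j * G j \<omega> + (s j)\<^sup>2)
          = (\<Sum>k\<in>UNIV. p N j k * (\<integral>z. (g z)\<^sup>2 \<partial>F k)) - (s j)\<^sup>2"
        using 1 2 prob_space by (simp add: power2_eq_square)
      also have "\<dots> \<le> (\<Sum>k\<in>UNIV. p N j k * (\<integral>z. (g z)\<^sup>2 \<partial>F k))"
        by simp
      also have "\<dots> \<le> (\<Sum>k\<in>UNIV. 1 * (\<integral>z. (g z)\<^sup>2 \<partial>F k))"
        using concentration_bounds[OF j] by (intro sum_mono mult_right_mono) auto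
      finally have G: "expectation (\<lambda>\<omega>. (G j \<omega>)\<^sup>2 - 2 * s j * G j \<omega> + (s j)\<^sup>2) \<le> C"
        by (simp add: C_def)
      have "expectation (\<lambda>\<omega>. (W j \<omega>)\<^sup>2) = (a N j)\<^sup>2 / (real N)\<^sup>2 * expectation (\<lambda>\<omega>. (G j \<omega>)\<^sup>2 - 2 * s j * G j \<omega> + (s j)\<^sup>2)"
        unfolding sq by simp
      also have "\<dots> \<le> K\<^sup>2 / (real N)\<^sup>2 * C"
      proof (rule mult_mono[OF divide_right_mono G])
        show "(a N j)\<^sup>2 \<le> K\<^sup>2"
          using elim(2) j K(1) by (simp add: abs_le_square_iff[symmetric])
        show "0 \<le> expectation (\<lambda>\<omega>. (G j \<omega>)\<^sup>2 - 2 * s j * G j \<omega> + (s j)\<^sup>2)"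
        proof (rule Bochner_Integration.integral_nonneg)
          show "0 \<le> (G j \<omega>)\<^sup>2 - 2 * s j * G j \<omega> + (s j)\<^sup>2" for \<omega>
            using zero_le_power2[of "G j \<omega> - s j"] by (simp add: power2_diff mult_ac)
        qed
      qed simp_all
      finally show "expectation (\<lambda>\<omega>. (W j \<omega>)\<^sup>2) \<le> K\<^sup>2 * C / (real N)\<^sup>2" by simp
    qed
    have "(\<Sum>j=1..N. expectation (\<lambda>\<omega>. (W j \<omega>)\<^sup>2)) \<le> (\<Sum>j=1..N. K\<^sup>2 * C / (real N)\<^sup>2)"
      by (intro sum_mono W)
    also have "\<dots> = K\<^sup>2 * C / real N" by (simp add: power2_eq_square)
    finally have "(\<Sum>j=1..N. expectation (\<lambda>\<omega>. (W j \<omega>)\<^sup>2)) \<le> K\<^sup>2 * C / real N" .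
    then show ?case
      unfolding sum_W
      using integrable_square_sum_indep[OF finite_atLeastAtMost indep W(1,2)]
        expectation_square_sum_indep[OF finite_atLeastAtMost indep W(1,2)] by simp
  qed
  then show "\<forall>\<^sub>F N in sequentially. integrable (P N) (\<lambda>\<omega>. (gram N \<omega> $ i $ l / real N - second_moments (F m) $ i $ l)\<^sup>2)"
    by eventually_elim simp
  have lim: "(\<lambda>N. K\<^sup>2 * C / real N) \<longlonglongrightarrow> 0"
    by (rule lim_const_over_n)
  show "(\<lambda>N. \<integral>\<omega>. (gram N \<omega> $ i $ l / real N - second_moments (F m) $ i $ l)\<^sup>2 \<partial>P N) \<longlonglongrightarrow> 0"
    by (rule tendsto_sandwich[OF always_eventually eventually_mono[OF main conjunct2] tendsto_const lim]) auto
qed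

lemma gram_converges_in_probability:
  assumes "\<delta> > 0" "e > 0"
  shows "\<forall>\<^sub>F N in sequentially.
    measure (P N) {\<omega> \<in> space (P N). \<not> (\<forall>i l. \<bar>gram N \<omega> $ i $ l / real N - second_moments (F m) $ i $ l\<bar> \<le> \<delta>)} \<le> e"
proof -
  define q where "q N \<omega> = (\<Sum>i\<in>UNIV. \<Sum>l\<in>UNIV. (gram N \<omega> $ i $ l / real N - second_moments (F m) $ i $ l)\<^sup>2)" for N \<omega>
  have ints: "\<forall>\<^sub>F N in sequentially. \<forall>i l. integrable (P N) (\<lambda>\<omega>. (gram N \<omega> $ i $ l / real N - second_moments (F m) $ i $ l)\<^sup>2)"
    using gram_square_integrable by (simp add: eventually_all_finite)
  have "(\<lambda>N. \<Sum>i\<in>UNIV. \<Sum>l\<in>UNIV. \<integral>\<omega>. (gram N \<omega> $ i $ l / real N - second_moments (F m) $ i $ l)\<^sup>2 \<partial>P N) \<longlonglongrightarrow> 0"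
    by (intro tendsto_null_sum gram_mean_square_tendsto)
  then have "\<forall>\<^sub>F N in sequentially. (\<Sum>i\<in>UNIV. \<Sum>l\<in>UNIV. \<integral>\<omega>. (gram N \<omega> $ i $ l / real N - second_moments (F m) $ i $ l)\<^sup>2 \<partial>P N) < \<delta>\<^sup>2 * e"
    using assms by (intro order_tendstoD(2)) auto
  with ints eventually_ge_at_top[of 1] show ?thesis
  proof eventually_elim
    case (elim N)
    interpret prob_space "P N" using prob_space_P elim by simp
    have q_nonneg: "0 \<le> q N \<omega>" for \<omega>
      by (simp add: q_def sum_nonneg)
    have q: "integrable (P N) (q N)" "expectation (q N) \<le> \<delta>\<^sup>2 * e"
      using elim by (auto simp: q_def[abs_def])
    have "prob {\<omega> \<in> space (P N). \<not> (\<forall>i l. \<bar>gram N \<omega> $ i $ l / real N - second_moments (F m) $ i $ l\<bar> \<le> \<delta>)}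
        \<le> prob {\<omega> \<in> space (P N). q N \<omega> \<ge> \<delta>\<^sup>2}"
    proof (rule finite_measure_mono)
      show "{\<omega> \<in> space (P N). q N \<omega> \<ge> \<delta>\<^sup>2} \<in> events"
        using borel_measurable_integrable[OF q(1)] by measurable
      show "{\<omega> \<in> space (P N). \<not> (\<forall>i l. \<bar>gram N \<omega> $ i $ l / real N - second_moments (F m) $ i $ l\<bar> \<le> \<delta>)}
          \<subseteq> {\<omega> \<in> space (P N). q N \<omega> \<ge> \<delta>\<^sup>2}"
      proof safe
        fix \<omega> i l assume "\<not> \<bar>gram N \<omega> $ i $ l / real N - second_moments (F m) $ i $ l\<bar> \<le> \<delta>"
        then have "\<delta>\<^sup>2 \<le> (gram N \<omega> $ i $ l / real N - second_moments (F m) $ i $ l)\<^sup>2"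
          using assms(1) by (simp add: abs_le_square_iff[symmetric])
        also have "\<dots> \<le> (\<Sum>l\<in>UNIV. (gram N \<omega> $ i $ l / real N - second_moments (F m) $ i $ l)\<^sup>2)"
          by (rule member_le_sum) auto
        also have "\<dots> \<le> q N \<omega>"
          unfolding q_def by (rule member_le_sum) (auto intro: sum_nonneg)
        finally show "\<delta>\<^sup>2 \<le> q N \<omega>" .
      qed
    qed
    also have "\<dots> \<le> expectation (q N) / \<delta>\<^sup>2"
      using q(1) assms(1)
      by (intro integral_Markov_inequality_measure[where A = "{}"]) (auto simp: q_nonneg)
    also have "\<dots> \<le> e" using q(2) assms by (simp add: field_simps)
    finally show ?case .
  qed
qed

text \<open>
  The solution of the normal equations in which the Gram matrix is replaced by its limit.
\<close>

definition leading_term :: "nat \<Rightarrow> 'w \<Rightarrow> real ^ 'd" where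
  "leading_term N \<omega> = matrix_inv (second_moments (F m)) *v score_sum N \<omega>"

lemma inner_leading_term:
  "t \<bullet> leading_term N \<omega> = (matrix_inv (second_moments (F m)) *v t) \<bullet> score_sum N \<omega>"
  unfolding leading_term_def inner_matrix_vector_mult
  by (simp only: transpose_matrix_inv_symmetric[OF nonsingular transpose_second_moments])

lemma measurable_leading_term: "leading_term N \<in> borel_measurable (P N)"
  unfolding leading_term_def
  by (rule measurable_compose[OF measurable_score_sum])
    (intro borel_measurable_continuous_onI matrix_vector_mult_linear_continuous_on)

lemma covariance_quadratic_form:
  defines "D' \<equiv> matrix_inv (second_moments (F m))"
  shows "t \<bullet> (asymptotic_covariance p b F m *v t) = (D' *v t) \<bullet> (Sigma_matrix p b F m *v (D' *v t))"
proof -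
  have "t \<bullet> (asymptotic_covariance p b F m *v t) = t \<bullet> (D' *v (Sigma_matrix p b F m *v (D' *v t)))"
    by (simp add: asymptotic_covariance_def D'_def matrix_vector_mul_assoc matrix_mul_assoc)
  also have "\<dots> = (D' *v t) \<bullet> (Sigma_matrix p b F m *v (D' *v t))"
    unfolding inner_matrix_vector_mult[of t D']
    by (simp only: D'_def transpose_matrix_inv_symmetric[OF nonsingular transpose_second_moments])
  finally show ?thesis .
qed

lemma Sigma_psd: "0 \<le> c \<bullet> (Sigma_matrix p b F m *v c)"
  by (rule tendsto_lowerbound[OF score_sum_second_moment_tendsto]) auto

lemma asymptotic_covariance_symmetric:
  "asymptotic_covariance p b F m $ i $ j = asymptotic_covariance p b F m $ j $ i"
proof -
  have "transpose (asymptotic_covariance p b F m) = asymptotic_covariance p b F m"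
    by (simp add: asymptotic_covariance_def matrix_transpose_mul transpose_Sigma_matrix matrix_mul_assoc
        transpose_matrix_inv_symmetric[OF nonsingular transpose_second_moments])
  then show ?thesis
    by (metis (no_types, lifting) transpose_def vec_lambda_beta)
qed

lemma leading_term_tight:
  assumes "e > 0"
  shows "\<exists>R>0. \<forall>\<^sub>F N in sequentially. measure (P N) {\<omega> \<in> space (P N). norm (leading_term N \<omega>) > R} \<le> e"
proof -
  define c where "c i = matrix_inv (second_moments (F m)) *v axis i 1" for i :: 'd
  define L where "L = (\<Sum>i\<in>UNIV. c i \<bullet> (Sigma_matrix p b F m *v c i))"
  have L0: "0 \<le> L" unfolding L_def by (intro sum_nonneg Sigma_psd)
  have norm_sq: "(norm (leading_term N \<omega>))\<^sup>2 = (\<Sum>i\<in>UNIV. (c i \<bullet> score_sum N \<omega>)\<^sup>2)" for N \<omega>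
  proof -
    have "leading_term N \<omega> $ i = c i \<bullet> score_sum N \<omega>" for i
      using inner_leading_term[of "axis i 1" N \<omega>] by (simp add: c_def inner_axis')
    then show ?thesis
      by (simp add: norm_vec_def L2_set_def sum_nonneg)
  qed
  have ints: "\<forall>\<^sub>F N in sequentially. \<forall>i. integrable (P N) (\<lambda>\<omega>. (c i \<bullet> score_sum N \<omega>)\<^sup>2)"
    using score_sum_square_integrable by (simp add: eventually_all_finite)
  have "(\<lambda>N. \<Sum>i\<in>UNIV. \<integral>\<omega>. (c i \<bullet> score_sum N \<omega>)\<^sup>2 \<partial>P N) \<longlonglongrightarrow> L"
    unfolding L_def by (intro tendsto_sum score_sum_second_moment_tendsto)
  then have bound: "\<forall>\<^sub>F N in sequentially. (\<Sum>i\<in>UNIV. \<integral>\<omega>. (c i \<bullet> score_sum N \<omega>)\<^sup>2 \<partial>P N) < L + 1"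
    by (intro order_tendstoD(2)) auto
  define R where "R = sqrt ((L + 1) / e)"
  have R: "R > 0" "R\<^sup>2 = (L + 1) / e" using L0 assms by (simp_all add: R_def)
  have "\<forall>\<^sub>F N in sequentially. measure (P N) {\<omega> \<in> space (P N). norm (leading_term N \<omega>) > R} \<le> e"
    using ints bound eventually_ge_at_top[of 1]
  proof eventually_elim
    case (elim N)
    interpret prob_space "P N" using prob_space_P elim by simp
    note [measurable] = measurable_leading_term[of N]
    have int: "integrable (P N) (\<lambda>\<omega>. (norm (leading_term N \<omega>))\<^sup>2)"
        "expectation (\<lambda>\<omega>. (norm (leading_term N \<omega>))\<^sup>2) < L + 1"
      unfolding norm_sq using elim by auto
    have "prob {\<omega> \<in> space (P N). norm (leading_term N \<omega>) > R} \<le> prob {\<omega> \<in> space (P N). \<bar>norm (leading_term N \<omega>)\<bar> \<ge> R}"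
      by (rule finite_measure_mono) auto
    also have "\<dots> \<le> expectation (\<lambda>\<omega>. (norm (leading_term N \<omega>))\<^sup>2) / R\<^sup>2"
      using int(1) R(1) by (intro second_moment_method) auto
    also have "\<dots> \<le> e"
    proof -
      have "expectation (\<lambda>\<omega>. (norm (leading_term N \<omega>))\<^sup>2) \<le> e * R\<^sup>2"
        using int(2) assms by (simp add: R(2))
      then show ?thesis using R(1) by (simp add: divide_le_eq)
    qed
    finally show ?case .
  qed
  with R(1) show ?thesis by blast
qed

text \<open>
  Outside two events of small probability, the entries of the normalised Gram matrix are close to their
  limits and the leading term is bounded.  There the Gram matrix is invertible, so the estimator solves
  the normal equations, and the perturbation bound for linear systems applies.
\<close>

lemma estimator_close_to_leading_term:
  assumes est: "mvc_ls_estimator P X Y p m bhat" and "\<eta> > 0" "e > 0"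
  shows "\<forall>\<^sub>F N in sequentially. measure (P N)
    {\<omega> \<in> space (P N). norm (sqrt (real N) *\<^sub>R (bhat N \<omega> - b m) - leading_term N \<omega>) > \<eta>} \<le> e"
proof -
  define D where "D = second_moments (F m)"
  define c where "c = onorm ((*v) (matrix_inv D)) * (real CARD('d) * real CARD('d))"
  have c0: "c \<ge> 0"
    unfolding c_def by (intro mult_nonneg_nonneg onorm_pos_le matrix_vector_mul_bounded_linear) auto
  obtain R where R: "R > 0" "\<forall>\<^sub>F N in sequentially. measure (P N) {\<omega> \<in> space (P N). norm (leading_term N \<omega>) > R} \<le> e / 2"
    using leading_term_tight[of "e / 2"] assms(3) by auto
  \<comment> \<open>The perturbation bound is \<open>2 c \<delta>\<close> times the norm of the leading term and needs \<open>c \<delta> \<le> 1/2\<close>.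
    Dividing by \<open>c + 1\<close> instead of \<open>c\<close> covers the case \<open>c = 0\<close>.\<close>
  define r where "r = min (1 / 2) (\<eta> / (2 * R))"
  define \<delta> where "\<delta> = r / (c + 1)"
  have r: "r > 0" "r \<le> 1 / 2" "2 * r * R \<le> \<eta>"
    using R(1) assms(2) by (auto simp: r_def min_def field_simps)
  have \<delta>: "\<delta> > 0" "c * \<delta> \<le> r"
    using r c0 by (simp_all add: \<delta>_def field_simps)
  have gram: "\<forall>\<^sub>F N in sequentially. measure (P N)
      {\<omega> \<in> space (P N). \<not> (\<forall>i l. \<bar>gram N \<omega> $ i $ l / real N - second_moments (F m) $ i $ l\<bar> \<le> \<delta>)} \<le> e / 2"
    using gram_converges_in_probability[OF \<delta>(1), of "e / 2"] assms(3) by simp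
  show ?thesis
    using gram R(2) eventually_regular
  proof eventually_elim
    case (elim N)
    interpret prob_space "P N" using prob_space_P elim by simp
    have N: "N \<ge> 1" "invertible (Gamma_matrix p N)" using elim by auto
    define T where "T \<omega> = sqrt (real N) *\<^sub>R (bhat N \<omega> - b m)" for \<omega>
    define bad where "bad = {\<omega> \<in> space (P N). \<not> (\<forall>i l. \<bar>gram N \<omega> $ i $ l / real N - second_moments (F m) $ i $ l\<bar> \<le> \<delta>)}"
    define far where "far = {\<omega> \<in> space (P N). norm (leading_term N \<omega>) > R}"
    note [measurable] = measurable_leading_term[of N]
    have gram_meas: "(\<lambda>\<omega>. gram N \<omega> $ i $ l) \<in> borel_measurable (P N)" for i l
    proof -
      have "(\<lambda>\<omega>. X N j \<omega> $ r) \<in> borel_measurable (P N)" if "j \<in> {1..N}" for j r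
        by (rule measurable_compose[OF measurable_response(2)[OF that]])
          (intro borel_measurable_continuous_onI continuous_intros)
      then show ?thesis
        unfolding gram_def weighted_gram_def vec_lambda_beta
        by (intro borel_measurable_sum borel_measurable_times borel_measurable_const)
    qed
    have [measurable]: "bad \<in> events" "far \<in> events"
      unfolding bad_def far_def using gram_meas by measurable
    have "norm (T \<omega> - leading_term N \<omega>) \<le> \<eta>" if \<omega>: "\<omega> \<in> space (P N)" "\<omega> \<notin> bad" "\<omega> \<notin> far" for \<omega>
    proof -
      define H where "H = (1 / real N) *\<^sub>R gram N \<omega>"
      have entries: "\<bar>H $ i $ l - D $ i $ l\<bar> \<le> \<delta>" for i l
        using \<omega> by (auto simp: bad_def H_def D_def)
      have small: "c * \<delta> \<le> 1 / 2" using \<delta>(2) r(2) by linarith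
      note pert = perturbed_linear_system[OF nonsingular[folded D_def] entries small[unfolded c_def]]
      have gram_H: "gram N \<omega> = real N *\<^sub>R H" using N by (simp add: H_def)
      have inv: "invertible (gram N \<omega>)"
        unfolding gram_H by (rule scalar_invertible[OF _ pert(1)]) (use N in simp)
      let ?h = "weighted_cross N (a N) (\<lambda>j. X N j \<omega>) (\<lambda>j. Y N j \<omega>)"
      have "bhat N \<omega> = matrix_inv (gram N \<omega>) *v ?h"
        using est N \<omega>(1) inv unfolding mvc_ls_estimator_def Let_def gram_def by blast
      then have "gram N \<omega> *v bhat N \<omega> = ?h"
        by (simp add: matrix_vector_mul_assoc matrix_inv_mult(1)[OF inv])
      then have "gram N \<omega> *v (bhat N \<omega> - b m) = ?h - gram N \<omega> *v b m"
        by (simp add: matrix_vector_mult_diff_distrib)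
      also have "\<dots> = (\<Sum>j=1..N. a N j *\<^sub>R score N j \<omega>)"
      proof (subst vec_eq_iff, intro allI)
        fix i
        have "(gram N \<omega> *v b m) $ i = (\<Sum>j=1..N. X N j \<omega> $ i * a N j * (b m \<bullet> X N j \<omega>))"
          unfolding gram_def weighted_gram_def matrix_vector_mult_def inner_vec_def
          by (simp add: sum_distrib_left sum_distrib_right) (subst sum.swap, simp add: mult_ac)
        then show "(?h - gram N \<omega> *v b m) $ i = (\<Sum>j=1..N. a N j *\<^sub>R score N j \<omega>) $ i"
          by (simp add: weighted_cross_def score_def algebra_simps sum_subtractf)
      qed
      finally have "gram N \<omega> *v (bhat N \<omega> - b m) = sqrt (real N) *\<^sub>R score_sum N \<omega>"
        using N by (simp add: score_sum_def)
      then have "H *v T \<omega> = (sqrt (real N) * sqrt (real N) / real N) *\<^sub>R score_sum N \<omega>"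
        by (simp add: H_def T_def matrix_vector_mult_scaleR flip: scaleR_matrix_vector_assoc)
      then have "H *v T \<omega> = score_sum N \<omega>" using N by simp
      from pert(2)[OF this] have "norm (T \<omega> - leading_term N \<omega>) \<le> 2 * (c * \<delta>) * norm (leading_term N \<omega>)"
        unfolding leading_term_def c_def D_def .
      also have "\<dots> \<le> 2 * r * R"
        using \<delta> c0 r(1) \<omega> by (intro mult_mono) (auto simp: far_def)
      finally show ?thesis using r(3) by simp
    qed
    then have "prob {\<omega> \<in> space (P N). norm (T \<omega> - leading_term N \<omega>) > \<eta>} \<le> prob (bad \<union> far)"
      by (intro finite_measure_mono) (auto simp: not_le[symmetric])
    also have "\<dots> \<le> prob bad + prob far"
      by (rule measure_Un_le) measurable
    also have "\<dots> \<le> e" using elim by (simp add: bad_def far_def)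
    finally show ?case by (simp add: T_def)
  qed
qed

theorem estimator_asymptotically_normal:
  assumes est: "mvc_ls_estimator P X Y p m bhat"
  shows "\<exists>\<nu>. is_normal_distribution \<nu> 0 (asymptotic_covariance p b F m) \<and>
    converges_weakly (\<lambda>N. distr (P N) borel (\<lambda>\<omega>. sqrt (real N) *\<^sub>R (bhat N \<omega> - b m))) \<nu>"
proof -
  let ?V = "asymptotic_covariance p b F m"
  have psd: "0 \<le> t \<bullet> (?V *v t)" for t
    unfolding covariance_quadratic_form by (rule Sigma_psd)
  obtain \<nu> where \<nu>: "is_normal_distribution \<nu> 0 ?V" "prob_space \<nu>" "sets \<nu> = sets borel"
    "\<And>t. (\<integral>x. iexp (t \<bullet> x) \<partial>\<nu>) = exp (- (t \<bullet> (?V *v t)) / 2)"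
    using centred_normal_distribution[OF asymptotic_covariance_symmetric psd] by blast
  have "converges_weakly (\<lambda>N. distr (P N) borel (\<lambda>\<omega>. sqrt (real N) *\<^sub>R (bhat N \<omega> - b m))) \<nu>"
  proof (rule converges_weakly_perturbed[where U = leading_term, OF _ \<nu>(2,3)])
    show "\<forall>\<^sub>F N in sequentially. prob_space (P N) \<and>
        (\<lambda>\<omega>. sqrt (real N) *\<^sub>R (bhat N \<omega> - b m)) \<in> borel_measurable (P N) \<and> leading_term N \<in> borel_measurable (P N)"
      using eventually_ge_at_top[of 1]
    proof eventually_elim
      case (elim N)
      have [measurable]: "bhat N \<in> borel_measurable (P N)"
        using est elim by (simp add: mvc_ls_estimator_def)
      show ?case
        using prob_space_P[OF elim] measurable_leading_term by simp
    qed
    show "(\<lambda>N. \<integral>\<omega>. iexp (t \<bullet> leading_term N \<omega>) \<partial>P N) \<longlonglongrightarrow> (\<integral>x. iexp (t \<bullet> x) \<partial>\<nu>)" for t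
      unfolding inner_leading_term \<nu>(4) covariance_quadratic_form by (rule score_sum_char_tendsto)
    show "\<exists>R. \<forall>\<^sub>F N in sequentially. measure (P N) {\<omega> \<in> space (P N). norm (leading_term N \<omega>) > R} \<le> e" if "e > 0" for e
      using leading_term_tight[OF that] by blast
    show "\<forall>\<^sub>F N in sequentially. measure (P N)
        {\<omega> \<in> space (P N). norm (sqrt (real N) *\<^sub>R (bhat N \<omega> - b m) - leading_term N \<omega>) > \<eta>} \<le> e"
      if "\<eta> > 0" "e > 0" for \<eta> e
      by (rule estimator_close_to_leading_term[OF est that])
  qed
  with \<nu>(1) show ?thesis by blast
qed

end

theorem theorem2:
  fixes P :: "nat \<Rightarrow> 'w measure"
    and \<kappa> :: "nat \<Rightarrow> nat \<Rightarrow> 'w \<Rightarrow> 'k::finite"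
    and X :: "nat \<Rightarrow> nat \<Rightarrow> 'w \<Rightarrow> real ^ 'd"
    and \<epsilon> :: "nat \<Rightarrow> nat \<Rightarrow> 'w \<Rightarrow> real"
    and Y :: "nat \<Rightarrow> nat \<Rightarrow> 'w \<Rightarrow> real"
    and p :: "nat \<Rightarrow> nat \<Rightarrow> 'k \<Rightarrow> real"
    and b :: "'k \<Rightarrow> real ^ 'd"
    and F :: "'k \<Rightarrow> ((real ^ 'd) \<times> real) measure"
    and m :: 'k
    and bhat :: "nat \<Rightarrow> 'w \<Rightarrow> real ^ 'd"
  assumes model: "mixture_regression P \<kappa> X \<epsilon> Y p b F"
    and estimator: "mvc_ls_estimator P X Y p m bhat"
    and regressor_moments: "\<And>k i. integrable (F k) (\<lambda>z. (fst z $ i) ^ 4)"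
    and error_moments: "\<And>k. integrable (F k) (\<lambda>z. (snd z) ^ 4)"
    and nonsingular: "invertible (second_moments (F m))"
    and concentrations: "\<exists>C>0. eventually (\<lambda>N. det (Gamma_matrix p N) > C) sequentially"
    and limits: "\<And>s r. convergent (average (\<lambda>N j. (weight p m N j)\<^sup>2 * p N j s * p N j r))"
  shows "\<exists>\<nu>. is_normal_distribution \<nu> 0 (asymptotic_covariance p b F m) \<and>
           converges_weakly
             (\<lambda>N. distr (P N) borel (\<lambda>\<omega>. sqrt (real N) *\<^sub>R (bhat N \<omega> - b m))) \<nu>"
proof -
  interpret mixture_regression P \<kappa> X \<epsilon> Y p b F by (rule model)
  interpret mvc_ls_setting P \<kappa> X \<epsilon> Y p b F m
    by unfold_locales (fact regressor_moments error_moments nonsingular concentrations limits)+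
  show ?thesis
    by (rule estimator_asymptotically_normal[OF estimator])
qed

end
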